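(* Let $\mathcal{F}=\{(\Omega_n,K_n,\pi_n)\mid n=1,2,\dots\}$ be a family of irreducible and positive recurrent Markov chains on countable state spaces, and let $\delta\in(0,1)$. Let $\mathcal{F}_\delta$ be the family of associated $\delta$-lazy walks and $\mathcal{F}_c$ the family of associated continuous time semigroups. Suppose $T^{(c)}_{n,\mathrm{TV}}(\epsilon_0)\to\infty$ as $n\to\infty$ for some $\epsilon_0\in(0,1)$. Then the following are equivalent: (1) $\mathcal{F}_\delta$ has a cutoff in total variation. (2) $\mathcal{F}_c$ has a cutoff in total variation. Furthermore, if $\mathcal{F}_c$ has a cutoff in total variation, then $$\lim_{n\to\infty}\frac{T^{(c)}_{n,\mathrm{TV}}(\epsilon)}{T^{(\delta)}_{n,\mathrm{TV}}(\epsilon)}=1-\delta,\qquad\forall \epsilon\in(0,1).$$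
   Context: A triple $(\Omega,K,\pi)$ consists of a countable set $\Omega$, a transition (stochastic) matrix $K$ on $\Omega$, and its stationary probability distribution $\pi$. For $\delta\in(0,1)$ the $\delta$-lazy walk is the discrete time chain with matrix $K_\delta=\delta I+(1-\delta)K$, and the associated continuous time semigroup is $H_t=e^{-t(I-K)}=\sum_{i\ge0}e^{-t}\frac{t^i}{i!}K^i$, $t\ge0$. Total variation: $\|\mu-\nu\|_{\mathrm{TV}}=\sup_{A\subset\Omega}\{\mu(A)-\nu(A)\}$. Set $$d^{(\delta)}_{\mathrm{TV}}(m)=\sup_{x\in\Omega}\|K_\delta^m(x,\cdot)-\pi\|_{\mathrm{TV}}\ (m\in\{0,1,2,\dots\}),\qquad d^{(c)}_{\mathrm{TV}}(t)=\sup_{x\in\Omega}\|H_t(x,\cdot)-\pi\|_{\mathrm{TV}}\ (t\in[0,\infty)),$$ $T^{(\delta)}_{\mathrm{TV}}(\epsilon)=\inf\{m\in\mathbb{Z}_{\ge0}: d^{(\delta)}_{\mathrm{TV}}(m)\le\epsilon\}$ and $T^{(c)}_{\mathrm{TV}}(\epsilon)=\inf\{t\ge0: d^{(c)}_{\mathrm{TV}}(t)\le\epsilon\}$ (with $\inf\emptyset=\infty$). A subscript $n$ refers to the $n$-th chain of the family. A family with mixing times $T_{n,\mathrm{TV}}$ has a cutoff in total variation if $\lim_{n\to\infty}T_{n,\mathrm{TV}}(\epsilon)/T_{n,\mathrm{TV}}(\eta)=1$ for all $0<\epsilon<\eta<1$ (this includes that, for each such pair, the two quantities are finite and positive for all large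 $n$). This is applied with $T^{(\delta)}_{n,\mathrm{TV}}$ for $\mathcal{F}_\delta$ and with $T^{(c)}_{n,\mathrm{TV}}$ for $\mathcal{F}_c$. *)

theory Defs
  imports "HOL-Analysis.Analysis"
begin

text \<open>
  A matrix on a countable set \<open>\<Omega>\<close> is a function \<open>'a \<Rightarrow> 'a \<Rightarrow> real\<close> of which only the
  values on \<open>\<Omega> \<times> \<Omega>\<close> matter. A measure on \<open>\<Omega>\<close> is given by its mass function.
\<close>

definition stochastic_matrix :: "'a set \<Rightarrow> ('a \<Rightarrow> 'a \<Rightarrow> real) \<Rightarrow> bool" where
  "stochastic_matrix \<Omega> K \<longleftrightarrow>
     (\<forall>x\<in>\<Omega>. (\<forall>y\<in>\<Omega>. 0 \<le> K x y) \<and> ((\<lambda>y. K x y) has_sum 1) \<Omega>)"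

definition prob_distribution :: "'a set \<Rightarrow> ('a \<Rightarrow> real) \<Rightarrow> bool" where
  "prob_distribution \<Omega> \<pi> \<longleftrightarrow> (\<forall>x\<in>\<Omega>. 0 \<le> \<pi> x) \<and> (\<pi> has_sum 1) \<Omega>"

definition stationary_distribution :: "'a set \<Rightarrow> ('a \<Rightarrow> 'a \<Rightarrow> real) \<Rightarrow> ('a \<Rightarrow> real) \<Rightarrow> bool" where
  "stationary_distribution \<Omega> K \<pi> \<longleftrightarrow>
     prob_distribution \<Omega> \<pi> \<and> (\<forall>y\<in>\<Omega>. ((\<lambda>x. \<pi> x * K x y) has_sum \<pi> y) \<Omega>)"

primrec mat_pow :: "'a set \<Rightarrow> ('a \<Rightarrow> 'a \<Rightarrow> real) \<Rightarrow> nat \<Rightarrow> 'a \<Rightarrow> 'a \<Rightarrow> real" where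
  "mat_pow \<Omega> K 0 = (\<lambda>x y. if x = y then 1 else 0)"
| "mat_pow \<Omega> K (Suc m) = (\<lambda>x y. \<Sum>\<^sub>\<infinity>z\<in>\<Omega>. K x z * mat_pow \<Omega> K m z y)"

definition irreducible_chain :: "'a set \<Rightarrow> ('a \<Rightarrow> 'a \<Rightarrow> real) \<Rightarrow> bool" where
  "irreducible_chain \<Omega> K \<longleftrightarrow> (\<forall>x\<in>\<Omega>. \<forall>y\<in>\<Omega>. \<exists>m. mat_pow \<Omega> K m x y > 0)"

text \<open>
  \<open>first_passage \<Omega> K m x y\<close> is the probability that the chain started at \<open>x\<close> visits \<open>y\<close>
  at time \<open>m\<close> and at none of the times \<open>1, \<dots>, m - 1\<close>; for \<open>x = y\<close> this is the law of the
  first return time.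
\<close>

fun first_passage :: "'a set \<Rightarrow> ('a \<Rightarrow> 'a \<Rightarrow> real) \<Rightarrow> nat \<Rightarrow> 'a \<Rightarrow> 'a \<Rightarrow> real" where
  "first_passage \<Omega> K 0 x y = 0"
| "first_passage \<Omega> K (Suc 0) x y = K x y"
| "first_passage \<Omega> K (Suc (Suc m)) x y =
     (\<Sum>\<^sub>\<infinity>z\<in>\<Omega> - {y}. K x z * first_passage \<Omega> K (Suc m) z y)"

definition positive_recurrent :: "'a set \<Rightarrow> ('a \<Rightarrow> 'a \<Rightarrow> real) \<Rightarrow> bool" where
  "positive_recurrent \<Omega> K \<longleftrightarrow>
     (\<forall>x\<in>\<Omega>. (\<lambda>m. first_passage \<Omega> K m x x) sums 1 \<and>
            summable (\<lambda>m. real m * first_passage \<Omega> K m x x))"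

definition lazy_matrix :: "real \<Rightarrow> ('a \<Rightarrow> 'a \<Rightarrow> real) \<Rightarrow> 'a \<Rightarrow> 'a \<Rightarrow> real" where
  "lazy_matrix \<delta> K x y = \<delta> * (if x = y then 1 else 0) + (1 - \<delta>) * K x y"

definition semigroup_matrix :: "'a set \<Rightarrow> ('a \<Rightarrow> 'a \<Rightarrow> real) \<Rightarrow> real \<Rightarrow> 'a \<Rightarrow> 'a \<Rightarrow> real" where
  "semigroup_matrix \<Omega> K t x y = (\<Sum>i. exp (- t) * (t ^ i / fact i) * mat_pow \<Omega> K i x y)"

definition tv_dist :: "'a set \<Rightarrow> ('a \<Rightarrow> real) \<Rightarrow> ('a \<Rightarrow> real) \<Rightarrow> real" where
  "tv_dist \<Omega> \<mu> \<nu> = (SUP A\<in>Pow \<Omega>. (\<Sum>\<^sub>\<infinity>y\<in>A. \<mu> y) - (\<Sum>\<^sub>\<infinity>y\<in>A. \<nu> y))"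

definition d_lazy ::
  "real \<Rightarrow> 'a set \<Rightarrow> ('a \<Rightarrow> 'a \<Rightarrow> real) \<Rightarrow> ('a \<Rightarrow> real) \<Rightarrow> nat \<Rightarrow> real" where
  "d_lazy \<delta> \<Omega> K \<pi> m = (SUP x\<in>\<Omega>. tv_dist \<Omega> (mat_pow \<Omega> (lazy_matrix \<delta> K) m x) \<pi>)"

definition d_cont ::
  "'a set \<Rightarrow> ('a \<Rightarrow> 'a \<Rightarrow> real) \<Rightarrow> ('a \<Rightarrow> real) \<Rightarrow> real \<Rightarrow> real" where
  "d_cont \<Omega> K \<pi> t = (SUP x\<in>\<Omega>. tv_dist \<Omega> (semigroup_matrix \<Omega> K t x) \<pi>)"

text \<open>Mixing times are extended reals, with \<open>Inf {} = \<infinity>\<close>.\<close>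

definition T_lazy ::
  "real \<Rightarrow> 'a set \<Rightarrow> ('a \<Rightarrow> 'a \<Rightarrow> real) \<Rightarrow> ('a \<Rightarrow> real) \<Rightarrow> real \<Rightarrow> ereal" where
  "T_lazy \<delta> \<Omega> K \<pi> \<epsilon> = Inf {ereal (real m) | m. d_lazy \<delta> \<Omega> K \<pi> m \<le> \<epsilon>}"

definition T_cont ::
  "'a set \<Rightarrow> ('a \<Rightarrow> 'a \<Rightarrow> real) \<Rightarrow> ('a \<Rightarrow> real) \<Rightarrow> real \<Rightarrow> ereal" where
  "T_cont \<Omega> K \<pi> \<epsilon> = Inf {ereal t | t. 0 \<le> t \<and> d_cont \<Omega> K \<pi> t \<le> \<epsilon>}"

text \<open>
  \<open>T n \<epsilon>\<close> is the mixing time of the \<open>n\<close>-th chain. In \<open>ereal\<close> a quotient of nonnegative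
  numbers that are not both positive and finite is \<open>0\<close> or \<open>\<infinity>\<close>, so a positive finite limit
  of quotients never comes from a degenerate division.
\<close>

definition has_cutoff :: "(nat \<Rightarrow> real \<Rightarrow> ereal) \<Rightarrow> bool" where
  "has_cutoff T \<longleftrightarrow>
     (\<forall>\<epsilon> \<eta>. 0 < \<epsilon> \<and> \<epsilon> < \<eta> \<and> \<eta> < 1 \<longrightarrow>
        (\<forall>\<^sub>F n in sequentially. 0 < T n \<epsilon> \<and> T n \<epsilon> < \<infinity> \<and> 0 < T n \<eta> \<and> T n \<eta> < \<infinity>) \<and>
        (\<lambda>n. T n \<epsilon> / T n \<eta>) \<longlonglongrightarrow> 1)"

end

theory Submission
  imports Defs "HOL-Complex_Analysis.Cauchy_Integral_Formula"
begin

text \<open>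
  Write \<open>p = 1 - \<delta>\<close>. Both walks are mixtures of the powers of \<open>K\<close>: the \<open>m\<close>-th power of the lazy
  kernel is the mixture with binomial weights of mean \<open>p m\<close> and variance \<open>p (1 - p) m\<close>, and \<open>H\<^sub>t\<close>
  is the mixture with Poisson weights of mean and variance \<open>t\<close>. So the natural correspondence is
  \<open>t = p m\<close>, and the theorem says that the fluctuations, of order \<open>\<surd>m\<close>, are invisible on the
  scale of the mixing time once this time tends to infinity. Everything is reduced to statements about
  weights on \<open>\<nat>\<close>: convolving weights with a summable sequence \<open>v\<close> multiplies the distance of the mixture
  to \<open>\<pi>\<close> by at most the \<open>\<ell>\<^sup>1\<close> norm of \<open>v\<close> (\<open>weighted_gap_conv_le\<close>).

  One direction is soft. A Poisson number of lazy steps contains a Poisson number of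
  steps of \<open>K\<close>, so \<open>H\<^bsub>ps\<^esub>\<close> is a Poisson
  mixture, with mean \<open>s\<close>, of powers of the lazy kernel; by Chebyshev almost all of them are powers
  beyond \<open>(1 - \<theta>) s\<close>, and the distance decreases along powers. Hence the continuous distance at
  \<open>p s\<close> is at most the lazy distance at \<open>m \<le> (1 - \<theta>) s\<close> plus \<open>o(1)\<close>
  (\<open>mix_dist_pois_le_mix_dist_bino\<close>).

  The converse has to undo a smoothing: the binomial law is narrower than the Poisson law with the same
  mean. The binomial weights are expanded in iterated differences of the Poisson weights \<open>q\<close> of mean
  \<open>s = p m\<close>. Comparing generating functions, the coefficient of the \<open>k\<close>-th difference is \<open>p\<^sup>k a\<^sub>k\<close>,
  where \<open>e\<^bsup>mz\<^esup> (1 - z)\<^sup>m = \<Sum> a\<^sub>k z\<^sup>k\<close>. On \<open>|z| = r\<close> this function is at most \<open>e\<^bsup>m r r / 2\<^esup>\<close>,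
  so Cauchy's estimate gives \<open>a\<^sub>k\<^sup>2 k! \<le> e (k + 1) m\<^sup>k\<close>. Orthogonality of the Charlier polynomials
  (the quotients of the differences by \<open>q\<close>) bounds the \<open>\<ell>\<^sup>1\<close> norm of the \<open>k\<close>-th difference by
  \<open>\<surd>(k! / s\<^sup>k)\<close>. The two bounds match exactly: the \<open>k\<close>-th term has norm at most \<open>\<surd>(e (k + 1) p\<^sup>k)\<close>, which is
  summable uniformly in \<open>m\<close>, and laziness \<open>p < 1\<close> is what makes the series converge. Truncating, and
  factoring \<open>q\<close> as a Poisson law of mean \<open>s / (1 + \<theta>)\<close> convolved with another one on which the differences
  act, exhibits the binomial weights up to an error \<open>\<eta>\<close> as a convolution of the Poisson
  weights of mean \<open>s / (1 + \<theta>)\<close> with a sequence of norm at most \<open>C(\<theta>, \<eta>)\<close>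
  (\<open>bino_approx_pois_conv\<close>). A small continuous distance at time \<open>p m / (1 + \<theta>)\<close> therefore forces a small
  lazy distance at time \<open>m\<close>.

  Because of the constant \<open>C\<close> that estimate says nothing when the continuous distance is close to \<open>1\<close>.
  There a lower bound on the overlap of the two laws is used: within distance \<open>R \<surd>s\<close> of the
  mean the binomial weights dominate a positive multiple of the Poisson weights
  (\<open>bino_ge_pois_window\<close>), so a continuous distance bounded away from \<open>1\<close> at \<open>p m\<close>
  keeps the lazy distance at \<open>m\<close> bounded away from \<open>1\<close>.

  The three estimates turn into inequalities between mixing times with constants depending only on
  \<open>\<delta>\<close>, the levels and \<open>\<theta>\<close>, and \<open>cutoff_transfer\<close> deduces the theorem from them: under cutoff the
  mixing times at all levels are asymptotically equal, so the change of level in the inequalities is harmless.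
\<close>

section \<open>Sums over a product of two index sets\<close>

lemma summable_on_abs:
  fixes f :: "'i \<Rightarrow> real"
  shows "f summable_on I \<Longrightarrow> (\<lambda>i. \<bar>f i\<bar>) summable_on I"
  by (subst (asm) summable_on_iff_abs_summable_on_real) simp

lemma has_sum_diff_real:
  fixes f g :: "'i \<Rightarrow> real"
  shows "(f has_sum a) I \<Longrightarrow> (g has_sum b) I \<Longrightarrow> ((\<lambda>i. f i - g i) has_sum (a - b)) I"
  using has_sum_add[where f = f and g = "\<lambda>i. - g i" and A = I and a = a and b = "- b"]
  by (simp add: has_sum_uminus)

text \<open>The condition under which infinite sums are interchanged below: the \<open>\<ell>\<^sup>1\<close> norms of the rows
  have a summable majorant.\<close>

lemma summable_on_dominated_family:
  fixes w :: "'i \<Rightarrow> real" and g :: "'i \<Rightarrow> 'j \<Rightarrow> real"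
  assumes w: "w summable_on I"
    and g: "\<And>i. i \<in> I \<Longrightarrow> g i summable_on J"
    and le: "\<And>i. i \<in> I \<Longrightarrow> (\<Sum>\<^sub>\<infinity>j\<in>J. \<bar>g i j\<bar>) \<le> w i"
  shows "(\<lambda>(i, j). g i j) summable_on I \<times> J"
proof -
  have "(\<lambda>x. norm (case x of (i, j) \<Rightarrow> g i j)) summable_on I \<times> J"
  proof (rule Infinite_Sum.abs_summable_on_Sigma_iff[THEN iffD2], intro conjI ballI)
    fix i assume "i \<in> I"
    then show "(\<lambda>j. norm (case (i, j) of (i, j) \<Rightarrow> g i j)) summable_on J"
      using summable_on_abs[OF g] by simp
  next
    have "(\<lambda>i. \<Sum>\<^sub>\<infinity>j\<in>J. norm (case (i, j) of (i, j) \<Rightarrow> g i j)) summable_on I"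
      by (rule summable_on_comparison_test[OF w]) (use le in \<open>auto intro: infsum_nonneg\<close>)
    from summable_on_abs[OF this]
    show "(\<lambda>i. norm (\<Sum>\<^sub>\<infinity>j\<in>J. norm (case (i, j) of (i, j) \<Rightarrow> g i j))) summable_on I"
      by simp
  qed
  then show ?thesis
    by (rule abs_summable_summable)
qed

lemma infsum_dominated_swap:
  fixes w :: "'i \<Rightarrow> real" and g :: "'i \<Rightarrow> 'j \<Rightarrow> real"
  assumes w: "w summable_on I"
    and g: "\<And>i. i \<in> I \<Longrightarrow> g i summable_on J"
    and le: "\<And>i. i \<in> I \<Longrightarrow> (\<Sum>\<^sub>\<infinity>j\<in>J. \<bar>g i j\<bar>) \<le> w i"
  shows "(\<Sum>\<^sub>\<infinity>i\<in>I. \<Sum>\<^sub>\<infinity>j\<in>J. g i j) = (\<Sum>\<^sub>\<infinity>j\<in>J. \<Sum>\<^sub>\<infinity>i\<in>I. g i j)"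
    and "(\<lambda>j. \<Sum>\<^sub>\<infinity>i\<in>I. g i j) summable_on J"
    and "\<And>j. j \<in> J \<Longrightarrow> (\<lambda>i. g i j) summable_on I"
    and "(\<Sum>\<^sub>\<infinity>j\<in>J. \<bar>\<Sum>\<^sub>\<infinity>i\<in>I. g i j\<bar>) \<le> infsum w I"
proof -
  note s = summable_on_dominated_family[OF assms]
  have g': "(\<lambda>j. \<bar>g i j\<bar>) summable_on J" if "i \<in> I" for i
    by (rule summable_on_abs[OF g[OF that]])
  have s': "(\<lambda>(i, j). \<bar>g i j\<bar>) summable_on I \<times> J"
    by (rule summable_on_dominated_family[OF w g']) (use le in auto)
  have cols: "(\<lambda>j. \<Sum>\<^sub>\<infinity>i\<in>I. h i j) summable_on J"
    if "(\<lambda>(i, j). h i j) summable_on I \<times> J" for h :: "'i \<Rightarrow> 'j \<Rightarrow> real"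
  proof -
    have "(\<lambda>(j, i). h i j) summable_on J \<times> I"
      using that by (subst summable_on_swap) (simp add: case_prod_unfold)
    then show ?thesis
      using summable_on_Sigma_banach[of "\<lambda>j i. h i j" J "\<lambda>_. I"] by simp
  qed
  show "(\<Sum>\<^sub>\<infinity>i\<in>I. \<Sum>\<^sub>\<infinity>j\<in>J. g i j) = (\<Sum>\<^sub>\<infinity>j\<in>J. \<Sum>\<^sub>\<infinity>i\<in>I. g i j)"
    by (rule infsum_swap_banach[OF s])
  show "(\<lambda>j. \<Sum>\<^sub>\<infinity>i\<in>I. g i j) summable_on J"
    by (rule cols[OF s])
  have entry: "\<bar>g i j\<bar> \<le> w i" if "i \<in> I" "j \<in> J" for i j
    using finite_sum_le_infsum[OF g'[OF that(1)], of "{j}"] le[OF that(1)] that by simp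
  have col: "(\<lambda>i. \<bar>g i j\<bar>) summable_on I" if "j \<in> J" for j
    by (rule summable_on_comparison_test[OF w]) (use entry that in auto)
  then show "(\<lambda>i. g i j) summable_on I" if "j \<in> J" for j
    using abs_summable_summable[of "\<lambda>i. g i j" I] that by simp
  have "(\<Sum>\<^sub>\<infinity>j\<in>J. \<bar>\<Sum>\<^sub>\<infinity>i\<in>I. g i j\<bar>) \<le> (\<Sum>\<^sub>\<infinity>j\<in>J. \<Sum>\<^sub>\<infinity>i\<in>I. \<bar>g i j\<bar>)"
  proof (rule infsum_mono[OF summable_on_abs[OF cols[OF s]] cols[OF s']])
    show "\<bar>\<Sum>\<^sub>\<infinity>i\<in>I. g i j\<bar> \<le> (\<Sum>\<^sub>\<infinity>i\<in>I. \<bar>g i j\<bar>)" if "j \<in> J" for j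
      using norm_infsum_bound[of "\<lambda>i. g i j" I] col[OF that] by simp
  qed
  also have "\<dots> = (\<Sum>\<^sub>\<infinity>i\<in>I. \<Sum>\<^sub>\<infinity>j\<in>J. \<bar>g i j\<bar>)"
    by (rule infsum_swap_banach[OF s', symmetric])
  also have "\<dots> \<le> infsum w I"
    by (rule infsum_mono[OF _ w le])
       (rule summable_on_comparison_test[OF w], use le in \<open>auto intro: infsum_nonneg\<close>)
  finally show "(\<Sum>\<^sub>\<infinity>j\<in>J. \<bar>\<Sum>\<^sub>\<infinity>i\<in>I. g i j\<bar>) \<le> infsum w I" .
qed

lemma dominated_weighted_row:
  fixes w :: "'i \<Rightarrow> real" and f :: "'i \<Rightarrow> 'j \<Rightarrow> real"
  assumes w: "w summable_on I"
    and f: "\<And>i. i \<in> I \<Longrightarrow> f i summable_on J"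
    and C: "\<And>i. i \<in> I \<Longrightarrow> (\<Sum>\<^sub>\<infinity>j\<in>J. \<bar>f i j\<bar>) \<le> C"
  shows "(\<lambda>i. \<bar>w i\<bar> * C) summable_on I"
    and "\<And>i. i \<in> I \<Longrightarrow> (\<lambda>j. w i * f i j) summable_on J"
    and "\<And>i. i \<in> I \<Longrightarrow> (\<Sum>\<^sub>\<infinity>j\<in>J. \<bar>w i * f i j\<bar>) \<le> \<bar>w i\<bar> * C"
proof -
  show "(\<lambda>i. \<bar>w i\<bar> * C) summable_on I"
    by (rule summable_on_cmult_left[OF summable_on_abs[OF w]])
  fix i assume i: "i \<in> I"
  show "(\<lambda>j. w i * f i j) summable_on J"
    by (rule summable_on_cmult_right[OF f[OF i]])
  have "(\<Sum>\<^sub>\<infinity>j\<in>J. \<bar>w i\<bar> * \<bar>f i j\<bar>) = \<bar>w i\<bar> * (\<Sum>\<^sub>\<infinity>j\<in>J. \<bar>f i j\<bar>)"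
    by (rule infsum_cmult_right) (use summable_on_abs[OF f[OF i]] in simp)
  then show "(\<Sum>\<^sub>\<infinity>j\<in>J. \<bar>w i * f i j\<bar>) \<le> \<bar>w i\<bar> * C"
    using C[OF i] by (simp add: abs_mult mult_left_mono)
qed

lemma infsum_weighted_swap:
  fixes w :: "'i \<Rightarrow> real" and f :: "'i \<Rightarrow> 'j \<Rightarrow> real"
  assumes "w summable_on I"
    and "\<And>i. i \<in> I \<Longrightarrow> f i summable_on J"
    and "\<And>i. i \<in> I \<Longrightarrow> (\<Sum>\<^sub>\<infinity>j\<in>J. \<bar>f i j\<bar>) \<le> C"
  shows "(\<Sum>\<^sub>\<infinity>i\<in>I. w i * (\<Sum>\<^sub>\<infinity>j\<in>J. f i j)) = (\<Sum>\<^sub>\<infinity>j\<in>J. \<Sum>\<^sub>\<infinity>i\<in>I. w i * f i j)"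
    and "(\<lambda>j. \<Sum>\<^sub>\<infinity>i\<in>I. w i * f i j) summable_on J"
proof -
  note swap = infsum_dominated_swap[OF dominated_weighted_row[OF assms]]
  have "(\<Sum>\<^sub>\<infinity>i\<in>I. w i * (\<Sum>\<^sub>\<infinity>j\<in>J. f i j)) = (\<Sum>\<^sub>\<infinity>i\<in>I. \<Sum>\<^sub>\<infinity>j\<in>J. w i * f i j)"
    by (intro infsum_cong infsum_cmult_right[symmetric] assms(2)) auto
  also note swap(1)
  finally show "(\<Sum>\<^sub>\<infinity>i\<in>I. w i * (\<Sum>\<^sub>\<infinity>j\<in>J. f i j)) = (\<Sum>\<^sub>\<infinity>j\<in>J. \<Sum>\<^sub>\<infinity>i\<in>I. w i * f i j)" .
  show "(\<lambda>j. \<Sum>\<^sub>\<infinity>i\<in>I. w i * f i j) summable_on J"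
    by (rule swap(2))
qed

lemma summable_on_mult_bounded:
  fixes w h :: "'i \<Rightarrow> real"
  assumes "w summable_on I" and "\<And>i. i \<in> I \<Longrightarrow> \<bar>h i\<bar> \<le> C"
  shows "(\<lambda>i. w i * h i) summable_on I"
proof -
  have "(\<lambda>i. norm (w i * h i)) summable_on I"
  proof (rule summable_on_comparison_test)
    show "(\<lambda>i. \<bar>w i\<bar> * C) summable_on I"
      by (rule summable_on_cmult_left[OF summable_on_abs[OF assms(1)]])
    show "norm (w i * h i) \<le> \<bar>w i\<bar> * C" if "i \<in> I" for i
      using assms(2)[OF that] by (auto simp: abs_mult intro!: mult_left_mono)
  qed simp
  then show ?thesis
    by (rule abs_summable_summable)
qed

lemma abs_infsum_mult_le:
  fixes w h :: "'i \<Rightarrow> real"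
  assumes w: "w summable_on I" and h: "\<And>i. i \<in> I \<Longrightarrow> \<bar>h i\<bar> \<le> C"
  shows "\<bar>\<Sum>\<^sub>\<infinity>i\<in>I. w i * h i\<bar> \<le> (\<Sum>\<^sub>\<infinity>i\<in>I. \<bar>w i\<bar>) * C"
proof -
  have w': "(\<lambda>i. \<bar>w i\<bar>) summable_on I"
    by (rule summable_on_abs[OF w])
  have s: "(\<lambda>i. \<bar>w i * h i\<bar>) summable_on I"
    by (rule summable_on_abs[OF summable_on_mult_bounded[OF w h]])
  have "\<bar>\<Sum>\<^sub>\<infinity>i\<in>I. w i * h i\<bar> \<le> (\<Sum>\<^sub>\<infinity>i\<in>I. \<bar>w i * h i\<bar>)"
    using norm_infsum_bound[of "\<lambda>i. w i * h i" I] s by simp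
  also have "\<dots> \<le> (\<Sum>\<^sub>\<infinity>i\<in>I. \<bar>w i\<bar> * C)"
    by (rule infsum_mono[OF s summable_on_cmult_left[OF w']])
       (use h in \<open>auto simp: abs_mult intro!: mult_left_mono\<close>)
  also have "\<dots> = (\<Sum>\<^sub>\<infinity>i\<in>I. \<bar>w i\<bar>) * C"
    by (rule infsum_cmult_left) (use w' in simp)
  finally show ?thesis .
qed

definition conv :: "(nat \<Rightarrow> real) \<Rightarrow> (nat \<Rightarrow> real) \<Rightarrow> nat \<Rightarrow> real" where
  "conv f g j = (\<Sum>i\<le>j. f i * g (j - i))"

text \<open>Substituting \<open>j = i + k\<close>. The factor \<open>h\<close> is kept, so that the lemma applies with \<open>h\<close> the
  deviation of the \<open>j\<close>-th power of a kernel from its limit; the inner sum on the right is then the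
  mixture of the shifted deviations.\<close>

lemma conv_weighted_sum:
  assumes f: "f summable_on UNIV" and g: "g summable_on UNIV" and h: "\<And>i. \<bar>h i\<bar> \<le> C"
  shows "(\<Sum>\<^sub>\<infinity>j. conv f g j * h j) = (\<Sum>\<^sub>\<infinity>k. g k * (\<Sum>\<^sub>\<infinity>i. f i * h (i + k)))"
    and "conv f g summable_on UNIV"
proof -
  have f': "(\<lambda>i. \<bar>f i\<bar>) summable_on UNIV"
    by (rule summable_on_abs[OF f])
  have key: "(\<Sum>\<^sub>\<infinity>j. conv f g j * h j) = (\<Sum>\<^sub>\<infinity>k. g k * (\<Sum>\<^sub>\<infinity>i. f i * h (i + k)))
      \<and> (\<lambda>j. conv f g j * h j) summable_on UNIV"
    if h: "\<And>i. \<bar>h i\<bar> \<le> C" for h :: "nat \<Rightarrow> real" and C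
  proof -
    have fs: "(\<lambda>i. f i * h (i + k)) summable_on UNIV" for k
      by (rule summable_on_mult_bounded[OF f]) (use h in auto)
    have C: "(\<Sum>\<^sub>\<infinity>i. \<bar>f i * h (i + k)\<bar>) \<le> (\<Sum>\<^sub>\<infinity>i. \<bar>f i\<bar>) * C" for k
    proof -
      have "(\<Sum>\<^sub>\<infinity>i. \<bar>f i * h (i + k)\<bar>) = \<bar>\<Sum>\<^sub>\<infinity>i. \<bar>f i\<bar> * \<bar>h (i + k)\<bar>\<bar>"
        by (subst abs_of_nonneg) (auto simp: abs_mult intro: infsum_nonneg)
      also have "\<dots> \<le> (\<Sum>\<^sub>\<infinity>i. \<bar>\<bar>f i\<bar>\<bar>) * C"
        by (rule abs_infsum_mult_le[OF f']) (use h in auto)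
      finally show ?thesis
        by simp
    qed
    have P: "(\<lambda>(k, i). g k * (f i * h (i + k))) summable_on UNIV \<times> UNIV"
      by (rule summable_on_dominated_family[OF dominated_weighted_row[of g UNIV "\<lambda>k i. f i * h (i + k)", OF g fs C]])
    have bij: "bij_betw (\<lambda>(j, i). (j - i, i)) (Sigma UNIV (\<lambda>j::nat. {..j})) (UNIV \<times> UNIV)"
      by (rule bij_betwI[where g = "\<lambda>(k, i). (i + k, i)"]) auto
    let ?F = "\<lambda>(j, i). g (j - i) * (f i * h j)"
    have e: "(case (case x of (j, i) \<Rightarrow> (j - i, i)) of (k, i) \<Rightarrow> g k * (f i * h (i + k))) = ?F x"
      if "x \<in> Sigma UNIV (\<lambda>j::nat. {..j})" for x
      using that by auto
    have P2: "?F summable_on Sigma UNIV (\<lambda>j::nat. {..j})"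
      using P summable_on_reindex_bij_betw[OF bij, of "\<lambda>(k, i). g k * (f i * h (i + k))"]
      by (subst summable_on_cong[OF e, symmetric]) auto
    have c: "conv f g j * h j = (\<Sum>\<^sub>\<infinity>i\<in>{..j}. ?F (j, i))" for j
      by (simp add: conv_def sum_distrib_left mult_ac)
    have "(\<Sum>\<^sub>\<infinity>j. conv f g j * h j) = infsum ?F (Sigma UNIV (\<lambda>j::nat. {..j}))"
      unfolding c by (rule infsum_Sigma_banach[OF P2])
    also have "\<dots> = (\<Sum>\<^sub>\<infinity>(k, i)\<in>UNIV \<times> UNIV. g k * (f i * h (i + k)))"
      using infsum_reindex_bij_betw[OF bij, of "\<lambda>(k, i). g k * (f i * h (i + k))"]
      by (subst infsum_cong[OF e, symmetric]) auto
    also have "\<dots> = (\<Sum>\<^sub>\<infinity>k. \<Sum>\<^sub>\<infinity>i. g k * (f i * h (i + k)))"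
      using infsum_Sigma_banach[OF P] by simp
    also have "\<dots> = (\<Sum>\<^sub>\<infinity>k. g k * (\<Sum>\<^sub>\<infinity>i. f i * h (i + k)))"
      by (intro infsum_cong infsum_cmult_right fs)
    finally have "(\<Sum>\<^sub>\<infinity>j. conv f g j * h j) = (\<Sum>\<^sub>\<infinity>k. g k * (\<Sum>\<^sub>\<infinity>i. f i * h (i + k)))" .
    moreover have "(\<lambda>j. conv f g j * h j) summable_on UNIV"
      unfolding c using summable_on_Sigma_banach[OF P2] by simp
    ultimately show ?thesis by blast
  qed
  show "(\<Sum>\<^sub>\<infinity>j. conv f g j * h j) = (\<Sum>\<^sub>\<infinity>k. g k * (\<Sum>\<^sub>\<infinity>i. f i * h (i + k)))"
    using key[of h C] h by blast
  show "conv f g summable_on UNIV"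
    using key[of "\<lambda>_. 1" 1] by simp
qed

section \<open>Poisson and binomial weights\<close>

definition pois :: "real \<Rightarrow> nat \<Rightarrow> real" where
  "pois t j = exp (- t) * (t ^ j / fact j)"

definition bino :: "real \<Rightarrow> nat \<Rightarrow> nat \<Rightarrow> real" where
  "bino p m j = real (m choose j) * p ^ j * (1 - p) ^ (m - j)"

lemma pois_nonneg: "0 \<le> t \<Longrightarrow> 0 \<le> pois t j"
  by (simp add: pois_def)

lemma pois_pos: "0 < t \<Longrightarrow> 0 < pois t j"
  by (simp add: pois_def)

lemma pois_gf: "(\<lambda>j. pois t j * u ^ j) sums exp (- t * (1 - u))"
proof -
  have "(\<lambda>j. exp (- t) * ((t * u) ^ j /\<^sub>R fact j)) sums (exp (- t) * exp (t * u))"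
    by (intro sums_mult exp_converges)
  then show ?thesis
    by (simp add: pois_def field_simps exp_diff exp_minus power_mult_distrib)
qed

lemma pois_sums: "pois t sums 1"
  using pois_gf[of t 1] by simp

lemma pois_has_sum: "0 \<le> t \<Longrightarrow> (pois t has_sum 1) UNIV"
  by (intro sums_nonneg_imp_has_sum pois_sums pois_nonneg)

lemma pois_le_1:
  assumes "0 \<le> t"
  shows "pois t j \<le> 1"
  using finite_sum_le_has_sum[OF pois_has_sum[OF assms], of "{j}"] pois_nonneg[OF assms] by simp

lemma bino_nonneg: "0 \<le> p \<Longrightarrow> p \<le> 1 \<Longrightarrow> 0 \<le> bino p m j"
  by (simp add: bino_def)

lemma bino_eq_0: "m < j \<Longrightarrow> bino p m j = 0"
  by (simp add: bino_def)

lemma bino_gf: "(\<Sum>j\<le>m. bino p m j * u ^ j) = (1 - p + p * u) ^ m"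
proof -
  have "(p * u + (1 - p)) ^ m = (\<Sum>j\<le>m. real (m choose j) * (p * u) ^ j * (1 - p) ^ (m - j))"
    by (rule binomial_ring)
  then show ?thesis
    by (simp add: bino_def power_mult_distrib mult_ac add.commute)
qed

lemma bino_sum_eq_infsum: "(\<Sum>\<^sub>\<infinity>j. bino p m j * h j) = (\<Sum>j\<le>m. bino p m j * h j)"
proof -
  have "(\<Sum>\<^sub>\<infinity>j. bino p m j * h j) = (\<Sum>\<^sub>\<infinity>j\<in>{..m}. bino p m j * h j)"
    by (rule infsum_cong_neutral) (auto simp: bino_eq_0)
  then show ?thesis by simp
qed

lemma bino_has_sum: "(bino p m has_sum 1) UNIV"
proof (rule has_sum_finite_neutralI)
  show "finite {..m}" "{..m} \<subseteq> UNIV"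
    by auto
  show "bino p m x = 0" if "x \<in> UNIV - {..m}" for x
    using that by (simp add: bino_eq_0)
  show "1 = sum (bino p m) {..m}"
    using bino_gf[of p m 1] by simp
qed

lemma pois_conv: "conv (pois s) (pois t) = pois (s + t)"
proof
  fix j
  have "(s + t) ^ j / fact j = (\<Sum>i\<le>j. (s ^ i / fact i) * (t ^ (j - i) / fact (j - i)))"
    unfolding binomial_ring sum_divide_distrib
    by (intro sum.cong refl) (simp add: binomial_fact field_simps)
  moreover have "conv (pois s) (pois t) j
      = exp (- s) * exp (- t) * (\<Sum>i\<le>j. (s ^ i / fact i) * (t ^ (j - i) / fact (j - i)))"
    by (simp add: conv_def pois_def sum_distrib_left mult_ac)
  ultimately show "conv (pois s) (pois t) j = pois (s + t) j"
    by (simp add: pois_def exp_add[symmetric] add.commute)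
qed

lemma bino_conv: "conv (bino p m) (bino p k) = bino p (m + k)"
proof
  fix j
  have "conv (bino p m) (bino p k) j
      = (\<Sum>i\<le>j. real (m choose i) * real (k choose (j - i)) * (p ^ j * (1 - p) ^ (m + k - j)))"
    unfolding conv_def
  proof (intro sum.cong refl)
    fix i assume "i \<in> {..j}"
    then have "i \<le> j" by simp
    show "bino p m i * bino p k (j - i)
        = real (m choose i) * real (k choose (j - i)) * (p ^ j * (1 - p) ^ (m + k - j))"
    proof (cases "i \<le> m \<and> j - i \<le> k")
      case True
      have 1: "p ^ i * p ^ (j - i) = p ^ j"
        using \<open>i \<le> j\<close> by (simp flip: power_add)
      have 2: "(1 - p) ^ (m - i) * (1 - p) ^ (k - (j - i)) = (1 - p) ^ (m + k - j)"
      proof -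
        have "(m - i) + (k - (j - i)) = m + k - j"
          using \<open>i \<le> j\<close> True by arith
        then show ?thesis by (metis power_add)
      qed
      have "bino p m i * bino p k (j - i) = real (m choose i) * real (k choose (j - i))
          * ((p ^ i * p ^ (j - i)) * ((1 - p) ^ (m - i) * (1 - p) ^ (k - (j - i))))"
        by (simp add: bino_def mult_ac)
      then show ?thesis
        by (simp only: 1 2)
    qed (auto simp: bino_def)
  qed
  also have "\<dots> = bino p (m + k) j"
    unfolding bino_def vandermonde[symmetric] by (simp add: sum_distrib_left mult_ac)
  finally show "conv (bino p m) (bino p k) j = bino p (m + k) j" .
qed

text \<open>Thinning: independent deletion of the points of a Poisson number of points leaves a Poisson number.\<close>

lemma pois_mix_bino:
  assumes "0 \<le> s" and p: "0 \<le> p" "p \<le> 1"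
  shows "((\<lambda>j. pois s j * bino p j i) has_sum pois (p * s) i) UNIV"
proof (rule sums_nonneg_imp_has_sum)
  have e: "pois s (j + i) * bino p (j + i) i
      = exp (- s) * ((p * s) ^ i / fact i) * (((1 - p) * s) ^ j /\<^sub>R fact j)" for j
    unfolding pois_def bino_def power_mult_distrib power_add
    by (simp add: binomial_fact field_simps)
  have "(\<lambda>j. pois s (j + i) * bino p (j + i) i)
      sums (exp (- s) * ((p * s) ^ i / fact i) * exp ((1 - p) * s))"
    unfolding e by (intro sums_mult exp_converges)
  also have "exp (- s) * ((p * s) ^ i / fact i) * exp ((1 - p) * s) = pois (p * s) i"
    by (simp add: pois_def power_mult_distrib algebra_simps flip: exp_add)
  finally show "(\<lambda>j. pois s j * bino p j i) sums pois (p * s) i"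
    by (subst (asm) sums_iff_shift) (simp add: bino_eq_0)
  show "0 \<le> pois s j * bino p j i" for j
    using assms p by (simp add: pois_nonneg bino_nonneg)
qed

section \<open>Charlier polynomials and differences of the Poisson weights\<close>

text \<open>The value \<open>f (-1)\<close> counts as \<open>0\<close>, as for a sequence extended by zero to the integers.\<close>

definition nabla :: "(nat \<Rightarrow> real) \<Rightarrow> nat \<Rightarrow> real" where
  "nabla f j = f j - (case j of 0 \<Rightarrow> 0 | Suc i \<Rightarrow> f i)"

text \<open>The polynomials defined by \<open>(nabla ^^ k) (pois t) = pois t * charlier t k\<close>. At \<open>j = 0\<close> the truncated
  \<open>j - 1\<close> is multiplied by \<open>0\<close>.\<close>

primrec charlier :: "real \<Rightarrow> nat \<Rightarrow> nat \<Rightarrow> real" where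
  "charlier t 0 j = 1"
| "charlier t (Suc k) j = charlier t k j - real j / t * charlier t k (j - 1)"

lemma nabla_pow_pois:
  assumes "0 < t"
  shows "(nabla ^^ k) (pois t) j = pois t j * charlier t k j"
proof (induction k arbitrary: j)
  case (Suc k)
  have e: "pois t i = pois t (Suc i) * (real (Suc i) / t)" for i
    using assms by (simp add: pois_def field_simps del: of_nat_Suc)
  show ?case
  proof (cases j)
    case 0
    then show ?thesis using Suc by (simp add: nabla_def)
  next
    case (Suc i)
    then show ?thesis
      using Suc.IH[of i] Suc.IH[of j] e[of i] by (simp add: nabla_def algebra_simps)
  qed
qed simp

text \<open>Forward differences lower the degree. With the definition, where backward differences of the weighted
  polynomial raise the degree, this is the pair of adjoint relations from which the norms follow.\<close>

lemma charlier_forward_difference: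
  assumes "0 < t"
  shows "charlier t (Suc k) (Suc j) - charlier t (Suc k) j = - (real (Suc k) / t) * charlier t k j"
proof (induction k arbitrary: j)
  case 0
  then show ?case using assms by (simp add: field_simps)
next
  case (Suc k)
  let ?c = "charlier t"
  have 1: "?c (Suc (Suc k)) (Suc j) - ?c (Suc (Suc k)) j
    = (?c (Suc k) (Suc j) - ?c (Suc k) j) - real (Suc j) / t * ?c (Suc k) j + real j / t * ?c (Suc k) (j - 1)"
    by simp
  have 2: "real j / t * ?c (Suc k) (j - 1)
      = real j / t * (?c (Suc k) j + (real (Suc k) / t) * ?c k (j - 1))"
  proof (cases j)
    case (Suc i)
    then show ?thesis
      using Suc.IH[of i] by (simp add: algebra_simps del: charlier.simps)
  qed simp
  have 3: "?c k j = ?c (Suc k) j + real j / t * ?c k (j - 1)"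
    by simp
  show ?case
    unfolding 1 2 Suc.IH[of j]
    unfolding 3 using assms by (simp add: divide_simps del: charlier.simps) (simp add: algebra_simps del: charlier.simps)
qed

lemma charlier_bound:
  assumes "0 < t"
  shows "\<bar>charlier t k j\<bar> \<le> (1 + real j / t) ^ k"
proof (induction k arbitrary: j)
  case (Suc k)
  have "\<bar>charlier t (Suc k) j\<bar> \<le> \<bar>charlier t k j\<bar> + real j / t * \<bar>charlier t k (j - 1)\<bar>"
    using assms abs_triangle_ineq4[of "charlier t k j" "real j / t * charlier t k (j - 1)"]
    by (simp add: abs_mult)
  also have "\<dots> \<le> (1 + real j / t) ^ k + real j / t * (1 + real j / t) ^ k"
  proof (intro add_mono mult_left_mono)
    have "\<bar>charlier t k (j - 1)\<bar> \<le> (1 + real (j - 1) / t) ^ k"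
      by (rule Suc)
    also have "\<dots> \<le> (1 + real j / t) ^ k"
      using assms by (intro power_mono add_left_mono divide_right_mono) auto
    finally show "\<bar>charlier t k (j - 1)\<bar> \<le> (1 + real j / t) ^ k" .
  qed (use assms Suc in auto)
  finally show ?case by (simp add: algebra_simps)
qed simp

text \<open>\<open>(t + j)\<^sup>n \<le> n! e\<^bsup>t + j\<^esup>\<close>, since the Poisson probability of \<open>n\<close> with mean \<open>t + j\<close> is at most \<open>1\<close>; and
  the Poisson law has exponential moments.\<close>

lemma summable_pois_poly:
  assumes t: "0 < t"
  shows "summable (\<lambda>j. pois t j * (1 + real j / t) ^ n)"
proof (rule summable_comparison_test')
  have "summable (\<lambda>j. pois t j * exp 1 ^ j)"
    using pois_gf sums_iff by blast
  then show "summable (\<lambda>j. fact n / t ^ n * exp t * (pois t j * exp 1 ^ j))"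
    by (rule summable_mult)
  fix j :: nat
  have "(t + real j) ^ n / fact n \<le> exp (t + real j)"
    using pois_le_1[of "t + real j" n] t by (simp add: pois_def exp_minus divide_simps mult_ac del: minus_add_distrib)
  then have "(t + real j) ^ n \<le> fact n * (exp t * exp 1 ^ j)"
    by (simp add: field_simps exp_add flip: exp_of_nat_mult)
  moreover have "(1 + real j / t) ^ n = (t + real j) ^ n / t ^ n"
    using t by (simp add: power_divide[symmetric] add_divide_distrib)
  ultimately have le: "(1 + real j / t) ^ n \<le> fact n / t ^ n * exp t * exp 1 ^ j"
    using t by (simp add: field_simps)
  then show "norm (pois t j * (1 + real j / t) ^ n) \<le> fact n / t ^ n * exp t * (pois t j * exp 1 ^ j)"
    using mult_left_mono[OF le pois_nonneg[of t j]] t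
    by (simp add: abs_mult pois_nonneg mult_ac)
qed

lemma summable_pois_poly_bounded:
  assumes t: "0 < t" and h: "\<And>j. \<bar>h j\<bar> \<le> C * (1 + real j / t) ^ n"
  shows "summable (\<lambda>j. pois t j * h j)"
proof (rule summable_comparison_test')
  show "summable (\<lambda>j. C * (pois t j * (1 + real j / t) ^ n))"
    by (intro summable_mult summable_pois_poly t)
  show "norm (pois t j * h j) \<le> C * (pois t j * (1 + real j / t) ^ n)" for j
    using mult_left_mono[OF h[of j] pois_nonneg[of t j]] t
    by (simp add: abs_mult pois_nonneg mult_ac)
qed

lemma summable_pois_charlier:
  assumes t: "0 < t"
  shows "summable (\<lambda>j. pois t j * (charlier t k j * charlier t l j))"
    and "summable (\<lambda>j. pois t j * (charlier t k j * charlier t l (Suc j)))"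
proof -
  have "\<bar>charlier t k j * charlier t l j\<bar> \<le> 1 * (1 + real j / t) ^ (k + l)" for j
    unfolding abs_mult power_add mult_1
    by (intro mult_mono charlier_bound t) (use t in auto)
  then show "summable (\<lambda>j. pois t j * (charlier t k j * charlier t l j))"
    by (rule summable_pois_poly_bounded[OF t])
  have "\<bar>charlier t k j * charlier t l (Suc j)\<bar> \<le> (1 + 1 / t) ^ l * (1 + real j / t) ^ (k + l)" for j
  proof -
    have "\<bar>charlier t l (Suc j)\<bar> \<le> (1 + real (Suc j) / t) ^ l"
      by (rule charlier_bound[OF t])
    also have "\<dots> \<le> ((1 + 1 / t) * (1 + real j / t)) ^ l"
      using t by (intro power_mono) (auto simp: field_simps)
    finally have "\<bar>charlier t l (Suc j)\<bar> \<le> (1 + 1 / t) ^ l * (1 + real j / t) ^ l"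
      by (simp add: power_mult_distrib)
    then have "\<bar>charlier t k j\<bar> * \<bar>charlier t l (Suc j)\<bar>
        \<le> (1 + real j / t) ^ k * ((1 + 1 / t) ^ l * (1 + real j / t) ^ l)"
      by (intro mult_mono charlier_bound t) (use t in auto)
    then show ?thesis
      by (simp add: abs_mult power_add mult_ac)
  qed
  then show "summable (\<lambda>j. pois t j * (charlier t k j * charlier t l (Suc j)))"
    by (rule summable_pois_poly_bounded[OF t])
qed

text \<open>Summation by parts: in \<open>\<Sum> q C\<^bsub>k+1\<^esub>\<^sup>2\<close> one factor \<open>q C\<^bsub>k+1\<^esub>\<close> is the backward difference of
  \<open>q C\<^sub>k\<close>; moved to the other factor it becomes minus the forward difference of \<open>C\<^bsub>k+1\<^esub>\<close>, which is
  \<open>(k + 1) / t\<close> times \<open>C\<^sub>k\<close>. So each step multiplies the squared norm by \<open>(k + 1) / t\<close>.\<close>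

lemma charlier_norm:
  assumes t: "0 < t"
  shows "(\<lambda>j. pois t j * (charlier t k j)\<^sup>2) sums (fact k / t ^ k)"
proof (induction k)
  case 0
  then show ?case using pois_sums[of t] by simp
next
  case (Suc k)
  let ?c = "charlier t"
  define X where "X = (\<Sum>j. pois t j * (?c k j * ?c (Suc k) j))"
  define Y where "Y = (\<Sum>j. pois t j * (?c k j * ?c (Suc k) (Suc j)))"
  have X: "(\<lambda>j. pois t j * (?c k j * ?c (Suc k) j)) sums X"
    unfolding X_def by (rule summable_sums[OF summable_pois_charlier(1)[OF t]])
  have Y: "(\<lambda>j. pois t j * (?c k j * ?c (Suc k) (Suc j))) sums Y"
    unfolding Y_def by (rule summable_sums[OF summable_pois_charlier(2)[OF t]])
  have "(\<lambda>j. - (t / real (Suc k)) * (pois t j * (?c k j * ?c (Suc k) (Suc j))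
      - pois t j * (?c k j * ?c (Suc k) j))) sums (- (t / real (Suc k)) * (Y - X))"
    by (intro sums_mult sums_diff X Y)
  moreover have "- (t / real (Suc k)) * (pois t j * (?c k j * ?c (Suc k) (Suc j))
      - pois t j * (?c k j * ?c (Suc k) j)) = pois t j * (?c k j)\<^sup>2" for j
  proof -
    have "- (t / real (Suc k)) * (pois t j * (?c k j * ?c (Suc k) (Suc j))
        - pois t j * (?c k j * ?c (Suc k) j))
      = - (t / real (Suc k)) * (pois t j * ?c k j * (?c (Suc k) (Suc j) - ?c (Suc k) j))"
      by (simp add: algebra_simps del: charlier.simps)
    also have "\<dots> = pois t j * (?c k j)\<^sup>2"
      unfolding charlier_forward_difference[OF t] using t
      by (simp add: power2_eq_square field_simps del: charlier.simps of_nat_Suc)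
    finally show ?thesis .
  qed
  ultimately have "- (t / real (Suc k)) * (Y - X) = fact k / t ^ k"
    using Suc sums_unique2 by simp
  then have XY: "X - Y = fact (Suc k) / t ^ Suc k"
    using t by (simp add: field_simps del: of_nat_Suc)
  have "(\<lambda>j. case j of 0 \<Rightarrow> 0 | Suc i \<Rightarrow> pois t i * (?c k i * ?c (Suc k) (Suc i))) sums Y"
    using sums_Suc[of "\<lambda>j. case j of 0 \<Rightarrow> 0 | Suc i \<Rightarrow> pois t i * (?c k i * ?c (Suc k) (Suc i))" Y] Y
    by (simp del: charlier.simps)
  then have "(\<lambda>j. pois t j * (?c k j * ?c (Suc k) j)
      - (case j of 0 \<Rightarrow> 0 | Suc i \<Rightarrow> pois t i * (?c k i * ?c (Suc k) (Suc i)))) sums (X - Y)"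
    by (rule sums_diff[OF X])
  moreover have "pois t j * (?c k j * ?c (Suc k) j)
      - (case j of 0 \<Rightarrow> 0 | Suc i \<Rightarrow> pois t i * (?c k i * ?c (Suc k) (Suc i)))
      = pois t j * (?c (Suc k) j)\<^sup>2" for j
  proof -
    have "pois t j * ?c (Suc k) j = nabla (\<lambda>j. pois t j * ?c k j) j"
      using nabla_pow_pois[OF t, of "Suc k" j] nabla_pow_pois[OF t, of k]
      by (simp add: nabla_def cong: nat.case_cong)
    then have "pois t j * (?c (Suc k) j)\<^sup>2 = nabla (\<lambda>j. pois t j * ?c k j) j * ?c (Suc k) j"
      by (simp add: power2_eq_square del: charlier.simps)
    then show ?thesis
      unfolding \<open>pois t j * (?c (Suc k) j)\<^sup>2 = _\<close>
      by (cases j) (simp_all add: nabla_def algebra_simps del: charlier.simps)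
  qed
  ultimately show ?case
    using XY by simp
qed

text \<open>Cauchy--Schwarz in \<open>L\<^sup>2\<close> of the Poisson law: the \<open>\<ell>\<^sup>1\<close> norm of \<open>q C\<^sub>k\<close> is at most the \<open>L\<^sup>2\<close> norm \<open>N\<close>
  of \<open>C\<^sub>k\<close>. It is applied pointwise in the form \<open>|c| \<le> (N + c\<^sup>2 / N) / 2\<close>.\<close>

lemma nabla_pow_pois_l1:
  assumes t: "0 < t"
  shows "(nabla ^^ k) (pois t) summable_on UNIV"
    and "(\<Sum>\<^sub>\<infinity>j. \<bar>(nabla ^^ k) (pois t) j\<bar>) \<le> sqrt (fact k / t ^ k)"
proof -
  define N :: real where "N = sqrt (fact k / t ^ k)"
  have N: "0 < N" "N * N = fact k / t ^ k"
    using t by (auto simp: N_def)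
  have e: "\<bar>(nabla ^^ k) (pois t) j\<bar> = pois t j * \<bar>charlier t k j\<bar>" for j
    using t by (simp add: nabla_pow_pois abs_mult pois_nonneg)
  have sm: "summable (\<lambda>j. \<bar>(nabla ^^ k) (pois t) j\<bar>)"
    unfolding e
    by (rule summable_pois_poly_bounded[OF t, where C = 1 and n = k]) (simp add: charlier_bound t)
  then show s: "(nabla ^^ k) (pois t) summable_on UNIV"
    by (intro norm_summable_imp_summable_on) simp
  have dom: "(\<lambda>j. (pois t j * N + pois t j * (charlier t k j)\<^sup>2 / N) / 2) sums
      ((1 * N + fact k / t ^ k / N) / 2)"
    by (intro sums_divide sums_add sums_mult2 pois_sums charlier_norm t)
  have "pois t j * \<bar>charlier t k j\<bar> \<le> (pois t j * N + pois t j * (charlier t k j)\<^sup>2 / N) / 2" for j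
  proof -
    have "0 \<le> (\<bar>charlier t k j\<bar> - N)\<^sup>2"
      by simp
    then have "\<bar>charlier t k j\<bar> \<le> (N + (charlier t k j)\<^sup>2 / N) / 2"
      using N(1) by (simp add: field_simps power2_eq_square abs_mult_self_eq)
    then show ?thesis
      using mult_left_mono[of _ _ "pois t j"] pois_nonneg[of t j] t by (fastforce simp: distrib_left)
  qed
  then have "(\<Sum>j. \<bar>(nabla ^^ k) (pois t) j\<bar>) \<le> (1 * N + fact k / t ^ k / N) / 2"
    using suminf_le[OF _ sm sums_summable[OF dom]] sums_unique[OF dom] e by simp
  also have "\<dots> = N"
    using N by (simp flip: N(2))
  finally have "(\<Sum>j. \<bar>(nabla ^^ k) (pois t) j\<bar>) \<le> N" .
  moreover have "(\<Sum>\<^sub>\<infinity>j. \<bar>(nabla ^^ k) (pois t) j\<bar>) = (\<Sum>j. \<bar>(nabla ^^ k) (pois t) j\<bar>)"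
    using has_sum_imp_sums[OF has_sum_infsum[OF summable_on_abs[OF s]]] sums_unique by blast
  ultimately show "(\<Sum>\<^sub>\<infinity>j. \<bar>(nabla ^^ k) (pois t) j\<bar>) \<le> sqrt (fact k / t ^ k)"
    by (simp add: N_def)
qed

lemma nabla_gf:
  assumes "(\<lambda>j. f j * u ^ j) sums S"
  shows "(\<lambda>j. nabla f j * u ^ j) sums ((1 - u) * S)"
proof -
  have "(\<lambda>j. (case j of 0 \<Rightarrow> 0 | Suc i \<Rightarrow> f i) * u ^ j) sums (u * S)"
    using sums_Suc[of "\<lambda>j. (case j of 0 \<Rightarrow> 0 | Suc i \<Rightarrow> f i) * u ^ j"] sums_mult[OF assms, of u]
    by (simp add: mult_ac)
  from sums_diff[OF assms this] show ?thesis
    by (simp add: nabla_def algebra_simps)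
qed

lemma nabla_pow_pois_gf: "(\<lambda>j. (nabla ^^ k) (pois t) j * u ^ j) sums ((1 - u) ^ k * exp (- t * (1 - u)))"
proof (induction k)
  case 0
  then show ?case using pois_gf by simp
next
  case (Suc k)
  from nabla_gf[OF this] show ?case by (simp add: mult_ac)
qed

lemma nabla_conv: "nabla (conv f g) = conv f (nabla g)"
proof
  fix j
  show "nabla (conv f g) j = conv f (nabla g) j"
  proof (cases j)
    case (Suc i)
    have "(\<Sum>l\<le>i. f l * nabla g (Suc i - l)) = (\<Sum>l\<le>i. f l * g (Suc i - l) - f l * g (i - l))"
      by (intro sum.cong refl) (simp add: nabla_def Suc_diff_le algebra_simps)
    then show ?thesis
      using Suc by (simp add: nabla_def conv_def sum_subtractf)
  qed (simp add: nabla_def conv_def)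
qed

lemma nabla_pow_pois_conv: "(nabla ^^ k) (pois (s + t)) = conv (pois s) ((nabla ^^ k) (pois t))"
  by (induction k) (simp_all add: pois_conv nabla_conv)

section \<open>Binomial weights as a series of Poisson differences\<close>

text \<open>The Taylor coefficients \<open>a\<^sub>k\<close> of \<open>e\<^bsup>mz\<^esup> (1 - z)\<^sup>m\<close> at \<open>0\<close>. They are real; the complex
  derivatives are used in order to have Cauchy's estimate.\<close>

definition charlier_coeff :: "nat \<Rightarrow> nat \<Rightarrow> real" where
  "charlier_coeff m k = Re ((deriv ^^ k) (\<lambda>z. exp (of_nat m * z) * (1 - z) ^ m) 0 / fact k)"

lemma charlier_coeff_sums: "(\<lambda>k. charlier_coeff m k * x ^ k) sums (exp (real m * x) * (1 - x) ^ m)"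
proof -
  let ?f = "\<lambda>z::complex. exp (of_nat m * z) * (1 - z) ^ m"
  have "(\<lambda>k. (deriv ^^ k) ?f 0 / fact k * (complex_of_real x - 0) ^ k) sums ?f (of_real x)"
    by (rule holomorphic_power_series[where r = "\<bar>x\<bar> + 1"]) (auto intro!: holomorphic_intros)
  then have "(\<lambda>k. Re ((deriv ^^ k) ?f 0 / fact k * of_real (x ^ k))) sums Re (?f (of_real x))"
    by (intro sums_Re) simp
  moreover have "?f (of_real x) = of_real (exp (real m * x) * (1 - x) ^ m)"
    by (simp flip: exp_of_real)
  ultimately show ?thesis
    by (simp only: charlier_coeff_def Re_complex_of_real times_complex.sel Im_complex_of_real
        mult_zero_right diff_zero)
qed

text \<open>\<open>|1 - z|\<^sup>2 = 1 + (|z|\<^sup>2 - 2 Re z) \<le> exp (|z|\<^sup>2 - 2 Re z)\<close>, and the linear term cancels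
  against \<open>|e\<^sup>z|\<^sup>2\<close>.\<close>

lemma norm_exp_times_one_minus_le:
  fixes z :: complex
  shows "norm (exp z * (1 - z)) \<le> exp ((norm z)\<^sup>2 / 2)"
proof -
  have "(norm (exp z * (1 - z)))\<^sup>2 = exp (2 * Re z) * (1 + ((norm z)\<^sup>2 - 2 * Re z))"
    unfolding norm_mult norm_exp_eq_Re power_mult_distrib cmod_power2
    by (simp add: power2_eq_square algebra_simps flip: exp_add)
  also have "\<dots> \<le> exp (2 * Re z) * exp ((norm z)\<^sup>2 - 2 * Re z)"
    by (intro mult_left_mono exp_ge_add_one_self) auto
  also have "\<dots> = (exp ((norm z)\<^sup>2 / 2))\<^sup>2"
    by (simp add: power2_eq_square flip: exp_add)
  finally show ?thesis
    by (rule power2_le_imp_le) simp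
qed

text \<open>The upper half of Stirling's formula up to a polynomial factor. The induction step is
  \<open>e \<le> (1 + 1 / (k + 1))\<^bsup>k + 2\<^esup>\<close>.\<close>

lemma fact_exp_le: "fact k * exp (real k) \<le> real (Suc k) ^ Suc k"
proof (induction k)
  case (Suc k)
  have "1 - real (Suc k) / real (Suc (Suc k)) \<le> - ln (real (Suc k) / real (Suc (Suc k)))"
    using ln_le_minus_one[of "real (Suc k) / real (Suc (Suc k))"] by simp
  then have "1 / real (Suc (Suc k)) \<le> ln (real (Suc (Suc k)) / real (Suc k))"
    by (simp add: ln_div field_simps)
  then have "1 \<le> real (Suc (Suc k)) * ln (real (Suc (Suc k)) / real (Suc k))"
    by (simp add: field_simps)
  also have "\<dots> = ln ((real (Suc (Suc k)) / real (Suc k)) ^ Suc (Suc k))"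
    by (subst ln_realpow) auto
  finally have "exp 1 \<le> (real (Suc (Suc k)) / real (Suc k)) ^ Suc (Suc k)"
    by (subst (asm) ln_ge_iff) auto
  then have e: "exp 1 * real (Suc k) ^ Suc (Suc k) \<le> real (Suc (Suc k)) ^ Suc (Suc k)"
    by (simp add: power_divide field_simps del: of_nat_Suc power_Suc)
  have "fact (Suc k) * exp (real (Suc k)) = (fact k * exp (real k)) * (exp 1 * real (Suc k))"
    by (simp add: exp_add algebra_simps)
  also have "\<dots> \<le> real (Suc k) ^ Suc k * (exp 1 * real (Suc k))"
    by (rule mult_right_mono[OF Suc]) auto
  also have "\<dots> \<le> real (Suc (Suc k)) ^ Suc (Suc k)"
    using e by (simp add: mult_ac)
  finally show ?case .
qed simp

text \<open>Cauchy's estimate on the circle \<open>r\<^sup>2 = (k + 1) / m\<close>, which essentially minimises \<open>e\<^bsup>m r r / 2\<^esup> / r\<^sup>k\<close>.\<close>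

lemma charlier_coeff_bound:
  assumes m: "1 \<le> m"
  shows "(charlier_coeff m k)\<^sup>2 * fact k / real m ^ k \<le> exp 1 * real (Suc k)"
proof -
  let ?f = "\<lambda>z::complex. exp (of_nat m * z) * (1 - z) ^ m"
  define r where "r = sqrt (real (Suc k) / real m)"
  have r: "0 < r" "r\<^sup>2 = real (Suc k) / real m"
    using m by (auto simp: r_def)
  have "norm ((deriv ^^ k) ?f 0) \<le> fact k * exp (real (Suc k) / 2) / r ^ k"
  proof (rule Cauchy_inequality)
    show "?f holomorphic_on ball 0 r" "continuous_on (cball 0 r) ?f" "0 < r"
      using r by (auto intro!: holomorphic_intros continuous_intros)
    fix z :: complex assume "norm (0 - z) = r"
    then have z: "norm z = r" by simp
    have "norm (?f z) = norm (exp z * (1 - z)) ^ m"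
      by (simp add: exp_of_nat_mult norm_mult norm_power power_mult_distrib)
    also have "\<dots> \<le> exp ((norm z)\<^sup>2 / 2) ^ m"
      by (intro power_mono norm_exp_times_one_minus_le) auto
    also have "\<dots> = exp (real (Suc k) / 2)"
      using m by (simp add: z r(2) del: of_nat_Suc flip: exp_of_nat_mult)
    finally show "norm (?f z) \<le> exp (real (Suc k) / 2)" .
  qed
  then have "norm ((deriv ^^ k) ?f 0 / fact k) \<le> exp (real (Suc k) / 2) / r ^ k"
    by (simp add: norm_divide field_simps del: of_nat_Suc)
  then have "\<bar>charlier_coeff m k\<bar> \<le> exp (real (Suc k) / 2) / r ^ k"
    unfolding charlier_coeff_def using abs_Re_le_cmod order_trans by blast
  then have "\<bar>charlier_coeff m k\<bar>\<^sup>2 \<le> (exp (real (Suc k) / 2) / r ^ k)\<^sup>2"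
    by (rule power_mono) simp
  also have "\<dots> = exp (real (Suc k)) / (r\<^sup>2) ^ k"
    by (simp add: power_divide power_mult[symmetric] mult.commute[of k] del: of_nat_Suc flip: exp_of_nat_mult)
  also have "\<dots> = exp (real (Suc k)) * real m ^ k / real (Suc k) ^ k"
    by (simp add: r(2) power_divide del: of_nat_Suc)
  finally have "(charlier_coeff m k)\<^sup>2 * fact k / real m ^ k
      \<le> exp (real (Suc k)) * real m ^ k / real (Suc k) ^ k * fact k / real m ^ k"
    by (intro divide_right_mono mult_right_mono) auto
  also have "\<dots> = exp 1 * (fact k * exp (real k)) / real (Suc k) ^ k"
    using m by (simp add: exp_add)
  also have "\<dots> \<le> exp 1 * real (Suc k) ^ Suc k / real (Suc k) ^ k"
    by (intro divide_right_mono mult_left_mono fact_exp_le) auto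
  also have "\<dots> = exp 1 * real (Suc k)"
    by simp
  finally show ?thesis .
qed

text \<open>A bound, independent of \<open>m\<close>, for the \<open>\<ell>\<^sup>1\<close> norm of the \<open>k\<close>-th term of the expansion of the
  binomial weights.\<close>

definition term_bound :: "real \<Rightarrow> nat \<Rightarrow> real" where
  "term_bound p k = sqrt (exp 1 * real (Suc k) * p ^ k)"

lemma term_bound_pos: "0 < p \<Longrightarrow> 0 < term_bound p k"
  by (simp add: term_bound_def)

lemma term_bound_summable:
  assumes "0 < p" "p < 1"
  shows "term_bound p summable_on UNIV"
proof -
  have "summable (\<lambda>k. sqrt (exp 1) * (real (Suc k) * sqrt p ^ k))"
    by (intro summable_mult sums_summable[OF geometric_deriv_sums]) (use assms in simp)
  then have "summable (term_bound p)"
  proof (rule summable_comparison_test')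
    fix k
    have "sqrt (real (Suc k)) \<le> real (Suc k)"
      by (rule real_le_lsqrt) (auto simp: power2_eq_square)
    then show "norm (term_bound p k) \<le> sqrt (exp 1) * (real (Suc k) * sqrt p ^ k)"
      using assms by (simp add: term_bound_def real_sqrt_mult real_sqrt_power mult.assoc mult_right_mono)
  qed
  then show ?thesis
    using summable_on_UNIV_nonneg_real_iff[of "term_bound p"] term_bound_pos[OF assms(1)] less_imp_le by blast
qed

text \<open>The factors \<open>k!\<close> of the Charlier norm and of the coefficient bound cancel. The mean \<open>r\<close> of the
  Poisson law is left free, because the differences will be applied only to a part of mean smaller than
  \<open>m p\<close>.\<close>

lemma charlier_term_bound:
  assumes m: "1 \<le> m" and p: "0 < p" and r: "0 < r"
  shows "\<bar>charlier_coeff m k * p ^ k\<bar> * sqrt (fact k / r ^ k) \<le> term_bound p k * sqrt ((real m * p / r) ^ k)"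
proof (rule power2_le_imp_le)
  have "(\<bar>charlier_coeff m k * p ^ k\<bar> * sqrt (fact k / r ^ k))\<^sup>2
      = ((charlier_coeff m k)\<^sup>2 * fact k / real m ^ k) * (p ^ k * (real m * p / r) ^ k)"
    using m p r by (simp add: power_mult_distrib power_divide field_simps power2_eq_square)
  also have "\<dots> \<le> (exp 1 * real (Suc k)) * (p ^ k * (real m * p / r) ^ k)"
    by (rule mult_right_mono[OF charlier_coeff_bound[OF m]]) (use p r in simp)
  also have "\<dots> = (term_bound p k * sqrt ((real m * p / r) ^ k))\<^sup>2"
    using p r by (simp add: term_bound_def power_mult_distrib mult_ac)
  finally show "(\<bar>charlier_coeff m k * p ^ k\<bar> * sqrt (fact k / r ^ k))\<^sup>2
      \<le> (term_bound p k * sqrt ((real m * p / r) ^ k))\<^sup>2" .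
  show "0 \<le> term_bound p k * sqrt ((real m * p / r) ^ k)"
    using p r by (simp add: term_bound_def)
qed

lemma charlier_term_l1:
  assumes m: "1 \<le> m" and p: "0 < p" and r: "0 < r"
  shows "(\<Sum>\<^sub>\<infinity>j. \<bar>charlier_coeff m k * p ^ k * (nabla ^^ k) (pois r) j\<bar>) \<le> term_bound p k * sqrt ((real m * p / r) ^ k)"
proof -
  have "(\<Sum>\<^sub>\<infinity>j. \<bar>charlier_coeff m k * p ^ k * (nabla ^^ k) (pois r) j\<bar>)
      = \<bar>charlier_coeff m k * p ^ k\<bar> * (\<Sum>\<^sub>\<infinity>j. \<bar>(nabla ^^ k) (pois r) j\<bar>)"
    unfolding abs_mult[of "charlier_coeff m k * p ^ k"]
    by (rule infsum_cmult_right[OF summable_on_abs[OF nabla_pow_pois_l1(1)[OF r]]])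
  also have "\<dots> \<le> \<bar>charlier_coeff m k * p ^ k\<bar> * sqrt (fact k / r ^ k)"
    by (rule mult_left_mono[OF nabla_pow_pois_l1(2)[OF r]]) simp
  also have "\<dots> \<le> term_bound p k * sqrt ((real m * p / r) ^ k)"
    by (rule charlier_term_bound[OF assms])
  finally show ?thesis .
qed

lemma powser_eq_zero:
  fixes a :: "nat \<Rightarrow> real"
  assumes z: "\<And>u. \<bar>u\<bar> < 1 \<Longrightarrow> (\<lambda>n. a n * u ^ n) sums 0"
  shows "a n = 0"
proof (cases "n = 0")
  case True
  have "(\<lambda>n. a n * 0 ^ n) sums 0"
    using z[of 0] by simp
  then have "a 0 = 0"
    by (rule sums_unique2[OF powser_sums_zero])
  then show ?thesis
    using True by simp
next
  case False
  show ?thesis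
  proof (rule ccontr)
    assume "a n \<noteq> 0"
    then obtain s where s: "0 < s" "\<And>z. z \<in> cball 0 s - {0} \<Longrightarrow> (\<lambda>_::real. 0::real) z \<noteq> 0"
      using powser_0_nonzero[of 1 0 a "\<lambda>_. 0" n] z False by auto
    show False
      using s(2)[of s] s(1) by simp
  qed
qed

lemma bino_expansion_terms:
  assumes m: "1 \<le> m" and p: "0 < p" "p < 1"
  shows "term_bound p summable_on UNIV"
    and "(\<lambda>j. charlier_coeff m k * p ^ k * (nabla ^^ k) (pois (real m * p)) j) summable_on UNIV"
    and "(\<Sum>\<^sub>\<infinity>j. \<bar>charlier_coeff m k * p ^ k * (nabla ^^ k) (pois (real m * p)) j\<bar>) \<le> term_bound p k"
proof -
  have s: "0 < real m * p"
    using m p by simp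
  show "term_bound p summable_on UNIV"
    by (rule term_bound_summable[OF p])
  show "(\<lambda>j. charlier_coeff m k * p ^ k * (nabla ^^ k) (pois (real m * p)) j) summable_on UNIV"
    by (intro summable_on_cmult_right nabla_pow_pois_l1(1) s)
  show "(\<Sum>\<^sub>\<infinity>j. \<bar>charlier_coeff m k * p ^ k * (nabla ^^ k) (pois (real m * p)) j\<bar>) \<le> term_bound p k"
    using charlier_term_l1[OF m p(1) s, of k] m p by simp
qed

text \<open>Both sides have the same generating function: the \<open>k\<close>-th difference of the Poisson weights of mean
  \<open>m p\<close> has generating function \<open>(1 - u)\<^sup>k e\<^bsup>- m p (1 - u)\<^esup>\<close>, and with \<open>z = p (1 - u)\<close> the sum over
  \<open>k\<close> becomes \<open>e\<^bsup>- m z\<^esup> e\<^bsup>m z\<^esup> (1 - z)\<^sup>m = (1 - p + p u)\<^sup>m\<close>. Uniform summability of the terms justifies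
  the interchange of the sums over \<open>k\<close> and \<open>j\<close>.\<close>

lemma bino_expansion:
  assumes m: "1 \<le> m" and p: "0 < p" "p < 1"
  shows "((\<lambda>k. charlier_coeff m k * p ^ k * (nabla ^^ k) (pois (real m * p)) j) has_sum bino p m j) UNIV"
proof -
  let ?s = "real m * p"
  define g where "g k j = charlier_coeff m k * p ^ k * (nabla ^^ k) (pois ?s) j" for k j
  note g = bino_expansion_terms[OF assms, folded g_def]
  have wfs: "(\<lambda>k. g k j) summable_on UNIV" for j
    using infsum_dominated_swap(3)[of "term_bound p" UNIV g UNIV] g by simp
  define E where "E j = (\<Sum>\<^sub>\<infinity>k. g k j)" for j
  have "E j - bino p m j = 0"
  proof (rule powser_eq_zero[of "\<lambda>j. E j - bino p m j"])
    fix u :: real assume u: "\<bar>u\<bar> < 1"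
    have uj: "\<bar>u ^ j\<bar> \<le> 1" for j
      using u by (simp add: power_abs power_le_one)
    have gus: "(\<lambda>j. g k j * u ^ j) summable_on UNIV" for k
      by (rule summable_on_mult_bounded[OF g(2)]) (rule uj)
    have gu: "(\<Sum>\<^sub>\<infinity>j. \<bar>g k j * u ^ j\<bar>) \<le> term_bound p k" for k
    proof -
      have "(\<Sum>\<^sub>\<infinity>j. \<bar>g k j * u ^ j\<bar>) \<le> (\<Sum>\<^sub>\<infinity>j. \<bar>g k j\<bar>)"
        by (rule infsum_mono[OF summable_on_abs[OF gus] summable_on_abs[OF g(2)]])
           (use uj in \<open>auto simp: abs_mult intro!: mult_left_le\<close>)
      then show ?thesis using g(3)[of k] by linarith
    qed
    note swap = infsum_dominated_swap[of "term_bound p" UNIV "\<lambda>k j. g k j * u ^ j" UNIV, OF g(1) gus gu]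
    have Eu: "(\<Sum>\<^sub>\<infinity>k. g k j * u ^ j) = E j * u ^ j" for j
      unfolding E_def by (rule infsum_cmult_left[OF wfs])
    have inner: "(\<Sum>\<^sub>\<infinity>j. g k j * u ^ j) = exp (- ?s * (1 - u)) * (charlier_coeff m k * (p * (1 - u)) ^ k)" for k
    proof -
      have "(\<lambda>j. g k j * u ^ j) sums (charlier_coeff m k * p ^ k * ((1 - u) ^ k * exp (- ?s * (1 - u))))"
        using sums_mult[OF nabla_pow_pois_gf[of k ?s u], of "charlier_coeff m k * p ^ k"]
        by (simp add: g_def mult.assoc)
      from sums_unique2[OF has_sum_imp_sums[OF has_sum_infsum[OF gus]] this] show ?thesis
        by (simp add: power_mult_distrib mult_ac)
    qed
    have "(\<lambda>k. \<Sum>\<^sub>\<infinity>j. g k j * u ^ j) sums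
        (exp (- ?s * (1 - u)) * (exp (real m * (p * (1 - u))) * (1 - p * (1 - u)) ^ m))"
      unfolding inner by (intro sums_mult charlier_coeff_sums)
    moreover have "exp (- ?s * (1 - u)) * exp (real m * (p * (1 - u))) = 1"
      by (simp add: mult.assoc flip: exp_add)
    ultimately have lhs: "(\<lambda>k. \<Sum>\<^sub>\<infinity>j. g k j * u ^ j) sums ((1 - p + p * u) ^ m)"
      by (simp add: mult.assoc[symmetric]) (simp add: algebra_simps)
    have "(\<lambda>k. \<Sum>\<^sub>\<infinity>j. g k j * u ^ j) summable_on UNIV"
    proof (rule abs_summable_summable, rule summable_on_comparison_test[OF g(1)])
      show "norm (\<Sum>\<^sub>\<infinity>j. g k j * u ^ j) \<le> term_bound p k" for k
        using norm_infsum_bound[of "\<lambda>j. g k j * u ^ j" UNIV] summable_on_abs[OF gus[of k]] gu[of k]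
        by simp
    qed simp
    from has_sum_imp_sums[OF has_sum_infsum[OF this]]
    have rhs: "(\<lambda>k. \<Sum>\<^sub>\<infinity>j. g k j * u ^ j) sums (\<Sum>\<^sub>\<infinity>j. E j * u ^ j)"
      using swap(1) Eu by simp
    have "(\<lambda>j. E j * u ^ j) sums (\<Sum>\<^sub>\<infinity>j. E j * u ^ j)"
      using swap(2) unfolding Eu by (rule has_sum_imp_sums[OF has_sum_infsum])
    then have 1: "(\<lambda>j. E j * u ^ j) sums ((1 - p + p * u) ^ m)"
      unfolding sums_unique2[OF rhs lhs] .
    have "(\<lambda>j. bino p m j * u ^ j) sums (\<Sum>j\<le>m. bino p m j * u ^ j)"
      by (rule sums_finite) (auto simp: bino_eq_0)
    then have "(\<lambda>j. bino p m j * u ^ j) sums ((1 - p + p * u) ^ m)"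
      by (simp add: bino_gf)
    from sums_diff[OF 1 this] show "(\<lambda>j. (E j - bino p m j) * u ^ j) sums 0"
      by (simp add: left_diff_distrib)
  qed
  then have "E j = bino p m j"
    by simp
  then show ?thesis
    using has_sum_infsum[OF wfs[of j]] by (simp add: E_def g_def)
qed

lemma bino_expansion_tail:
  assumes m: "1 \<le> m" and p: "0 < p" "p < 1"
  shows "(\<Sum>\<^sub>\<infinity>j. \<bar>bino p m j - (\<Sum>k<J. charlier_coeff m k * p ^ k * (nabla ^^ k) (pois (real m * p)) j)\<bar>)
    \<le> (\<Sum>\<^sub>\<infinity>k\<in>{J..}. term_bound p k)"
proof -
  define g where "g k j = charlier_coeff m k * p ^ k * (nabla ^^ k) (pois (real m * p)) j" for k j
  note g = bino_expansion_terms[OF assms, folded g_def]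
  have ws: "term_bound p summable_on {J..}"
    by (rule summable_on_subset_banach[OF g(1)]) auto
  have e: "bino p m j - (\<Sum>k<J. g k j) = (\<Sum>\<^sub>\<infinity>k\<in>{J..}. g k j)" for j
  proof -
    have h: "((\<lambda>k. g k j) has_sum bino p m j) UNIV"
      unfolding g_def by (rule bino_expansion[OF assms])
    then have "infsum (\<lambda>k. g k j) ({..<J} \<union> {J..}) = (\<Sum>k<J. g k j) + infsum (\<lambda>k. g k j) {J..}"
      using summable_on_subset_banach[OF has_sum_imp_summable[OF h]]
      by (subst infsum_Un_disjoint) auto
    moreover have "{..<J} \<union> {J..} = UNIV"
      by auto
    ultimately show ?thesis
      using infsumI[OF h] by simp
  qed
  show ?thesis
    unfolding g_def[symmetric] e
    using infsum_dominated_swap(4)[of "term_bound p" "{J..}" g UNIV] ws g by simp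
qed

lemma summable_on_sum_finite:
  fixes g :: "'k \<Rightarrow> 'j \<Rightarrow> real"
  assumes "finite I" and "\<And>k. k \<in> I \<Longrightarrow> g k summable_on J"
  shows "(\<lambda>j. \<Sum>k\<in>I. g k j) summable_on J"
    and "(\<Sum>\<^sub>\<infinity>j\<in>J. \<Sum>k\<in>I. g k j) = (\<Sum>k\<in>I. \<Sum>\<^sub>\<infinity>j\<in>J. g k j)"
proof -
  have "((\<lambda>j. \<Sum>k\<in>I. g k j) has_sum (\<Sum>k\<in>I. \<Sum>\<^sub>\<infinity>j\<in>J. g k j)) J"
    using assms by (induction I rule: finite_induct) (auto intro!: has_sum_add)
  then show "(\<lambda>j. \<Sum>k\<in>I. g k j) summable_on J"
      "(\<Sum>\<^sub>\<infinity>j\<in>J. \<Sum>k\<in>I. g k j) = (\<Sum>k\<in>I. \<Sum>\<^sub>\<infinity>j\<in>J. g k j)"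
    by (auto simp: has_sum_iff)
qed

text \<open>The truncated expansion, with the Poisson law of mean \<open>m p\<close> split into the part of mean
  \<open>m p / (1 + \<theta>)\<close> that stays visible and a remainder of mean \<open>r\<close> that absorbs the differences. Since
  \<open>m p / r = (1 + \<theta>) / \<theta>\<close>, the norm of the finitely many retained terms is bounded independently of \<open>m\<close>.\<close>

lemma bino_approx_pois_conv:
  assumes p: "0 < p" "p < 1" and \<theta>: "0 < \<theta>" and \<eta>: "0 < \<eta>"
  obtains C where "\<And>m. 1 \<le> m \<Longrightarrow> \<exists>v. v summable_on UNIV \<and> (\<Sum>\<^sub>\<infinity>k. \<bar>v k\<bar>) \<le> C \<and>
      (\<Sum>\<^sub>\<infinity>j. \<bar>bino p m j - conv (pois (real m * p / (1 + \<theta>))) v j\<bar>) \<le> \<eta>"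
proof -
  have ws: "term_bound p summable_on UNIV"
    by (rule term_bound_summable[OF p])
  obtain J where J: "(\<Sum>\<^sub>\<infinity>k\<in>{J..}. term_bound p k) \<le> \<eta>"
  proof -
    have "(\<lambda>J. sum (term_bound p) {..<J}) \<longlonglongrightarrow> infsum (term_bound p) UNIV"
      using has_sum_imp_sums[OF has_sum_infsum[OF ws]] by (simp add: sums_def)
    then have "\<forall>\<^sub>F J in sequentially. infsum (term_bound p) UNIV - \<eta> < sum (term_bound p) {..<J}"
      using \<eta> by (intro order_tendstoD(1)) auto
    then obtain J where J: "infsum (term_bound p) UNIV - \<eta> < sum (term_bound p) {..<J}"
      using eventually_sequentially by auto
    have "infsum (term_bound p) ({..<J} \<union> {J..}) = sum (term_bound p) {..<J} + infsum (term_bound p) {J..}"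
      using summable_on_subset_banach[OF ws] by (subst infsum_Un_disjoint) auto
    moreover have "{..<J} \<union> {J..} = UNIV"
      by auto
    ultimately show ?thesis
      using J that[of J] by simp
  qed
  define C where "C = (\<Sum>k<J. term_bound p k * sqrt (((1 + \<theta>) / \<theta>) ^ k))"
  show ?thesis
  proof (rule that)
    fix m :: nat assume m: "1 \<le> m"
    define r where "r = real m * p * \<theta> / (1 + \<theta>)"
    have r: "0 < r" "real m * p / r = (1 + \<theta>) / \<theta>" "real m * p / (1 + \<theta>) + r = real m * p"
      using m p \<theta> by (auto simp: r_def divide_simps) (simp add: algebra_simps)
    define g where "g k j = charlier_coeff m k * p ^ k * (nabla ^^ k) (pois r) j" for k j
    define v where "v j = (\<Sum>k<J. g k j)" for j
    have gs: "g k summable_on UNIV" for k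
      unfolding g_def by (intro summable_on_cmult_right nabla_pow_pois_l1(1) r)
    have vs: "v summable_on UNIV"
      unfolding v_def[abs_def] by (intro summable_on_sum_finite gs) auto
    have "(\<Sum>\<^sub>\<infinity>j. \<bar>v j\<bar>) \<le> (\<Sum>\<^sub>\<infinity>j. \<Sum>k<J. \<bar>g k j\<bar>)"
      unfolding v_def by (intro infsum_mono summable_on_abs summable_on_sum_finite gs sum_abs) auto
    also have "\<dots> = (\<Sum>k<J. \<Sum>\<^sub>\<infinity>j. \<bar>g k j\<bar>)"
      by (intro summable_on_sum_finite summable_on_abs gs) auto
    also have "\<dots> \<le> C"
      unfolding C_def g_def r(2)[symmetric] by (intro sum_mono charlier_term_l1 m p r)
    finally have vC: "(\<Sum>\<^sub>\<infinity>j. \<bar>v j\<bar>) \<le> C" .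
    have "conv (pois (real m * p / (1 + \<theta>))) v j
        = (\<Sum>k<J. charlier_coeff m k * p ^ k * (nabla ^^ k) (pois (real m * p)) j)" for j
    proof -
      have "conv (pois (real m * p / (1 + \<theta>))) v j
          = (\<Sum>k<J. charlier_coeff m k * p ^ k * conv (pois (real m * p / (1 + \<theta>))) ((nabla ^^ k) (pois r)) j)"
        unfolding conv_def v_def g_def sum_distrib_left by (subst sum.swap) (simp add: mult_ac)
      then show ?thesis
        by (simp flip: nabla_pow_pois_conv add: r(3))
    qed
    then have "(\<Sum>\<^sub>\<infinity>j. \<bar>bino p m j - conv (pois (real m * p / (1 + \<theta>))) v j\<bar>) \<le> \<eta>"
      using bino_expansion_tail[OF m p, of J] J by simp
    then show "\<exists>v. v summable_on UNIV \<and> (\<Sum>\<^sub>\<infinity>k. \<bar>v k\<bar>) \<le> C \<and>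
        (\<Sum>\<^sub>\<infinity>j. \<bar>bino p m j - conv (pois (real m * p / (1 + \<theta>))) v j\<bar>) \<le> \<eta>"
      using vs vC by blast
  qed
qed

section \<open>Mixtures of the powers of a stochastic matrix\<close>

definition prob_weights :: "(nat \<Rightarrow> real) \<Rightarrow> bool" where
  "prob_weights w \<longleftrightarrow> (\<forall>i. 0 \<le> w i) \<and> (w has_sum 1) UNIV"

lemma prob_weightsD:
  assumes "prob_weights w"
  shows "0 \<le> w i" "w summable_on UNIV" "infsum w UNIV = 1" "(\<Sum>\<^sub>\<infinity>i. \<bar>w i\<bar>) = 1"
  using assms by (auto simp: prob_weights_def has_sum_iff)

lemma prob_weights_pois: "0 \<le> t \<Longrightarrow> prob_weights (pois t)"
  by (simp add: prob_weights_def pois_nonneg pois_has_sum)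

lemma prob_weights_bino: "0 \<le> p \<Longrightarrow> p \<le> 1 \<Longrightarrow> prob_weights (bino p m)"
  by (simp add: prob_weights_def bino_nonneg bino_has_sum)

lemma bino_Suc:
  "bino p (Suc m) 0 = (1 - p) * bino p m 0"
  "bino p (Suc m) (Suc i) = (1 - p) * bino p m (Suc i) + p * bino p m i"
proof -
  show "bino p (Suc m) 0 = (1 - p) * bino p m 0"
    by (simp add: bino_def)
  show "bino p (Suc m) (Suc i) = (1 - p) * bino p m (Suc i) + p * bino p m i"
  proof (cases "i < m")
    case True
    then have "(1 - p) ^ (m - i) = (1 - p) * (1 - p) ^ (m - Suc i)"
      by (metis Suc_diff_Suc power_Suc)
    then show ?thesis
      by (simp add: bino_def distrib_right distrib_left mult_ac)
  next
    case False
    then show ?thesis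
      by (simp add: bino_def binomial_eq_0)
  qed
qed

text \<open>The distance to \<open>\<pi>\<close> decreases in time because a row of a power of \<open>K\<close> is an average of rows of any smaller
  power.\<close>

locale markov_chain =
  fixes \<Omega> :: "'a set" and K :: "'a \<Rightarrow> 'a \<Rightarrow> real" and \<pi> :: "'a \<Rightarrow> real"
  assumes stochastic: "stochastic_matrix \<Omega> K"
    and prob: "prob_distribution \<Omega> \<pi>"
begin

abbreviation P :: "nat \<Rightarrow> 'a \<Rightarrow> 'a \<Rightarrow> real" where
  "P \<equiv> mat_pow \<Omega> K"

text \<open>The deviation, on a fixed event, of the \<open>i\<close>-th power from \<open>\<pi>\<close>, as a sequence in \<open>i\<close>: all mixtures are
  studied by summing weights against these sequences.\<close>

definition gap :: "'a \<Rightarrow> 'a set \<Rightarrow> nat \<Rightarrow> real" where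
  "gap x A i = infsum (P i x) A - infsum \<pi> A"

definition mix_law :: "(nat \<Rightarrow> real) \<Rightarrow> 'a \<Rightarrow> 'a \<Rightarrow> real" where
  "mix_law w x y = (\<Sum>\<^sub>\<infinity>i. w i * P i x y)"

definition mix_dist :: "(nat \<Rightarrow> real) \<Rightarrow> real" where
  "mix_dist w = (SUP x\<in>\<Omega>. tv_dist \<Omega> (mix_law w x) \<pi>)"

lemma nonempty: "\<Omega> \<noteq> {}"
  using prob by (auto simp: prob_distribution_def has_sum_iff)

lemma K_nonneg: "x \<in> \<Omega> \<Longrightarrow> y \<in> \<Omega> \<Longrightarrow> 0 \<le> K x y"
  and K_sum: "x \<in> \<Omega> \<Longrightarrow> (K x has_sum 1) \<Omega>"
  using stochastic by (auto simp: stochastic_matrix_def)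

lemma P_nonneg: "x \<in> \<Omega> \<Longrightarrow> y \<in> \<Omega> \<Longrightarrow> 0 \<le> P i x y"
  by (induction i arbitrary: x) (auto intro!: infsum_nonneg mult_nonneg_nonneg K_nonneg)

lemma P_sum: "x \<in> \<Omega> \<Longrightarrow> (P i x has_sum 1) \<Omega>"
proof (induction i arbitrary: x)
  case 0
  then show ?case
    by (intro has_sum_finite_neutralI[of "{x}"]) auto
next
  case (Suc i)
  have K: "K x summable_on \<Omega>"
    using K_sum[OF Suc.prems] has_sum_imp_summable by blast
  have f: "P i z summable_on \<Omega>" if "z \<in> \<Omega>" for z
    using Suc.IH[OF that] has_sum_imp_summable by blast
  have C: "(\<Sum>\<^sub>\<infinity>y\<in>\<Omega>. \<bar>P i z y\<bar>) \<le> 1" if "z \<in> \<Omega>" for z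
  proof -
    have "(\<Sum>\<^sub>\<infinity>y\<in>\<Omega>. \<bar>P i z y\<bar>) = infsum (P i z) \<Omega>"
      using P_nonneg[OF that] by (intro infsum_cong) auto
    then show ?thesis
      using infsumI[OF Suc.IH[OF that]] by simp
  qed
  note swap = infsum_weighted_swap[of "K x" \<Omega> "P i" \<Omega> 1, OF K f C]
  have "(\<Sum>\<^sub>\<infinity>z\<in>\<Omega>. K x z * infsum (P i z) \<Omega>) = infsum (K x) \<Omega>"
    by (intro infsum_cong) (simp add: infsumI[OF Suc.IH])
  then have "infsum (P (Suc i) x) \<Omega> = 1"
    using swap(1) infsumI[OF K_sum[OF Suc.prems]] by simp
  then show ?case
    using swap(2) by (simp add: has_sum_iff)
qed

lemma P_summable: "x \<in> \<Omega> \<Longrightarrow> A \<subseteq> \<Omega> \<Longrightarrow> P i x summable_on A"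
  using summable_on_subset_banach[OF has_sum_imp_summable[OF P_sum]] by blast

lemma P_abs_sum_le:
  assumes "x \<in> \<Omega>" "A \<subseteq> \<Omega>"
  shows "(\<Sum>\<^sub>\<infinity>y\<in>A. \<bar>P i x y\<bar>) \<le> 1" "0 \<le> infsum (P i x) A" "infsum (P i x) A \<le> 1"
proof -
  have "(\<Sum>\<^sub>\<infinity>y\<in>A. \<bar>P i x y\<bar>) = infsum (P i x) A"
    using assms P_nonneg by (intro infsum_cong) auto
  moreover have "infsum (P i x) A \<le> infsum (P i x) \<Omega>"
    using assms P_nonneg P_summable by (intro infsum_mono2) auto
  ultimately show "(\<Sum>\<^sub>\<infinity>y\<in>A. \<bar>P i x y\<bar>) \<le> 1" "infsum (P i x) A \<le> 1"
    using infsumI[OF P_sum[OF assms(1)]] by auto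
  show "0 \<le> infsum (P i x) A"
    using assms P_nonneg by (intro infsum_nonneg) auto
qed

lemma pi_bounds:
  assumes "A \<subseteq> \<Omega>"
  shows "0 \<le> infsum \<pi> A" "infsum \<pi> A \<le> 1" "\<pi> summable_on A"
proof -
  have s: "\<pi> summable_on \<Omega>" "infsum \<pi> \<Omega> = 1" and nn: "\<And>x. x \<in> \<Omega> \<Longrightarrow> 0 \<le> \<pi> x"
    using prob by (auto simp: prob_distribution_def has_sum_iff)
  show sA: "\<pi> summable_on A"
    by (rule summable_on_subset_banach[OF s(1) assms])
  show "0 \<le> infsum \<pi> A"
    using assms nn by (intro infsum_nonneg) auto
  have "infsum \<pi> A \<le> infsum \<pi> \<Omega>"
    using assms nn s sA by (intro infsum_mono2) auto
  then show "infsum \<pi> A \<le> 1"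
    using s by simp
qed

lemma gap_bound: "x \<in> \<Omega> \<Longrightarrow> A \<subseteq> \<Omega> \<Longrightarrow> \<bar>gap x A i\<bar> \<le> 1"
  using P_abs_sum_le(2,3)[of x A i] pi_bounds(1,2)[of A] by (auto simp: gap_def)

lemma gap_compl:
  assumes "x \<in> \<Omega>" "A \<subseteq> \<Omega>"
  shows "gap x (\<Omega> - A) i = - gap x A i"
proof -
  have u: "A \<union> \<Omega> = \<Omega>"
    using assms by auto
  have "infsum (P i x) A + infsum (P i x) (\<Omega> - A) = 1"
    using infsum_Un_disjoint[of "P i x" A "\<Omega> - A"] P_summable[OF assms(1)] assms
      infsumI[OF P_sum[OF assms(1)]] by (simp add: u)
  moreover have "infsum \<pi> A + infsum \<pi> (\<Omega> - A) = 1"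
    using infsum_Un_disjoint[of \<pi> A "\<Omega> - A"] pi_bounds(3) assms prob
    by (simp add: u prob_distribution_def has_sum_iff)
  ultimately show ?thesis
    by (simp add: gap_def)
qed

lemma P_add:
  assumes "x \<in> \<Omega>" "A \<subseteq> \<Omega>"
  shows "infsum (P (k + i) x) A = (\<Sum>\<^sub>\<infinity>z\<in>\<Omega>. P k x z * infsum (P i z) A)"
  using assms(1)
proof (induction k arbitrary: x)
  case 0
  have "(\<Sum>\<^sub>\<infinity>z\<in>\<Omega>. P 0 x z * infsum (P i z) A) = (\<Sum>\<^sub>\<infinity>z\<in>{x}. P 0 x z * infsum (P i z) A)"
    using 0 by (intro infsum_cong_neutral) auto
  then show ?case by simp
next
  case (Suc k)
  have K: "K x summable_on \<Omega>"
    using K_sum[OF Suc.prems] has_sum_imp_summable by blast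
  have s: "(\<lambda>z'. P k z z' * infsum (P i z') A) summable_on \<Omega>" if "z \<in> \<Omega>" for z
    using P_abs_sum_le(2,3) assms(2)
    by (intro summable_on_mult_bounded[where C = 1] P_summable that) auto
  have C: "(\<Sum>\<^sub>\<infinity>z'\<in>\<Omega>. \<bar>P k z z' * infsum (P i z') A\<bar>) \<le> 1" if "z \<in> \<Omega>" for z
  proof -
    have "(\<Sum>\<^sub>\<infinity>z'\<in>\<Omega>. \<bar>P k z z' * infsum (P i z') A\<bar>) \<le> infsum (P k z) \<Omega>"
    proof (rule infsum_mono[OF summable_on_abs[OF s[OF that]] P_summable[OF that]])
      fix z' assume "z' \<in> \<Omega>"
      then show "\<bar>P k z z' * infsum (P i z') A\<bar> \<le> P k z z'"
        using P_abs_sum_le(2,3)[of z' A i] assms(2) P_nonneg[OF that, of z' k]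
        by (simp add: abs_mult mult_left_le)
    qed simp
    then show ?thesis
      using P_abs_sum_le(3)[OF that order_refl, of k] by linarith
  qed
  have "infsum (P (Suc k + i) x) A = (\<Sum>\<^sub>\<infinity>z\<in>\<Omega>. K x z * infsum (P (k + i) z) A)"
    using infsum_weighted_swap(1)[of "K x" \<Omega> "P (k + i)" A 1, OF K] P_summable P_abs_sum_le(1) assms(2)
    by simp
  also have "\<dots> = (\<Sum>\<^sub>\<infinity>z\<in>\<Omega>. K x z * (\<Sum>\<^sub>\<infinity>z'\<in>\<Omega>. P k z z' * infsum (P i z') A))"
    by (intro infsum_cong) (simp add: Suc.IH)
  also have "\<dots> = (\<Sum>\<^sub>\<infinity>z'\<in>\<Omega>. \<Sum>\<^sub>\<infinity>z\<in>\<Omega>. K x z * (P k z z' * infsum (P i z') A))"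
    by (rule infsum_weighted_swap(1)[OF K s C])
  also have "\<dots> = (\<Sum>\<^sub>\<infinity>z'\<in>\<Omega>. P (Suc k) x z' * infsum (P i z') A)"
    by (simp add: infsum_cmult_left' mult.assoc[symmetric])
  finally show ?case .
qed

lemma gap_shift:
  assumes "x \<in> \<Omega>" "A \<subseteq> \<Omega>"
  shows "gap x A (k + i) = (\<Sum>\<^sub>\<infinity>z\<in>\<Omega>. P k x z * gap z A i)"
proof -
  have s: "(\<lambda>z. P k x z * infsum (P i z) A) summable_on \<Omega>"
    using P_abs_sum_le(2,3) assms
    by (intro summable_on_mult_bounded[where C = 1] P_summable) auto
  have "((\<lambda>z. P k x z * infsum (P i z) A - P k x z * infsum \<pi> A) has_sum
      (infsum (P (k + i) x) A - 1 * infsum \<pi> A)) \<Omega>"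
    using has_sum_infsum[OF s] P_add[OF assms, of k i]
    by (intro has_sum_diff_real has_sum_cmult_left P_sum assms) simp
  then show ?thesis
    by (simp add: gap_def right_diff_distrib infsumI)
qed

lemma mix_law_measure:
  assumes w: "prob_weights w" and x: "x \<in> \<Omega>" "A \<subseteq> \<Omega>"
  shows "infsum (mix_law w x) A - infsum \<pi> A = (\<Sum>\<^sub>\<infinity>i. w i * gap x A i)"
proof -
  have s: "(\<lambda>i. w i * infsum (P i x) A) summable_on UNIV"
    using P_abs_sum_le(2,3)[OF x] prob_weightsD[OF w]
    by (intro summable_on_mult_bounded[where C = 1]) auto
  have "infsum (mix_law w x) A = (\<Sum>\<^sub>\<infinity>i. w i * infsum (P i x) A)"
    unfolding mix_law_def[abs_def]
    using infsum_weighted_swap(1)[of w UNIV "\<lambda>i. P i x" A 1] prob_weightsD[OF w] P_summable[OF x]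
      P_abs_sum_le(1)[OF x] by simp
  then have "((\<lambda>i. w i * infsum (P i x) A - w i * infsum \<pi> A) has_sum
      (infsum (mix_law w x) A - 1 * infsum \<pi> A)) UNIV"
    using has_sum_infsum[OF s] w
    by (intro has_sum_diff_real has_sum_cmult_left) (auto simp: prob_weights_def)
  then show ?thesis
    by (simp add: gap_def right_diff_distrib infsumI)
qed

lemma abs_weighted_gap_le_1:
  assumes w: "prob_weights w" and x: "x \<in> \<Omega>" "A \<subseteq> \<Omega>"
  shows "\<bar>\<Sum>\<^sub>\<infinity>i. w i * gap x A i\<bar> \<le> 1"
  using abs_infsum_mult_le[OF prob_weightsD(2)[OF w], of "gap x A" 1] gap_bound[OF x]
    prob_weightsD(4)[OF w] by simp

lemma tv_dist_mix_law:
  assumes w: "prob_weights w" and x: "x \<in> \<Omega>"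
  shows "tv_dist \<Omega> (mix_law w x) \<pi> = (SUP A\<in>Pow \<Omega>. \<Sum>\<^sub>\<infinity>i. w i * gap x A i)"
  unfolding tv_dist_def by (intro SUP_cong refl mix_law_measure assms) auto

lemma mix_dist_least:
  assumes w: "prob_weights w"
    and B: "\<And>x A. x \<in> \<Omega> \<Longrightarrow> A \<subseteq> \<Omega> \<Longrightarrow> (\<Sum>\<^sub>\<infinity>i. w i * gap x A i) \<le> B"
  shows "mix_dist w \<le> B"
  unfolding mix_dist_def
proof (rule cSUP_least[OF nonempty])
  fix x assume x: "x \<in> \<Omega>"
  show "tv_dist \<Omega> (mix_law w x) \<pi> \<le> B"
    unfolding tv_dist_mix_law[OF w x] by (rule cSUP_least) (use B[OF x] in auto)
qed

lemma weighted_gap_le_mix_dist: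
  assumes w: "prob_weights w" and x: "x \<in> \<Omega>" "A \<subseteq> \<Omega>"
  shows "(\<Sum>\<^sub>\<infinity>i. w i * gap x A i) \<le> mix_dist w"
proof -
  have le1: "(\<Sum>\<^sub>\<infinity>i. w i * gap y B i) \<le> 1" if "y \<in> \<Omega>" "B \<subseteq> \<Omega>" for y B
    using abs_weighted_gap_le_1[OF w that] by linarith
  have tv1: "tv_dist \<Omega> (mix_law w y) \<pi> \<le> 1" if "y \<in> \<Omega>" for y
    unfolding tv_dist_mix_law[OF w that] by (rule cSUP_least) (use le1[OF that] in auto)
  have "(\<Sum>\<^sub>\<infinity>i. w i * gap x A i) \<le> tv_dist \<Omega> (mix_law w x) \<pi>"
    unfolding tv_dist_mix_law[OF w x(1)]
    by (rule cSUP_upper) (use x le1[OF x(1)] in \<open>auto intro!: bdd_aboveI2[where M = 1]\<close>)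
  also have "\<dots> \<le> mix_dist w"
    unfolding mix_dist_def by (rule cSUP_upper[OF x(1)]) (auto intro!: bdd_aboveI2[where M = 1] tv1)
  finally show ?thesis .
qed

text \<open>The one-sided supremum in the total variation distance controls the absolute value, by passing to the
  complementary event.\<close>

lemma abs_weighted_gap_le_mix_dist:
  assumes w: "prob_weights w" and x: "x \<in> \<Omega>" "A \<subseteq> \<Omega>"
  shows "\<bar>\<Sum>\<^sub>\<infinity>i. w i * gap x A i\<bar> \<le> mix_dist w"
proof -
  have "(\<Sum>\<^sub>\<infinity>i. w i * gap x (\<Omega> - A) i) = - (\<Sum>\<^sub>\<infinity>i. w i * gap x A i)"
    by (simp add: gap_compl[OF x] infsum_uminus)
  then show ?thesis
    using weighted_gap_le_mix_dist[OF w x] weighted_gap_le_mix_dist[OF w x(1), of "\<Omega> - A"] by auto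
qed

lemma mix_dist_nonneg:
  assumes w: "prob_weights w"
  shows "0 \<le> mix_dist w"
proof -
  obtain x where "x \<in> \<Omega>"
    using nonempty by blast
  then show ?thesis
    using abs_weighted_gap_le_mix_dist[OF w, of x "{}"] by fastforce
qed

text \<open>Chapman--Kolmogorov: the shifted deviations are averages over the position after \<open>k\<close> steps of the unshifted
  ones, and the distance is a supremum over all starting points.\<close>

lemma weighted_shifted_gap_le:
  assumes w: "prob_weights w" and x: "x \<in> \<Omega>" "A \<subseteq> \<Omega>"
  shows "\<bar>\<Sum>\<^sub>\<infinity>i. w i * gap x A (i + k)\<bar> \<le> mix_dist w"
proof -
  have Ps: "P k x summable_on \<Omega>"
    using P_summable[OF x(1)] by simp
  have s: "(\<lambda>i. w i * gap z A i) summable_on UNIV" if "z \<in> \<Omega>" for z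
    by (rule summable_on_mult_bounded[OF prob_weightsD(2)[OF w]]) (rule gap_bound[OF that x(2)])
  have C: "(\<Sum>\<^sub>\<infinity>i. \<bar>w i * gap z A i\<bar>) \<le> 1" if "z \<in> \<Omega>" for z
  proof -
    have "(\<Sum>\<^sub>\<infinity>i. \<bar>w i * gap z A i\<bar>) \<le> infsum w UNIV"
      by (rule infsum_mono[OF summable_on_abs[OF s[OF that]] prob_weightsD(2)[OF w]])
         (use prob_weightsD(1)[OF w] gap_bound[OF that x(2)] in \<open>auto simp: abs_mult intro!: mult_left_le\<close>)
    then show ?thesis
      using prob_weightsD(3)[OF w] by simp
  qed
  have "(\<Sum>\<^sub>\<infinity>i. w i * gap x A (i + k)) = (\<Sum>\<^sub>\<infinity>i. \<Sum>\<^sub>\<infinity>z\<in>\<Omega>. P k x z * (w i * gap z A i))"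
    unfolding add.commute[of _ k] gap_shift[OF x]
    by (simp add: infsum_cmult_right'[symmetric] mult_ac)
  also have "\<dots> = (\<Sum>\<^sub>\<infinity>z\<in>\<Omega>. P k x z * (\<Sum>\<^sub>\<infinity>i. w i * gap z A i))"
    by (rule infsum_weighted_swap(1)[OF Ps s C, symmetric])
  also have "\<bar>\<dots>\<bar> \<le> (\<Sum>\<^sub>\<infinity>z\<in>\<Omega>. \<bar>P k x z\<bar>) * mix_dist w"
    by (rule abs_infsum_mult_le[OF Ps]) (rule abs_weighted_gap_le_mix_dist[OF w _ x(2)])
  also have "\<dots> \<le> 1 * mix_dist w"
    by (rule mult_right_mono[OF P_abs_sum_le(1)[OF x(1)] mix_dist_nonneg[OF w]]) simp
  finally show ?thesis by simp
qed

text \<open>The sequence \<open>v\<close> may have negative entries. This is what allows deconvolution to be used.\<close>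

lemma weighted_gap_conv_le:
  assumes w: "prob_weights w" and v: "v summable_on UNIV" and x: "x \<in> \<Omega>" "A \<subseteq> \<Omega>"
  shows "\<bar>\<Sum>\<^sub>\<infinity>j. conv w v j * gap x A j\<bar> \<le> (\<Sum>\<^sub>\<infinity>k. \<bar>v k\<bar>) * mix_dist w"
  unfolding conv_weighted_sum(1)[OF prob_weightsD(2)[OF w] v gap_bound[OF x]]
  by (rule abs_infsum_mult_le[OF v]) (rule weighted_shifted_gap_le[OF w x])

lemma mix_dist_conv_le:
  assumes "prob_weights w" "prob_weights v" "prob_weights (conv w v)"
  shows "mix_dist (conv w v) \<le> mix_dist w"
proof (rule mix_dist_least[OF assms(3)])
  fix x A assume "x \<in> \<Omega>" "A \<subseteq> \<Omega>"
  from weighted_gap_conv_le[OF assms(1) prob_weightsD(2)[OF assms(2)] this]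
  show "(\<Sum>\<^sub>\<infinity>i. conv w v i * gap x A i) \<le> mix_dist w"
    using prob_weightsD(4)[OF assms(2)] by simp
qed

lemma mix_dist_pois_antimono:
  assumes "0 \<le> s" "s \<le> t"
  shows "mix_dist (pois t) \<le> mix_dist (pois s)"
  using mix_dist_conv_le[of "pois s" "pois (t - s)"] assms by (simp add: pois_conv prob_weights_pois)

lemma mix_dist_bino_antimono:
  assumes "0 \<le> p" "p \<le> 1" "m \<le> n"
  shows "mix_dist (bino p n) \<le> mix_dist (bino p m)"
  using mix_dist_conv_le[of "bino p m" "bino p (n - m)"] assms by (simp add: bino_conv prob_weights_bino)

lemma d_cont_eq:
  assumes "0 \<le> t"
  shows "d_cont \<Omega> K \<pi> t = mix_dist (pois t)"
proof -
  have "semigroup_matrix \<Omega> K t x y = mix_law (pois t) x y" if x: "x \<in> \<Omega>" "y \<in> \<Omega>" for x y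
  proof -
    have "\<bar>P i x y\<bar> \<le> 1" for i
      using P_abs_sum_le(2,3)[OF x(1), of "{y}" i] x by simp
    then have "(\<lambda>i. pois t i * P i x y) summable_on UNIV"
      by (rule summable_on_mult_bounded[OF prob_weightsD(2)[OF prob_weights_pois[OF assms]]])
    then have "(\<lambda>i. pois t i * P i x y) sums mix_law (pois t) x y"
      unfolding mix_law_def by (rule has_sum_imp_sums[OF has_sum_infsum])
    then show ?thesis
      by (simp add: semigroup_matrix_def pois_def sums_iff)
  qed
  then have "tv_dist \<Omega> (semigroup_matrix \<Omega> K t x) \<pi> = tv_dist \<Omega> (mix_law (pois t) x) \<pi>" if "x \<in> \<Omega>" for x
    unfolding tv_dist_def using that
    by (intro SUP_cong refl arg_cong2[where f = "(-)"] infsum_cong) auto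
  then show ?thesis
    unfolding d_cont_def mix_dist_def by (intro SUP_cong) auto
qed

lemma lazy_pow:
  assumes "x \<in> \<Omega>" "y \<in> \<Omega>"
  shows "mat_pow \<Omega> (lazy_matrix \<delta> K) m x y = (\<Sum>i\<le>m. bino (1 - \<delta>) m i * P i x y)"
  using assms(1)
proof (induction m arbitrary: x)
  case 0
  then show ?case by (simp add: bino_def)
next
  case (Suc m)
  let ?p = "1 - \<delta>"
  let ?F = "\<lambda>z. \<Sum>i\<le>m. bino ?p m i * P i z y"
  have s: "((\<lambda>z. K x z * P i z y) has_sum P (Suc i) x y) \<Omega>" for i
  proof -
    have "(\<lambda>z. K x z * P i z y) summable_on \<Omega>"
    proof (rule summable_on_mult_bounded[OF has_sum_imp_summable[OF K_sum[OF Suc.prems]]])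
      show "\<bar>P i z y\<bar> \<le> 1" if "z \<in> \<Omega>" for z
        using P_abs_sum_le(2,3)[OF that, of "{y}" i] assms(2) by simp
    qed
    then show ?thesis by simp
  qed
  have "((\<lambda>z. ?p * (\<Sum>i\<le>m. bino ?p m i * (K x z * P i z y))) has_sum
      (?p * (\<Sum>i\<le>m. bino ?p m i * P (Suc i) x y))) \<Omega>"
  proof (rule has_sum_cmult_right)
    show "((\<lambda>z. \<Sum>i\<le>m. bino ?p m i * (K x z * P i z y)) has_sum
        (\<Sum>i\<le>m. bino ?p m i * P (Suc i) x y)) \<Omega>"
      using summable_on_sum_finite[of "{..m}" "\<lambda>i z. bino ?p m i * (K x z * P i z y)" \<Omega>]
        has_sum_cmult_right[OF s] by (simp add: has_sum_iff)
  qed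
  moreover have "((\<lambda>z. \<delta> * (if x = z then 1 else 0) * ?F z) has_sum (\<delta> * ?F x)) \<Omega>"
    using Suc.prems by (intro has_sum_finite_neutralI[of "{x}"]) auto
  ultimately have "((\<lambda>z. \<delta> * (if x = z then 1 else 0) * ?F z + ?p * (\<Sum>i\<le>m. bino ?p m i * (K x z * P i z y)))
      has_sum (\<delta> * ?F x + ?p * (\<Sum>i\<le>m. bino ?p m i * P (Suc i) x y))) \<Omega>"
    by (rule has_sum_add[rotated])
  then have "((\<lambda>z. lazy_matrix \<delta> K x z * ?F z) has_sum
      (\<delta> * ?F x + ?p * (\<Sum>i\<le>m. bino ?p m i * P (Suc i) x y))) \<Omega>"
    unfolding lazy_matrix_def distrib_right mult.assoc sum_distrib_left
    by (simp add: mult.left_commute sum.distrib del: mat_pow.simps)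
  then have "mat_pow \<Omega> (lazy_matrix \<delta> K) (Suc m) x y
      = \<delta> * ?F x + ?p * (\<Sum>i\<le>m. bino ?p m i * P (Suc i) x y)"
    by (simp add: infsumI Suc.IH cong: infsum_cong)
  also have "?F x = (\<Sum>i\<le>Suc m. bino ?p m i * P i x y)"
    by (simp add: bino_eq_0 del: mat_pow.simps)
  also have "\<delta> * \<dots> + ?p * (\<Sum>i\<le>m. bino ?p m i * P (Suc i) x y)
      = (\<Sum>i\<le>Suc m. bino ?p (Suc m) i * P i x y)"
    unfolding sum.atMost_Suc_shift bino_Suc
    by (simp add: algebra_simps sum.distrib sum_subtractf sum_distrib_left del: mat_pow.simps)
  finally show ?case .
qed

lemma d_lazy_eq:
  assumes "0 \<le> \<delta>" "\<delta> \<le> 1"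
  shows "d_lazy \<delta> \<Omega> K \<pi> m = mix_dist (bino (1 - \<delta>) m)"
proof -
  have "mat_pow \<Omega> (lazy_matrix \<delta> K) m x y = mix_law (bino (1 - \<delta>) m) x y" if "x \<in> \<Omega>" "y \<in> \<Omega>" for x y
    unfolding mix_law_def bino_sum_eq_infsum by (rule lazy_pow[OF that])
  then have "tv_dist \<Omega> (mat_pow \<Omega> (lazy_matrix \<delta> K) m x) \<pi> = tv_dist \<Omega> (mix_law (bino (1 - \<delta>) m) x) \<pi>"
    if "x \<in> \<Omega>" for x
    unfolding tv_dist_def using that
    by (intro SUP_cong refl arg_cong2[where f = "(-)"] infsum_cong) auto
  then show ?thesis
    unfolding d_lazy_def mix_dist_def by (intro SUP_cong) auto
qed

end

section \<open>Concentration of the Poisson weights and their overlap with the binomial weights\<close>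

lemma pois_chebyshev:
  assumes s: "0 < s" and \<theta>: "0 < \<theta>" and S: "\<And>j. j \<in> S \<Longrightarrow> \<theta> \<le> \<bar>1 - real j / s\<bar>"
  shows "(\<lambda>j. pois s j * of_bool (j \<in> S)) summable_on UNIV"
    and "(\<Sum>\<^sub>\<infinity>j. pois s j * of_bool (j \<in> S)) \<le> 1 / (\<theta>\<^sup>2 * s)"
proof -
  have "(\<lambda>j. pois s j * (1 - real j / s)\<^sup>2) sums (1 / s)"
    using charlier_norm[OF s, of 1] by simp
  then have "(\<lambda>j. pois s j * (1 - real j / s)\<^sup>2 / \<theta>\<^sup>2) sums (1 / s / \<theta>\<^sup>2)"
    by (rule sums_divide)
  then have q: "((\<lambda>j. pois s j * (1 - real j / s)\<^sup>2 / \<theta>\<^sup>2) has_sum (1 / (\<theta>\<^sup>2 * s))) UNIV"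
    using s by (intro sums_nonneg_imp_has_sum) (simp_all add: pois_nonneg mult.commute)
  show sm: "(\<lambda>j. pois s j * of_bool (j \<in> S)) summable_on UNIV"
    by (rule summable_on_mult_bounded[where C = 1]) (use pois_has_sum[of s] s in \<open>auto simp: has_sum_iff\<close>)
  have "pois s j * of_bool (j \<in> S) \<le> pois s j * (1 - real j / s)\<^sup>2 / \<theta>\<^sup>2" for j
  proof (cases "j \<in> S")
    case True
    then have "\<theta>\<^sup>2 \<le> (1 - real j / s)\<^sup>2"
      using power_mono[OF S[OF True], of 2] \<theta> by simp
    then show ?thesis
      using True \<theta> s mult_left_mono[of "\<theta>\<^sup>2" "(1 - real j / s)\<^sup>2" "pois s j"] pois_nonneg[of s j]
      by (simp add: field_simps)
  qed (use s in \<open>simp add: pois_nonneg\<close>)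
  then show "(\<Sum>\<^sub>\<infinity>j. pois s j * of_bool (j \<in> S)) \<le> 1 / (\<theta>\<^sup>2 * s)"
    using infsum_mono[OF sm has_sum_imp_summable[OF q]] infsumI[OF q] by simp
qed

lemma bino_Suc_ratio:
  "bino p m (Suc j) * (real (Suc j) * (1 - p)) = bino p m j * ((real m - real j) * p)"
proof (cases "j < m")
  case True
  have "Suc j * (m choose Suc j) = (m - j) * (m choose j)"
    by (metis binomial_absorb_comp binomial_absorption)
  then have "real (Suc j) * real (m choose Suc j) = (real m - real j) * real (m choose j)"
    using True by (metis (no_types, lifting) of_nat_diff of_nat_mult less_imp_le)
  moreover have "(1 - p) ^ (m - j) = (1 - p) * (1 - p) ^ (m - Suc j)"
    using True by (metis Suc_diff_Suc power_Suc)
  ultimately show ?thesis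
    unfolding bino_def by (simp del: of_nat_Suc binomial_Suc_Suc) (metis (no_types, lifting) mult.assoc mult.commute)
next
  case False
  then show ?thesis
    by (cases "j = m") (simp_all add: bino_eq_0)
qed

lemma bino_pois_ratio:
  assumes p: "0 < p" "p < 1" and m: "1 \<le> m"
  defines "h \<equiv> \<lambda>j. bino p m j / pois (real m * p) j"
  shows "h (Suc j) = h j * ((real m - real j) / ((1 - p) * real m))"
proof -
  have s: "0 < real m * p"
    using p m by simp
  have q: "pois (real m * p) (Suc j) * real (Suc j) = pois (real m * p) j * (real m * p)"
    by (simp add: pois_def field_simps del: of_nat_Suc)
  have q0: "pois (real m * p) j > 0" "pois (real m * p) (Suc j) > 0"
    using pois_pos[OF s] by auto
  have "h (Suc j) = bino p m (Suc j) * (real (Suc j) * (1 - p)) /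
      ((1 - p) * (pois (real m * p) (Suc j) * real (Suc j)))"
    using p q0 by (simp add: h_def del: of_nat_Suc)
  also have "\<dots> = bino p m j * ((real m - real j) * p) / ((1 - p) * (pois (real m * p) j * (real m * p)))"
    unfolding q bino_Suc_ratio ..
  also have "\<dots> = h j * ((real m - real j) / ((1 - p) * real m))"
    using p m q0 by (simp add: h_def)
  finally show ?thesis .
qed

text \<open>The quotient \<open>h\<close> of the binomial by the Poisson weights satisfies
  \<open>h (j + 1) / h j = 1 - (j - s) / ((1 - p) m)\<close> with \<open>s = m p\<close>, so it increases up to the mean and decreases
  afterwards. Both weights sum to \<open>1\<close>, hence the maximal value, at \<open>j0 = \<lceil>s\<rceil>\<close>, is at least \<open>1\<close>; and each step
  away from \<open>j0\<close> within distance \<open>B\<close> of the mean loses at most a factor \<open>1 - x\<close>.\<close>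

lemma bino_ge_pois_window_aux:
  assumes p: "0 < p" "p < 1" and m: "1 \<le> m"
    and B: "0 \<le> B" and x: "x = B / ((1 - p) * real m)" "x \<le> 1"
    and j: "\<bar>real j - real m * p\<bar> \<le> B"
  shows "\<exists>i::nat. real i \<le> B + 1 \<and> (1 - x) ^ i * pois (real m * p) j \<le> bino p m j"
proof -
  define s where "s = real m * p"
  define h where "h j = bino p m j / pois s j" for j
  \<comment> \<open>the mode of the quotient \<open>h\<close>\<close>
  define j0 where "j0 = nat \<lceil>s\<rceil>"
  have s: "0 < s"
    using p m by (simp add: s_def)
  have j0: "s \<le> real j0" "real j0 < s + 1"
    using s unfolding j0_def by linarith+
  have q0: "0 < pois s j" for j
    by (rule pois_pos[OF s])
  have h0: "0 \<le> h j" for j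
    unfolding h_def using q0[of j] p bino_nonneg[of p m j] by simp
  have bh: "bino p m j = h j * pois s j" for j
    using q0[of j] by (simp add: h_def)
  have dm: "0 < (1 - p) * real m"
    using p m by simp
  define f where "f j = 1 - (real j - s) / ((1 - p) * real m)" for j
  have hS: "h (Suc j) = h j * f j" for j
  proof -
    have "(real m - real j) / ((1 - p) * real m) = f j"
      using p m unfolding f_def s_def by (simp add: divide_simps) (simp add: algebra_simps)
    then show ?thesis
      using bino_pois_ratio[OF p m, of j] by (simp add: h_def s_def)
  qed
  have x0: "0 \<le> x"
    using B dm x by simp
  have below: "h (j0 - i) \<le> h j0" for i
  proof (induction i)
    case (Suc i)
    show ?case
    proof (cases "i < j0")
      case True
      define j where "j = j0 - Suc i"
      have j: "j0 - i = Suc j" "real j < s"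
        using True j0 by (auto simp: j_def)
      have "1 \<le> f j"
        using j dm by (simp add: f_def divide_le_0_iff)
      then have "h j \<le> h (Suc j)"
        unfolding hS using h0[of j] mult_left_mono[of 1 "f j" "h j"] by simp
      then show ?thesis
        using Suc j by (simp add: j_def)
    qed (use Suc in simp)
  qed simp
  have above: "h (j0 + i) \<le> h j0" for i
  proof (induction i)
    case (Suc i)
    have "f (j0 + i) \<le> 1"
      using j0 dm by (simp add: f_def)
    then have "h (Suc (j0 + i)) \<le> h (j0 + i)"
      unfolding hS using h0[of "j0 + i"] mult_left_mono[of "f (j0 + i)" 1 "h (j0 + i)"] by simp
    then show ?case
      using Suc by simp
  qed simp
  have max: "h j \<le> h j0" for j
    using below[of "j0 - j"] above[of "j - j0"] by (cases "j \<le> j0") auto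
  have peak: "1 \<le> h j0"
  proof (rule sums_le)
    show "bino p m sums 1"
      by (rule has_sum_imp_sums[OF bino_has_sum])
    show "(\<lambda>j. h j0 * pois s j) sums h j0"
      using sums_mult[OF pois_sums, of "h j0" s] by simp
    show "bino p m j \<le> h j0 * pois s j" for j
      unfolding bh by (rule mult_right_mono[OF max less_imp_le[OF q0]])
  qed
  have right: "real (j0 + i) \<le> s + B \<Longrightarrow> (1 - x) ^ i \<le> h (j0 + i)" for i
  proof (induction i)
    case (Suc i)
    have "real (j0 + i) - s \<le> B"
      using Suc.prems by simp
    then have "1 - x \<le> f (j0 + i)"
      using dm unfolding f_def x by (simp add: divide_right_mono)
    then have "(1 - x) ^ i * (1 - x) \<le> h (j0 + i) * f (j0 + i)"
      using Suc x h0 by (intro mult_mono) auto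
    then show ?case
      by (simp add: hS mult.commute)
  qed (simp add: peak)
  have left: "i \<le> j0 \<Longrightarrow> s - B \<le> real (j0 - i) \<Longrightarrow> (1 - x) ^ i \<le> h (j0 - i)" for i
  proof (induction i)
    case (Suc i)
    define j where "j = j0 - Suc i"
    have j: "j0 - i = Suc j" "s - real j \<le> B"
      using Suc.prems by (auto simp: j_def)
    have "f j \<le> 1 + x"
    proof -
      have "(s - real j) / ((1 - p) * real m) \<le> x"
        using j dm unfolding x by (intro divide_right_mono) auto
      then show ?thesis
        unfolding f_def by (simp add: diff_divide_distrib)
    qed
    then have "f j * (1 - x) \<le> (1 + x) * (1 - x)"
      using x by (intro mult_right_mono) auto
    also have "\<dots> \<le> 1"
      using x0 by (simp add: algebra_simps)
    finally have "h j * (f j * (1 - x)) \<le> h j"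
      using mult_left_mono[of _ 1 "h j"] h0[of j] by simp
    moreover have "(1 - x) ^ i * (1 - x) \<le> h (Suc j) * (1 - x)"
      using Suc.IH Suc.prems x unfolding j(1)[symmetric] by (intro mult_right_mono) auto
    ultimately show ?case
      unfolding j_def[symmetric] hS by (simp add: mult_ac)
  qed (simp add: peak)
  have js: "\<bar>real j - s\<bar> \<le> B"
    using j by (simp add: s_def)
  show ?thesis
  proof (cases "j0 \<le> j")
    case True
    have "(1 - x) ^ (j - j0) \<le> h j"
      using right[of "j - j0"] True js by auto
    moreover have "real (j - j0) \<le> B + 1"
      using True js j0 by auto
    ultimately show ?thesis
      unfolding s_def[symmetric] bh
      using mult_right_mono[OF _ less_imp_le[OF q0[of j]]] by blast
  next
    case False
    have "(1 - x) ^ (j0 - j) \<le> h j"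
      using left[of "j0 - j"] False js by auto
    moreover have "real (j0 - j) \<le> B + 1"
      using False js j0 by auto
    ultimately show ?thesis
      unfolding s_def[symmetric] bh
      using mult_right_mono[OF _ less_imp_le[OF q0[of j]]] by blast
  qed
qed

text \<open>For \<open>B = R \<surd>s\<close> the loss \<open>(1 - x)\<^bsup>B + 1\<^esup>\<close> stays bounded below, as \<open>x (B + 1)\<close> is of order
  \<open>R\<^sup>2 / (1 - p)\<close>. The threshold \<open>M\<close> ensures \<open>x \<le> 1 / 2\<close>, where \<open>1 - x \<ge> e\<^bsup>- 2 x\<^esup>\<close>.\<close>

lemma bino_ge_pois_window:
  assumes p: "0 < p" "p < 1" and R: "0 < R"
  obtains c :: real and M :: nat where "0 < c" "c \<le> 1" "1 \<le> M"
    "\<And>m j. M \<le> m \<Longrightarrow> \<bar>real j - real m * p\<bar> \<le> R * sqrt (real m * p) \<Longrightarrow>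
      c * pois (real m * p) j \<le> bino p m j"
proof -
  define \<delta> where "\<delta> = 1 - p"
  have \<delta>: "0 < \<delta>"
    using p by (simp add: \<delta>_def)
  define c where "c = exp (- (2 * ((R\<^sup>2 + R) / \<delta>)))"
  define M where "M = nat \<lceil>(2 * R / \<delta>)\<^sup>2\<rceil> + 1"
  show ?thesis
  proof (rule that)
    show "0 < c" "c \<le> 1" "1 \<le> M"
      using R \<delta> by (auto simp: c_def M_def)
    fix m j :: nat
    assume m: "M \<le> m" and j: "\<bar>real j - real m * p\<bar> \<le> R * sqrt (real m * p)"
    define s where "s = real m * p"
    define B where "B = R * sqrt s"
    define x where "x = B / ((1 - p) * real m)"
    have m1: "1 \<le> m"
      using m by (simp add: M_def)
    have s: "0 < s" "s \<le> real m"
      using p m1 by (auto simp: s_def mult_left_le)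
    have sm: "sqrt s \<le> sqrt (real m)"
      using s by simp
    also have "sqrt (real m) \<le> real m"
      using m1 by (intro real_le_lsqrt) (auto simp: power2_eq_square)
    finally have sm': "sqrt s \<le> real m" .
    have B0: "0 \<le> B"
      using R s by (simp add: B_def)
    have x0: "0 \<le> x"
      using B0 p m1 by (simp add: x_def)
    have "(2 * R / \<delta>)\<^sup>2 \<le> real m"
      using m unfolding M_def by linarith
    then have R2: "2 * R / \<delta> \<le> sqrt (real m)"
      by (rule real_le_rsqrt)
    \<comment> \<open>\<open>x \<le> R / (\<delta> \<surd>m)\<close>, which is at most \<open>1 / 2\<close> by the choice of \<open>M\<close>\<close>
    have "2 * x = 2 * R / \<delta> * sqrt s / real m"
      unfolding x_def B_def \<delta>_def by simp
    also have "\<dots> \<le> 2 * R / \<delta> * sqrt (real m) / real m"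
      using R \<delta> by (intro divide_right_mono mult_left_mono sm) auto
    also have "\<dots> \<le> sqrt (real m) * sqrt (real m) / real m"
      by (intro divide_right_mono mult_right_mono R2) auto
    also have "\<dots> = 1"
      using m1 by simp
    finally have x2: "x \<le> 1 / 2"
      by simp
    have "x * (B + 1) = (R\<^sup>2 * s + R * sqrt s) / (\<delta> * real m)"
      using s unfolding x_def B_def \<delta>_def by (simp add: power2_eq_square algebra_simps)
    also have "\<dots> \<le> (R\<^sup>2 * real m + R * real m) / (\<delta> * real m)"
      using s sm' R \<delta> m1 by (intro divide_right_mono add_mono mult_left_mono) auto
    also have "\<dots> = (R\<^sup>2 + R) / \<delta>"
      using m1 by (simp add: distrib_right[symmetric])
    finally have xB: "x * (B + 1) \<le> (R\<^sup>2 + R) / \<delta>" .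
    obtain i :: nat where i: "real i \<le> B + 1" "(1 - x) ^ i * pois s j \<le> bino p m j"
      using bino_ge_pois_window_aux[OF p m1 B0 x_def, of j] x2 j unfolding s_def B_def by auto
    have "c \<le> exp (- (2 * (x * (B + 1))))"
      unfolding c_def exp_le_cancel_iff neg_le_iff_le by (rule mult_left_mono[OF xB]) simp
    also have "\<dots> \<le> exp (- (2 * x * real i))"
      using mult_left_mono[OF i(1), of "2 * x"] x0 by simp
    also have "\<dots> = exp (- (2 * x)) ^ i"
      by (simp flip: exp_of_nat_mult add: mult_ac)
    also have "\<dots> \<le> (1 - x) ^ i"
    proof (rule power_mono)
      have "x * x \<le> x * (1 / 2)"
        by (rule mult_left_mono[OF x2 x0])
      then have "- (2 * x) \<le> ln (1 - x)"
        using ln_one_minus_pos_lower_bound[OF x0 x2] by (simp add: power2_eq_square)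
      then show "exp (- (2 * x)) \<le> 1 - x"
        using x2 by (subst (asm) ln_ge_iff) auto
    qed simp
    finally have "c * pois s j \<le> (1 - x) ^ i * pois s j"
      using s by (intro mult_right_mono) (auto simp: pois_nonneg)
    then show "c * pois (real m * p) j \<le> bino p m j"
      using i(2) by (simp add: s_def)
  qed
qed

section \<open>Comparison of the lazy and the continuous distance\<close>

context markov_chain
begin

text \<open>The chain at Poisson time \<open>p s\<close> is the lazy chain after a Poisson number of steps of mean \<open>s\<close>. At least \<open>m\<close>
  steps are made except with probability at most \<open>1 / (\<theta>\<^sup>2 s)\<close>, and more steps do not increase the distance.\<close>

lemma mix_dist_pois_le_mix_dist_bino:
  assumes p: "0 < p" "p < 1" and s: "0 < s" and \<theta>: "0 < \<theta>" and m: "real m \<le> (1 - \<theta>) * s"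
  shows "mix_dist (pois (p * s)) \<le> mix_dist (bino p m) + 1 / (\<theta>\<^sup>2 * s)"
proof (rule mix_dist_least)
  show "prob_weights (pois (p * s))"
    using p s by (intro prob_weights_pois) simp
  fix x A assume x: "x \<in> \<Omega>" "A \<subseteq> \<Omega>"
  let ?g = "gap x A" and ?D = "mix_dist (bino p m)"
  have pw: "prob_weights (bino p j)" for j
    by (rule prob_weights_bino) (use p in auto)
  have ps: "pois s summable_on UNIV"
    using prob_weightsD(2)[OF prob_weights_pois] s by simp
  have f: "(\<lambda>i. bino p j i * ?g i) summable_on UNIV" for j
    by (rule summable_on_mult_bounded[OF prob_weightsD(2)[OF pw]]) (rule gap_bound[OF x])
  have C: "(\<Sum>\<^sub>\<infinity>i. \<bar>bino p j i * ?g i\<bar>) \<le> 1" for j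
  proof -
    have "(\<Sum>\<^sub>\<infinity>i. \<bar>bino p j i * ?g i\<bar>) \<le> infsum (bino p j) UNIV"
      by (rule infsum_mono[OF summable_on_abs[OF f] prob_weightsD(2)[OF pw]])
         (use prob_weightsD(1)[OF pw] gap_bound[OF x] in \<open>auto simp: abs_mult intro!: mult_left_le\<close>)
    then show ?thesis
      using prob_weightsD(3)[OF pw] by simp
  qed
  have mix: "(\<Sum>\<^sub>\<infinity>j. pois s j * (bino p j i * ?g i)) = pois (p * s) i * ?g i" for i
    using infsumI[OF has_sum_cmult_left[OF pois_mix_bino[of s p i], of "?g i"]] p s
    by (simp add: mult.assoc)
  have eq: "(\<Sum>\<^sub>\<infinity>i. pois (p * s) i * ?g i) = (\<Sum>\<^sub>\<infinity>j. pois s j * (\<Sum>\<^sub>\<infinity>i. bino p j i * ?g i))"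
    using infsum_weighted_swap(1)[of "pois s" UNIV "\<lambda>j i. bino p j i * ?g i" UNIV 1, OF ps f C]
    unfolding mix by simp
  define S where "S = {j. j < m}"
  have S: "\<theta> \<le> \<bar>1 - real j / s\<bar>" if "j \<in> S" for j
  proof -
    have "real j \<le> (1 - \<theta>) * s"
      using that m unfolding S_def by simp
    then have "real j / s \<le> 1 - \<theta>"
      using s by (simp add: field_simps)
    then show ?thesis by linarith
  qed
  have cD: "((\<lambda>j. pois s j * ?D) has_sum (1 * ?D)) UNIV"
    by (intro has_sum_cmult_left pois_has_sum) (use s in simp)
  have inner: "(\<Sum>\<^sub>\<infinity>i. bino p j i * ?g i) \<le> ?D + of_bool (j \<in> S)" for j
  proof (cases "j < m")
    case True
    have "(\<Sum>\<^sub>\<infinity>i. bino p j i * ?g i) \<le> 1"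
      using abs_weighted_gap_le_1[OF pw x, of j] by linarith
    then show ?thesis
      using True mix_dist_nonneg[OF pw, of m] by (simp add: S_def)
  next
    case False
    have "(\<Sum>\<^sub>\<infinity>i. bino p j i * ?g i) \<le> mix_dist (bino p j)"
      by (rule weighted_gap_le_mix_dist[OF pw x])
    also have "\<dots> \<le> ?D"
      by (rule mix_dist_bino_antimono) (use p False in auto)
    finally show ?thesis
      using False by (simp add: S_def)
  qed
  have "(\<Sum>\<^sub>\<infinity>j. pois s j * (\<Sum>\<^sub>\<infinity>i. bino p j i * ?g i))
      \<le> (\<Sum>\<^sub>\<infinity>j. pois s j * ?D + pois s j * of_bool (j \<in> S))"
  proof (rule infsum_mono)
    show "(\<lambda>j. pois s j * (\<Sum>\<^sub>\<infinity>i. bino p j i * ?g i)) summable_on UNIV"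
      by (rule summable_on_mult_bounded[OF ps]) (rule abs_weighted_gap_le_1[OF pw x])
    show "(\<lambda>j. pois s j * ?D + pois s j * of_bool (j \<in> S)) summable_on UNIV"
      by (intro summable_on_add has_sum_imp_summable[OF cD] pois_chebyshev(1)[OF s \<theta> S])
    show "pois s j * (\<Sum>\<^sub>\<infinity>i. bino p j i * ?g i) \<le> pois s j * ?D + pois s j * of_bool (j \<in> S)" for j
      using mult_left_mono[OF inner[of j] pois_nonneg[of s j]] s by (simp add: distrib_left)
  qed
  also have "\<dots> = ?D + (\<Sum>\<^sub>\<infinity>j. pois s j * of_bool (j \<in> S))"
    using infsumI[OF cD]
    by (subst infsum_add[OF has_sum_imp_summable[OF cD] pois_chebyshev(1)[OF s \<theta> S]]) auto
  also have "\<dots> \<le> ?D + 1 / (\<theta>\<^sup>2 * s)"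
    using pois_chebyshev(2)[OF s \<theta> S] by simp
  finally show "(\<Sum>\<^sub>\<infinity>i. pois (p * s) i * ?g i) \<le> ?D + 1 / (\<theta>\<^sup>2 * s)"
    unfolding eq .
qed

lemma mix_dist_bino_le_of_approx:
  assumes p: "0 < p" "p < 1" and t: "0 \<le> t" and v: "v summable_on UNIV" "(\<Sum>\<^sub>\<infinity>k. \<bar>v k\<bar>) \<le> C"
    and \<eta>: "(\<Sum>\<^sub>\<infinity>j. \<bar>bino p m j - conv (pois t) v j\<bar>) \<le> \<eta>"
  shows "mix_dist (bino p m) \<le> C * mix_dist (pois t) + \<eta>"
proof (rule mix_dist_least)
  show pw: "prob_weights (bino p m)"
    by (rule prob_weights_bino) (use p in auto)
  have pt: "prob_weights (pois t)"
    by (rule prob_weights_pois[OF t])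
  fix x A assume x: "x \<in> \<Omega>" "A \<subseteq> \<Omega>"
  let ?g = "gap x A"
  have cs: "conv (pois t) v summable_on UNIV"
    by (rule conv_weighted_sum(2)[OF prob_weightsD(2)[OF pt] v(1), of "\<lambda>_. 0" 0]) simp
  have ds: "(\<lambda>j. bino p m j - conv (pois t) v j) summable_on UNIV"
    using has_sum_diff_real[OF has_sum_infsum[OF prob_weightsD(2)[OF pw]] has_sum_infsum[OF cs]]
      has_sum_imp_summable by blast
  have "(\<Sum>\<^sub>\<infinity>j. bino p m j * ?g j)
      = (\<Sum>\<^sub>\<infinity>j. conv (pois t) v j * ?g j + (bino p m j - conv (pois t) v j) * ?g j)"
    by (simp add: algebra_simps)
  also have "\<dots> = (\<Sum>\<^sub>\<infinity>j. conv (pois t) v j * ?g j) + (\<Sum>\<^sub>\<infinity>j. (bino p m j - conv (pois t) v j) * ?g j)"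
    by (intro infsum_add summable_on_mult_bounded[OF cs gap_bound[OF x]]
        summable_on_mult_bounded[OF ds gap_bound[OF x]])
  also have "\<dots> \<le> C * mix_dist (pois t) + \<eta>"
  proof (rule add_mono)
    have "(\<Sum>\<^sub>\<infinity>j. conv (pois t) v j * ?g j) \<le> (\<Sum>\<^sub>\<infinity>k. \<bar>v k\<bar>) * mix_dist (pois t)"
      using weighted_gap_conv_le[OF pt v(1) x] by linarith
    also have "\<dots> \<le> C * mix_dist (pois t)"
      by (rule mult_right_mono[OF v(2) mix_dist_nonneg[OF pt]])
    finally show "(\<Sum>\<^sub>\<infinity>j. conv (pois t) v j * ?g j) \<le> C * mix_dist (pois t)" .
    show "(\<Sum>\<^sub>\<infinity>j. (bino p m j - conv (pois t) v j) * ?g j) \<le> \<eta>"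
      using abs_infsum_mult_le[OF ds, of ?g 1] gap_bound[OF x] \<eta> by fastforce
  qed
  finally show "(\<Sum>\<^sub>\<infinity>j. bino p m j * ?g j) \<le> C * mix_dist (pois t) + \<eta>" .
qed

text \<open>Write the binomial weights as \<open>c\<close> times the Poisson weights on the window, plus a nonnegative rest. The
  probability of missing the event \<open>A\<close> is then at least \<open>c\<close> times what it is for the Poisson mixture, up to the
  Poisson mass outside the window, at most \<open>1 / R\<^sup>2\<close>.\<close>

lemma mix_dist_bino_le_of_overlap:
  assumes p: "0 < p" "p < 1" and s: "0 < s" and c: "0 \<le> c" "c \<le> 1" and R: "0 < R"
    and W: "\<And>j. \<bar>real j - s\<bar> \<le> R * sqrt s \<Longrightarrow> c * pois s j \<le> bino p m j"
  shows "mix_dist (bino p m) \<le> 1 - c * (1 - 1 / R\<^sup>2 - mix_dist (pois s))"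
proof (rule mix_dist_least)
  show pw: "prob_weights (bino p m)"
    by (rule prob_weights_bino) (use p in auto)
  have pt: "prob_weights (pois s)"
    by (rule prob_weights_pois) (use s in simp)
  fix x A assume x: "x \<in> \<Omega>" "A \<subseteq> \<Omega>"
  let ?g = "gap x A"
  define e where "e = infsum \<pi> A"
  define S where "S = {j. \<not> \<bar>real j - s\<bar> \<le> R * sqrt s}"
  have e: "0 \<le> e" "e \<le> 1"
    using pi_bounds[OF x(2)] by (auto simp: e_def)
  have miss: "0 \<le> 1 - e - ?g j" "1 - e - ?g j \<le> 1" for j
    using P_abs_sum_le(2,3)[OF x, of j] by (auto simp: gap_def e_def)
  have S: "R / sqrt s \<le> \<bar>1 - real j / s\<bar>" if "j \<in> S" for j
  proof -
    have "\<bar>1 - real j / s\<bar> = \<bar>real j - s\<bar> / s"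
    proof -
      have "1 - real j / s = - (real j - s) / s"
        using s by (simp add: field_simps)
      then show ?thesis
        using s by (simp add: abs_divide)
    qed
    moreover have "R / sqrt s = R * sqrt s / s"
      using s by (simp add: real_div_sqrt field_simps)
    ultimately show ?thesis
      using that s by (simp add: S_def divide_right_mono)
  qed
  have th: "0 < R / sqrt s"
    using R s by simp
  note cheb = pois_chebyshev[OF s th S]
  have gs: "(\<lambda>j. w j * ?g j) summable_on UNIV" if "prob_weights w" for w
    by (rule summable_on_mult_bounded[OF prob_weightsD(2)[OF that]]) (rule gap_bound[OF x])
  have lin: "((\<lambda>j. w j * (1 - e - ?g j)) has_sum (1 - e - (\<Sum>\<^sub>\<infinity>j. w j * ?g j))) UNIV"
    if w: "prob_weights w" for w
  proof -
    have "((\<lambda>j. w j * (1 - e) - w j * ?g j) has_sum (1 * (1 - e) - (\<Sum>\<^sub>\<infinity>j. w j * ?g j))) UNIV"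
      using w by (intro has_sum_diff_real has_sum_cmult_left has_sum_infsum gs) (auto simp: prob_weights_def)
    then show ?thesis
      by (simp add: algebra_simps)
  qed
  have "c * (1 - e - (\<Sum>\<^sub>\<infinity>j. pois s j * ?g j)) - c * (\<Sum>\<^sub>\<infinity>j. pois s j * of_bool (j \<in> S))
      \<le> 1 - e - (\<Sum>\<^sub>\<infinity>j. bino p m j * ?g j)"
  proof (rule has_sum_mono)
    show "((\<lambda>j. c * (pois s j * (1 - e - ?g j)) - c * (pois s j * of_bool (j \<in> S))) has_sum
        (c * (1 - e - (\<Sum>\<^sub>\<infinity>j. pois s j * ?g j)) - c * (\<Sum>\<^sub>\<infinity>j. pois s j * of_bool (j \<in> S)))) UNIV"
      by (intro has_sum_diff_real has_sum_cmult_right lin pt has_sum_infsum cheb(1))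
    show "((\<lambda>j. bino p m j * (1 - e - ?g j)) has_sum (1 - e - (\<Sum>\<^sub>\<infinity>j. bino p m j * ?g j))) UNIV"
      by (rule lin[OF pw])
    fix j :: nat
    have q: "0 \<le> c * pois s j"
      using c s by (simp add: pois_nonneg)
    show "c * (pois s j * (1 - e - ?g j)) - c * (pois s j * of_bool (j \<in> S)) \<le> bino p m j * (1 - e - ?g j)"
    proof (cases "j \<in> S")
      case True
      have "c * pois s j * (1 - e - ?g j) \<le> c * pois s j * 1"
        by (rule mult_left_mono[OF miss(2) q])
      moreover have "0 \<le> bino p m j * (1 - e - ?g j)"
        by (rule mult_nonneg_nonneg[OF prob_weightsD(1)[OF pw] miss(1)])
      ultimately show ?thesis
        using True by (simp add: mult.assoc)
    next
      case False
      have "c * pois s j * (1 - e - ?g j) \<le> bino p m j * (1 - e - ?g j)"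
        by (rule mult_right_mono[OF W miss(1)]) (use False in \<open>simp add: S_def\<close>)
      then show ?thesis
        using False by (simp add: mult.assoc)
    qed
  qed
  moreover have "c * (\<Sum>\<^sub>\<infinity>j. pois s j * of_bool (j \<in> S)) \<le> c * (1 / R\<^sup>2)"
    using cheb(2) s c by (intro mult_left_mono) (auto simp: power_divide)
  moreover have "c * (\<Sum>\<^sub>\<infinity>j. pois s j * ?g j) \<le> c * mix_dist (pois s)"
    by (rule mult_left_mono[OF weighted_gap_le_mix_dist[OF pt x] c(1)])
  moreover have "c * e \<le> e"
    using c e by (simp add: mult_left_le_one_le)
  ultimately show "(\<Sum>\<^sub>\<infinity>j. bino p m j * ?g j) \<le> 1 - c * (1 - 1 / R\<^sup>2 - mix_dist (pois s))"
    by (simp add: algebra_simps)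
qed

end

section \<open>Comparison of the mixing times\<close>

lemma less_add_one_ereal:
  fixes a :: ereal
  shows "0 \<le> a \<Longrightarrow> a \<noteq> \<infinity> \<Longrightarrow> a < a + 1"
  by (cases a) auto

context markov_chain
begin

lemma T_cont_le: "0 \<le> t \<Longrightarrow> d_cont \<Omega> K \<pi> t \<le> \<epsilon> \<Longrightarrow> T_cont \<Omega> K \<pi> \<epsilon> \<le> ereal t"
  unfolding T_cont_def by (rule Inf_lower) blast

lemma T_lazy_le: "d_lazy \<delta> \<Omega> K \<pi> m \<le> \<epsilon> \<Longrightarrow> T_lazy \<delta> \<Omega> K \<pi> \<epsilon> \<le> ereal (real m)"
  unfolding T_lazy_def by (rule Inf_lower) blast

lemma T_cont_nonneg: "0 \<le> T_cont \<Omega> K \<pi> \<epsilon>"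
  unfolding T_cont_def by (rule Inf_greatest) auto

lemma T_lazy_nonneg: "0 \<le> T_lazy \<delta> \<Omega> K \<pi> \<epsilon>"
  unfolding T_lazy_def by (rule Inf_greatest) auto

lemma T_cont_witness:
  assumes "T_cont \<Omega> K \<pi> \<epsilon> \<noteq> \<infinity>"
  obtains t where "0 \<le> t" "d_cont \<Omega> K \<pi> t \<le> \<epsilon>" "ereal t \<le> T_cont \<Omega> K \<pi> \<epsilon> + 1"
proof -
  have "T_cont \<Omega> K \<pi> \<epsilon> < T_cont \<Omega> K \<pi> \<epsilon> + 1"
    by (rule less_add_one_ereal[OF T_cont_nonneg assms])
  then have "\<exists>a \<in> {ereal t | t. 0 \<le> t \<and> d_cont \<Omega> K \<pi> t \<le> \<epsilon>}. a < T_cont \<Omega> K \<pi> \<epsilon> + 1"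
    unfolding Inf_less_iff[symmetric] T_cont_def .
  then show ?thesis
    using that less_imp_le by blast
qed

lemma T_lazy_witness:
  assumes "T_lazy \<delta> \<Omega> K \<pi> \<epsilon> \<noteq> \<infinity>"
  obtains m where "d_lazy \<delta> \<Omega> K \<pi> m \<le> \<epsilon>" "ereal (real m) \<le> T_lazy \<delta> \<Omega> K \<pi> \<epsilon> + 1"
proof -
  have "T_lazy \<delta> \<Omega> K \<pi> \<epsilon> < T_lazy \<delta> \<Omega> K \<pi> \<epsilon> + 1"
    by (rule less_add_one_ereal[OF T_lazy_nonneg assms])
  then have "\<exists>a \<in> {ereal (real m) | m. d_lazy \<delta> \<Omega> K \<pi> m \<le> \<epsilon>}. a < T_lazy \<delta> \<Omega> K \<pi> \<epsilon> + 1"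
    unfolding Inf_less_iff[symmetric] T_lazy_def .
  then show ?thesis
    using that less_imp_le by blast
qed

end

lemma T_cont_le_T_lazy:
  assumes \<delta>: "0 < \<delta>" "\<delta> < 1" and \<epsilon>: "\<epsilon> < \<eta>" and \<theta>: "0 < \<theta>"
  obtains S where "\<And>\<Omega> (K :: 'a \<Rightarrow> 'a \<Rightarrow> real) \<pi>. markov_chain \<Omega> K \<pi> \<Longrightarrow>
      T_cont \<Omega> K \<pi> \<eta> \<le> ereal (1 + \<theta>) * (ereal (1 - \<delta>) * T_lazy \<delta> \<Omega> K \<pi> \<epsilon>) + ereal S"
proof -
  define p where "p = 1 - \<delta>"
  \<comment> \<open>chosen such that \<open>1 - \<theta>' = 1 / (1 + \<theta>)\<close>\<close>
  define \<theta>' where "\<theta>' = \<theta> / (1 + \<theta>)"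
  define S' where "S' = 1 / (\<theta>'\<^sup>2 * (\<eta> - \<epsilon>))"
  have p: "0 < p" "p < 1"
    using \<delta> by (auto simp: p_def)
  have \<theta>': "0 < \<theta>'" "1 - \<theta>' = 1 / (1 + \<theta>)"
    using \<theta> by (auto simp: \<theta>'_def field_simps)
  have S': "0 < S'"
    using \<theta>' \<epsilon> by (simp add: S'_def)
  show ?thesis
  proof (rule that)
    fix \<Omega> and K :: "'a \<Rightarrow> 'a \<Rightarrow> real" and \<pi>
    assume "markov_chain \<Omega> K \<pi>"
    then interpret markov_chain \<Omega> K \<pi> .
    show "T_cont \<Omega> K \<pi> \<eta> \<le> ereal (1 + \<theta>) * (ereal (1 - \<delta>) * T_lazy \<delta> \<Omega> K \<pi> \<epsilon>)
        + ereal (p * (1 + \<theta> + S'))"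
    proof (cases "T_lazy \<delta> \<Omega> K \<pi> \<epsilon> = \<infinity>")
      case True
      then show ?thesis
        using \<delta> \<theta> by simp
    next
      case False
      then obtain m where m: "d_lazy \<delta> \<Omega> K \<pi> m \<le> \<epsilon>" "ereal (real m) \<le> T_lazy \<delta> \<Omega> K \<pi> \<epsilon> + 1"
        by (rule T_lazy_witness)
      obtain T where T: "T_lazy \<delta> \<Omega> K \<pi> \<epsilon> = ereal T"
        using False T_lazy_nonneg[of \<delta> \<epsilon>] by (cases "T_lazy \<delta> \<Omega> K \<pi> \<epsilon>") auto
      have mT: "real m \<le> T + 1"
        using m(2) by (simp add: T one_ereal_def)
      \<comment> \<open>the summand \<open>S'\<close> makes the Chebyshev error at most \<open>\<eta> - \<epsilon>\<close> even for small \<open>m\<close>\<close>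
      define s where "s = (1 + \<theta>) * real m + S'"
      have s: "0 < s" "S' \<le> s"
        using S' \<theta> by (auto simp: s_def add_nonneg_pos)
      have ms: "real m \<le> (1 - \<theta>') * s"
        using \<theta> S' unfolding \<theta>'(2) s_def by (simp add: field_simps)
      have "1 / (\<theta>'\<^sup>2 * s) \<le> 1 / (\<theta>'\<^sup>2 * S')"
        using \<theta>' s S' by (intro divide_left_mono mult_left_mono) auto
      also have "\<dots> = \<eta> - \<epsilon>"
        using \<theta>' \<epsilon> by (simp add: S'_def)
      finally have "mix_dist (pois (p * s)) \<le> \<eta>"
        using mix_dist_pois_le_mix_dist_bino[OF p s(1) \<theta>'(1) ms] m(1) d_lazy_eq[of \<delta> m] \<delta>
        by (simp add: p_def)
      then have "T_cont \<Omega> K \<pi> \<eta> \<le> ereal (p * s)"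
        using p s by (intro T_cont_le) (simp_all add: d_cont_eq)
      also have "p * s \<le> (1 + \<theta>) * (p * T) + p * (1 + \<theta> + S')"
        using mult_left_mono[OF mT, of "p * (1 + \<theta>)"] p \<theta> by (simp add: s_def algebra_simps)
      finally show ?thesis
        by (simp add: T p_def)
    qed
  qed
qed

text \<open>The level \<open>\<epsilon>'\<close> has to be small enough to compensate the constant \<open>C\<close> of the deconvolution.\<close>

lemma T_lazy_le_T_cont:
  assumes \<delta>: "0 < \<delta>" "\<delta> < 1" and \<epsilon>: "0 < \<epsilon>" "\<epsilon> < 1" and \<theta>: "0 < \<theta>"
  obtains \<epsilon>' S where "0 < \<epsilon>'" "\<epsilon>' < 1"
    "\<And>\<Omega> (K :: 'a \<Rightarrow> 'a \<Rightarrow> real) \<pi>. markov_chain \<Omega> K \<pi> \<Longrightarrow>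
      ereal (1 - \<delta>) * T_lazy \<delta> \<Omega> K \<pi> \<epsilon> \<le> ereal (1 + \<theta>) * T_cont \<Omega> K \<pi> \<epsilon>' + ereal S"
proof -
  define p where "p = 1 - \<delta>"
  have p: "0 < p" "p < 1"
    using \<delta> by (auto simp: p_def)
  obtain C where C: "\<And>m. 1 \<le> m \<Longrightarrow> \<exists>v. v summable_on UNIV \<and> (\<Sum>\<^sub>\<infinity>k. \<bar>v k\<bar>) \<le> C \<and>
      (\<Sum>\<^sub>\<infinity>j. \<bar>bino p m j - conv (pois (real m * p / (1 + \<theta>))) v j\<bar>) \<le> \<epsilon> / 2"
    using bino_approx_pois_conv[OF p \<theta>, of "\<epsilon> / 2"] \<epsilon> by auto
  define C' where "C' = max 1 C"
  define \<epsilon>' where "\<epsilon>' = \<epsilon> / (2 * C')"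
  have C': "1 \<le> C'" "C \<le> C'"
    by (auto simp: C'_def)
  show ?thesis
  proof (rule that)
    show "0 < \<epsilon>'" "\<epsilon>' < 1"
      using \<epsilon> C' by (auto simp: \<epsilon>'_def field_simps)
    fix \<Omega> and K :: "'a \<Rightarrow> 'a \<Rightarrow> real" and \<pi>
    assume "markov_chain \<Omega> K \<pi>"
    then interpret markov_chain \<Omega> K \<pi> .
    show "ereal (1 - \<delta>) * T_lazy \<delta> \<Omega> K \<pi> \<epsilon> \<le> ereal (1 + \<theta>) * T_cont \<Omega> K \<pi> \<epsilon>'
        + ereal (1 + \<theta> + 2 * p)"
    proof (cases "T_cont \<Omega> K \<pi> \<epsilon>' = \<infinity>")
      case True
      then show ?thesis
        using \<theta> by simp
    next
      case False
      then obtain t where t: "0 \<le> t" "d_cont \<Omega> K \<pi> t \<le> \<epsilon>'" "ereal t \<le> T_cont \<Omega> K \<pi> \<epsilon>' + 1"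
        by (rule T_cont_witness)
      obtain T where T: "T_cont \<Omega> K \<pi> \<epsilon>' = ereal T"
        using False T_cont_nonneg[of \<epsilon>'] by (cases "T_cont \<Omega> K \<pi> \<epsilon>'") auto
      have tT: "t \<le> T + 1"
        using t(3) by (simp add: T one_ereal_def)
      \<comment> \<open>one is added because the expansion needs \<open>m \<ge> 1\<close>\<close>
      define m where "m = nat \<lceil>(1 + \<theta>) * t / p\<rceil> + 1"
      have q: "0 \<le> (1 + \<theta>) * t / p"
        using t \<theta> p by simp
      have m1: "1 \<le> m"
        by (simp add: m_def)
      have m: "(1 + \<theta>) * t / p \<le> real m" "real m \<le> (1 + \<theta>) * t / p + 2"
        using q unfolding m_def by linarith+
      define u where "u = real m * p / (1 + \<theta>)"
      have tu: "t \<le> u"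
        using m(1) p \<theta> by (simp add: u_def field_simps)
      obtain v where v: "v summable_on UNIV" "(\<Sum>\<^sub>\<infinity>k. \<bar>v k\<bar>) \<le> C"
          "(\<Sum>\<^sub>\<infinity>j. \<bar>bino p m j - conv (pois u) v j\<bar>) \<le> \<epsilon> / 2"
        using C[OF m1] unfolding u_def by blast
      have u0: "0 \<le> u"
        using t tu by linarith
      have D: "mix_dist (pois u) \<le> \<epsilon>'"
        using mix_dist_pois_antimono[OF t(1) tu] t by (simp add: d_cont_eq)
      have "mix_dist (bino p m) \<le> C * mix_dist (pois u) + \<epsilon> / 2"
        by (rule mix_dist_bino_le_of_approx[OF p u0 v])
      also have "C * mix_dist (pois u) \<le> C' * mix_dist (pois u)"
        by (rule mult_right_mono[OF C'(2) mix_dist_nonneg[OF prob_weights_pois[OF u0]]])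
      also have "C' * mix_dist (pois u) \<le> C' * \<epsilon>'"
        using C' by (intro mult_left_mono D) simp
      also have "C' * \<epsilon>' + \<epsilon> / 2 = \<epsilon>"
        using C' by (simp add: \<epsilon>'_def)
      finally have "mix_dist (bino p m) \<le> \<epsilon>"
        by simp
      then have "T_lazy \<delta> \<Omega> K \<pi> \<epsilon> \<le> ereal (real m)"
        using \<delta> by (intro T_lazy_le) (simp add: d_lazy_eq p_def)
      then have "ereal p * T_lazy \<delta> \<Omega> K \<pi> \<epsilon> \<le> ereal p * ereal (real m)"
        using p by (intro ereal_mult_left_mono) auto
      also have "ereal p * ereal (real m) \<le> ereal ((1 + \<theta>) * T + (1 + \<theta> + 2 * p))"
      proof -
        have "p * real m \<le> p * ((1 + \<theta>) * t / p + 2)"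
          using p by (intro mult_left_mono m(2)) simp
        also have "\<dots> = (1 + \<theta>) * t + 2 * p"
          using p by (simp add: distrib_left)
        also have "(1 + \<theta>) * t \<le> (1 + \<theta>) * (T + 1)"
          using \<theta> by (intro mult_left_mono tT) simp
        finally show ?thesis
          by (simp add: algebra_simps)
      qed
      finally show ?thesis
        by (simp add: T p_def)
    qed
  qed
qed

text \<open>The counterpart of the previous bound for levels near \<open>1\<close>: every level of the continuous chain is matched
  by some level \<open>\<epsilon>' < 1\<close> of the lazy chain.\<close>

lemma T_lazy_le_T_cont_near_one:
  assumes \<delta>: "0 < \<delta>" "\<delta> < 1" and \<epsilon>: "0 < \<epsilon>" "\<epsilon> < 1"
  obtains \<epsilon>' S where "0 < \<epsilon>'" "\<epsilon>' < 1"
    "\<And>\<Omega> (K :: 'a \<Rightarrow> 'a \<Rightarrow> real) \<pi>. markov_chain \<Omega> K \<pi> \<Longrightarrow>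
      ereal (1 - \<delta>) * T_lazy \<delta> \<Omega> K \<pi> \<epsilon>' \<le> T_cont \<Omega> K \<pi> \<epsilon> + ereal S"
proof -
  define p where "p = 1 - \<delta>"
  have p: "0 < p" "p < 1"
    using \<delta> by (auto simp: p_def)
  \<comment> \<open>half of the room \<open>1 - \<epsilon>\<close> pays for the Poisson mass outside the window\<close>
  define R where "R = sqrt (2 / (1 - \<epsilon>))"
  have R: "0 < R" "1 / R\<^sup>2 = (1 - \<epsilon>) / 2"
    using \<epsilon> by (auto simp: R_def)
  obtain c :: real and M :: nat where cM: "0 < c" "c \<le> 1" "1 \<le> M"
    and W: "\<And>m j. M \<le> m \<Longrightarrow> \<bar>real j - real m * p\<bar> \<le> R * sqrt (real m * p) \<Longrightarrow>
      c * pois (real m * p) j \<le> bino p m j"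
    by (rule bino_ge_pois_window[OF p R(1)]) blast
  define k where "k = c * ((1 - \<epsilon>) / 2)"
  define \<epsilon>' where "\<epsilon>' = 1 - k"
  have "k \<le> 1 * ((1 - \<epsilon>) / 2)"
    unfolding k_def using cM \<epsilon> by (intro mult_right_mono) auto
  also have "\<dots> < 1"
    using \<epsilon> by simp
  finally have k: "k < 1" "0 < k"
    using cM \<epsilon> by (simp_all add: k_def)
  show ?thesis
  proof (rule that)
    show "0 < \<epsilon>'" "\<epsilon>' < 1"
      using k by (auto simp: \<epsilon>'_def)
    fix \<Omega> and K :: "'a \<Rightarrow> 'a \<Rightarrow> real" and \<pi>
    assume "markov_chain \<Omega> K \<pi>"
    then interpret markov_chain \<Omega> K \<pi> .
    show "ereal (1 - \<delta>) * T_lazy \<delta> \<Omega> K \<pi> \<epsilon>' \<le> T_cont \<Omega> K \<pi> \<epsilon> + ereal (1 + p * (real M + 1))"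
    proof (cases "T_cont \<Omega> K \<pi> \<epsilon> = \<infinity>")
      case True
      then show ?thesis by simp
    next
      case False
      then obtain t where t: "0 \<le> t" "d_cont \<Omega> K \<pi> t \<le> \<epsilon>" "ereal t \<le> T_cont \<Omega> K \<pi> \<epsilon> + 1"
        by (rule T_cont_witness)
      obtain T where T: "T_cont \<Omega> K \<pi> \<epsilon> = ereal T"
        using False T_cont_nonneg[of \<epsilon>] by (cases "T_cont \<Omega> K \<pi> \<epsilon>") auto
      have tT: "t \<le> T + 1"
        using t(3) by (simp add: T one_ereal_def)
      \<comment> \<open>at least \<open>M\<close>, also when the mixing time is small\<close>
      define m where "m = M + nat \<lceil>t / p\<rceil>"
      have q: "0 \<le> t / p"
        using t p by simp
      have m: "t / p \<le> real m" "real m \<le> t / p + 1 + real M"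
        using q unfolding m_def by linarith+
      have mM: "M \<le> m"
        by (simp add: m_def)
      have s: "0 < real m * p" "t \<le> real m * p"
        using m p mM cM by (auto simp: field_simps)
      have D: "mix_dist (pois (real m * p)) \<le> \<epsilon>"
        using mix_dist_pois_antimono[OF t(1) s(2)] t by (simp add: d_cont_eq)
      have "mix_dist (bino p m) \<le> 1 - c * (1 - 1 / R\<^sup>2 - mix_dist (pois (real m * p)))"
        by (rule mix_dist_bino_le_of_overlap[OF p s(1) _ cM(2) R(1) W[OF mM]]) (use cM in auto)
      also have "\<dots> \<le> 1 - c * ((1 - \<epsilon>) / 2)"
        using D cM unfolding R(2) by (intro diff_left_mono mult_left_mono) (auto simp: field_simps)
      finally have "mix_dist (bino p m) \<le> \<epsilon>'"
        by (simp add: \<epsilon>'_def k_def)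
      then have "T_lazy \<delta> \<Omega> K \<pi> \<epsilon>' \<le> ereal (real m)"
        using \<delta> by (intro T_lazy_le) (simp add: d_lazy_eq p_def)
      then have "ereal p * T_lazy \<delta> \<Omega> K \<pi> \<epsilon>' \<le> ereal p * ereal (real m)"
        using p by (intro ereal_mult_left_mono) auto
      also have "ereal p * ereal (real m) \<le> ereal (T + (1 + p * (real M + 1)))"
      proof -
        have "p * real m \<le> p * (t / p + 1 + real M)"
          using p by (intro mult_left_mono m(2)) simp
        also have "\<dots> = t + p * (real M + 1)"
          using p by (simp add: distrib_left)
        finally show ?thesis
          using tT by simp
      qed
      finally show ?thesis
        by (simp add: T p_def)
    qed
  qed
qed

section \<open>Asymptotic comparison and cutoff\<close>

text \<open>\<open>limsup a / b \<le> 1\<close>, in a form that needs no division.\<close>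

definition asym_le :: "(nat \<Rightarrow> ereal) \<Rightarrow> (nat \<Rightarrow> ereal) \<Rightarrow> bool" where
  "asym_le a b \<longleftrightarrow> (\<forall>\<theta>>0. \<forall>\<^sub>F n in sequentially. a n \<le> ereal (1 + \<theta>) * b n)"

definition ev_pos_finite :: "(nat \<Rightarrow> ereal) \<Rightarrow> bool" where
  "ev_pos_finite a \<longleftrightarrow> (\<forall>\<^sub>F n in sequentially. 0 < a n \<and> a n < \<infinity>)"

lemma tendsto_PInfty_eventually_pos:
  fixes a :: "nat \<Rightarrow> ereal"
  shows "a \<longlonglongrightarrow> \<infinity> \<Longrightarrow> \<forall>\<^sub>F n in sequentially. 0 < a n"
  unfolding tendsto_PInfty zero_ereal_def by blast

lemma le_one_plus_mult:
  fixes b :: ereal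
  assumes "0 \<le> b" "0 < \<theta>"
  shows "b \<le> ereal (1 + \<theta>) * b"
proof -
  have "1 * b \<le> ereal (1 + \<theta>) * b"
    by (rule ereal_mult_right_mono) (use assms in \<open>auto simp: one_ereal_def\<close>)
  then show ?thesis by simp
qed

lemma asym_le_refl:
  assumes "\<forall>\<^sub>F n in sequentially. 0 \<le> b n"
  shows "asym_le b b"
  unfolding asym_le_def
  using assms by (auto elim!: eventually_mono intro: le_one_plus_mult)

text \<open>Additive constants are absorbed as \<open>b\<close> tends to infinity. The intermediate sequence \<open>c\<close> may depend on
  \<open>\<theta>\<close>, since the level \<open>\<epsilon>'\<close> in the comparison of the mixing times does.\<close>

lemma asym_le_via:
  assumes via: "\<And>\<theta>. 0 < \<theta> \<Longrightarrow> \<exists>c S. asym_le c b \<and> (\<forall>\<^sub>F n in sequentially. a n \<le> ereal (1 + \<theta>) * c n + ereal S)"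
    and b: "b \<longlonglongrightarrow> \<infinity>"
  shows "asym_le a b"
  unfolding asym_le_def
proof (intro allI impI)
  fix \<theta> :: real assume \<theta>: "0 < \<theta>"
  \<comment> \<open>so small that two factors \<open>1 + t\<close> and a summand \<open>t\<close> stay below \<open>1 + \<theta>\<close>\<close>
  define t where "t = min 1 (\<theta> / 4)"
  have t: "0 < t" "t \<le> 1" "4 * t \<le> \<theta>"
    using \<theta> by (auto simp: t_def)
  have tt: "(1 + t) * (1 + t) + t \<le> 1 + \<theta>"
  proof -
    have "t * t \<le> t * 1"
      using t by (intro mult_left_mono) auto
    then show ?thesis
      using t(3) by (simp add: algebra_simps)
  qed
  obtain c S where c: "asym_le c b" and S: "\<forall>\<^sub>F n in sequentially. a n \<le> ereal (1 + t) * c n + ereal S"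
    using via[OF t(1)] by blast
  have "\<forall>\<^sub>F n in sequentially. c n \<le> ereal (1 + t) * b n"
    using c t by (auto simp: asym_le_def)
  moreover have "\<forall>\<^sub>F n in sequentially. ereal (\<bar>S\<bar> / t) < b n"
    using b by (simp add: tendsto_PInfty)
  ultimately show "\<forall>\<^sub>F n in sequentially. a n \<le> ereal (1 + \<theta>) * b n"
    using S
  proof eventually_elim
    case (elim n)
    have a: "a n \<le> ereal (1 + t) * (ereal (1 + t) * b n) + ereal S"
      using elim(3) add_right_mono[OF ereal_mult_left_mono[OF elim(1), of "ereal (1 + t)"], of "ereal S"] t
      by (auto intro: order_trans)
    show ?case
    proof (cases "b n")
      case (real r)
      have "\<bar>S\<bar> / t < r"
        using elim(2) real by simp
      then have r: "S \<le> t * r" "0 \<le> r"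
        using t by (auto simp: field_simps intro: order_trans[of 0 "\<bar>S\<bar> / t"] less_imp_le)
      have "(1 + t) * ((1 + t) * r) + S \<le> ((1 + t) * (1 + t) + t) * r"
        using r by (simp add: algebra_simps)
      also have "\<dots> \<le> (1 + \<theta>) * r"
        by (rule mult_right_mono[OF tt r(2)])
      finally have "ereal (1 + t) * (ereal (1 + t) * b n) + ereal S \<le> ereal (1 + \<theta>) * b n"
        by (simp add: real)
      then show ?thesis
        by (rule order_trans[OF a])
    next
      case PInf
      then show ?thesis
        using \<theta> by simp
    next
      case MInf
      then show ?thesis
        using elim(2) by simp
    qed
  qed
qed

lemma asym_le_trans:
  assumes "asym_le a c" "asym_le c b" "b \<longlonglongrightarrow> \<infinity>"
  shows "asym_le a b"
proof (rule asym_le_via[OF _ assms(3)])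
  fix \<theta> :: real assume "0 < \<theta>"
  then have "\<forall>\<^sub>F n in sequentially. a n \<le> ereal (1 + \<theta>) * c n + ereal 0"
    using assms(1) by (simp add: asym_le_def)
  then show "\<exists>c S. asym_le c b \<and> (\<forall>\<^sub>F n in sequentially. a n \<le> ereal (1 + \<theta>) * c n + ereal S)"
    using assms(2) by blast
qed

lemma tendsto_PInfty_lower_bound:
  assumes a: "a \<longlonglongrightarrow> (\<infinity>::ereal)" and C: "0 < C"
    and le: "\<forall>\<^sub>F n in sequentially. a n \<le> ereal C * b n + ereal S"
  shows "b \<longlonglongrightarrow> \<infinity>"
  unfolding tendsto_PInfty
proof
  fix r
  have "\<forall>\<^sub>F n in sequentially. ereal (C * r + S) < a n"
    using a by (simp add: tendsto_PInfty)
  then show "\<forall>\<^sub>F n in sequentially. ereal r < b n"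
    using le
  proof eventually_elim
    case (elim n)
    show ?case
    proof (rule ccontr)
      assume "\<not> ereal r < b n"
      then have "ereal C * b n \<le> ereal C * ereal r"
        using C by (intro ereal_mult_left_mono) auto
      then have "ereal C * b n + ereal S \<le> ereal (C * r + S)"
        using add_right_mono[of "ereal C * b n" "ereal C * ereal r" "ereal S"] by simp
      then show False
        using elim by (meson leD order_trans)
    qed
  qed
qed

lemma asym_le_tendsto_PInfty:
  assumes "a \<longlonglongrightarrow> \<infinity>" "asym_le a b"
  shows "b \<longlonglongrightarrow> \<infinity>"
proof (rule tendsto_PInfty_lower_bound[of a 2 b 0])
  show "\<forall>\<^sub>F n in sequentially. a n \<le> ereal 2 * b n + ereal 0"
    using assms(2)[unfolded asym_le_def, rule_format, of 1] by simp
qed (use assms in auto)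

lemma ratio_tendsto_1_iff:
  assumes "ev_pos_finite a" "ev_pos_finite b"
  shows "(\<lambda>n. a n / b n) \<longlonglongrightarrow> 1 \<longleftrightarrow> asym_le a b \<and> asym_le b a"
proof -
  define x where "x n = real_of_ereal (a n)" for n
  define y where "y n = real_of_ereal (b n)" for n
  have ev: "\<forall>\<^sub>F n in sequentially. a n = ereal (x n) \<and> b n = ereal (y n) \<and> 0 < x n \<and> 0 < y n"
    using assms[unfolded ev_pos_finite_def]
  proof eventually_elim
    case (elim n)
    then show ?case
      by (cases "a n"; cases "b n") (auto simp: x_def y_def)
  qed
  have "(\<lambda>n. a n / b n) \<longlonglongrightarrow> 1 \<longleftrightarrow> (\<lambda>n. ereal (x n / y n)) \<longlonglongrightarrow> ereal 1"
    unfolding one_ereal_def by (rule tendsto_cong, use ev in eventually_elim) auto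
  also have "\<dots> \<longleftrightarrow> (\<lambda>n. x n / y n) \<longlonglongrightarrow> 1"
    by simp
  also have "\<dots> \<longleftrightarrow> asym_le a b \<and> asym_le b a"
  proof
    assume lim: "(\<lambda>n. x n / y n) \<longlonglongrightarrow> 1"
    have "asym_le a b"
      unfolding asym_le_def
    proof (intro allI impI)
      fix \<theta> :: real assume \<theta>: "0 < \<theta>"
      have "\<forall>\<^sub>F n in sequentially. x n / y n < 1 + \<theta>"
        by (rule order_tendstoD(2)[OF lim]) (use \<theta> in simp)
      then show "\<forall>\<^sub>F n in sequentially. a n \<le> ereal (1 + \<theta>) * b n"
        using ev by eventually_elim (auto simp: field_simps)
    qed
    moreover have "asym_le b a"
      unfolding asym_le_def
    proof (intro allI impI)
      fix \<theta> :: real assume \<theta>: "0 < \<theta>"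
      have "\<forall>\<^sub>F n in sequentially. 1 / (1 + \<theta>) < x n / y n"
        by (rule order_tendstoD(1)[OF lim]) (use \<theta> in simp)
      then show "\<forall>\<^sub>F n in sequentially. b n \<le> ereal (1 + \<theta>) * a n"
        using ev by eventually_elim (use \<theta> in \<open>auto simp: field_simps\<close>)
    qed
    ultimately show "asym_le a b \<and> asym_le b a" ..
  next
    assume as: "asym_le a b \<and> asym_le b a"
    show "(\<lambda>n. x n / y n) \<longlonglongrightarrow> 1"
    proof (rule tendstoI)
      fix e :: real assume e: "0 < e"
      define \<theta> where "\<theta> = e / 2"
      have \<theta>: "0 < \<theta>" "\<theta> < e"
        using e by (auto simp: \<theta>_def)
      have "\<forall>\<^sub>F n in sequentially. a n \<le> ereal (1 + \<theta>) * b n"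
        and "\<forall>\<^sub>F n in sequentially. b n \<le> ereal (1 + \<theta>) * a n"
        using as \<theta> by (auto simp: asym_le_def)
      then show "\<forall>\<^sub>F n in sequentially. dist (x n / y n) 1 < e"
        using ev
      proof eventually_elim
        case (elim n)
        have xy: "0 < x n" "0 < y n" "x n \<le> (1 + \<theta>) * y n" "y n \<le> (1 + \<theta>) * x n"
          using elim by auto
        have "(1 - \<theta>) * y n \<le> x n"
        proof (cases "\<theta> \<le> 1")
          case True
          have "(1 - \<theta>) * y n \<le> (1 - \<theta>) * ((1 + \<theta>) * x n)"
            using True by (intro mult_left_mono xy(4)) simp
          also have "\<dots> = (1 - \<theta> * \<theta>) * x n"
            by (simp add: algebra_simps)
          also have "\<dots> \<le> x n"
            using xy \<theta> by (intro mult_left_le_one_le) (use True in \<open>auto simp: mult_le_one\<close>)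
          finally show ?thesis .
        next
          case False
          then have "(1 - \<theta>) * y n \<le> 0"
            using xy by (simp add: mult_nonpos_nonneg)
          then show ?thesis
            using xy by linarith
        qed
        then have "1 - \<theta> \<le> x n / y n" "x n / y n \<le> 1 + \<theta>"
          using xy by (auto simp: field_simps)
        then show ?case
          using \<theta> by (simp add: dist_real_def abs_less_iff)
      qed
    qed
  qed
  finally show ?thesis .
qed

lemma has_cutoff_iff:
  assumes nn: "\<And>\<epsilon>. \<forall>\<^sub>F n in sequentially. 0 \<le> T n \<epsilon>"
  shows "has_cutoff T \<longleftrightarrow> (\<forall>\<epsilon>\<in>{0<..<1}. ev_pos_finite (\<lambda>n. T n \<epsilon>)) \<and>
    (\<forall>\<epsilon>\<in>{0<..<1}. \<forall>\<eta>\<in>{0<..<1}. asym_le (\<lambda>n. T n \<epsilon>) (\<lambda>n. T n \<eta>))"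
proof
  assume cut: "has_cutoff T"
  have fin: "ev_pos_finite (\<lambda>n. T n \<epsilon>)" if "\<epsilon> \<in> {0<..<1}" for \<epsilon>
  proof -
    have "\<forall>\<^sub>F n in sequentially. 0 < T n \<epsilon> \<and> T n \<epsilon> < \<infinity> \<and> 0 < T n ((1 + \<epsilon>) / 2) \<and> T n ((1 + \<epsilon>) / 2) < \<infinity>"
      using cut[unfolded has_cutoff_def, rule_format, of \<epsilon> "(1 + \<epsilon>) / 2"] that by simp
    then show ?thesis
      unfolding ev_pos_finite_def by eventually_elim auto
  qed
  have lt: "asym_le (\<lambda>n. T n \<epsilon>) (\<lambda>n. T n \<eta>) \<and> asym_le (\<lambda>n. T n \<eta>) (\<lambda>n. T n \<epsilon>)"
    if "0 < \<epsilon>" "\<epsilon> < \<eta>" "\<eta> < 1" for \<epsilon> \<eta>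
    using cut that ratio_tendsto_1_iff[OF fin[of \<epsilon>] fin[of \<eta>]] unfolding has_cutoff_def by auto
  have "asym_le (\<lambda>n. T n \<epsilon>) (\<lambda>n. T n \<eta>)" if "\<epsilon> \<in> {0<..<1}" "\<eta> \<in> {0<..<1}" for \<epsilon> \<eta>
    using lt[of \<epsilon> \<eta>] lt[of \<eta> \<epsilon>] asym_le_refl[of "\<lambda>n. T n \<epsilon>"] nn that
    by (cases \<epsilon> \<eta> rule: linorder_cases) auto
  with fin show "(\<forall>\<epsilon>\<in>{0<..<1}. ev_pos_finite (\<lambda>n. T n \<epsilon>)) \<and>
    (\<forall>\<epsilon>\<in>{0<..<1}. \<forall>\<eta>\<in>{0<..<1}. asym_le (\<lambda>n. T n \<epsilon>) (\<lambda>n. T n \<eta>))"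
    by blast
next
  assume r: "(\<forall>\<epsilon>\<in>{0<..<1}. ev_pos_finite (\<lambda>n. T n \<epsilon>)) \<and>
    (\<forall>\<epsilon>\<in>{0<..<1}. \<forall>\<eta>\<in>{0<..<1}. asym_le (\<lambda>n. T n \<epsilon>) (\<lambda>n. T n \<eta>))"
  show "has_cutoff T"
    unfolding has_cutoff_def
  proof (intro allI impI conjI)
    fix \<epsilon> \<eta> :: real assume e: "0 < \<epsilon> \<and> \<epsilon> < \<eta> \<and> \<eta> < 1"
    have f: "ev_pos_finite (\<lambda>n. T n \<epsilon>)" "ev_pos_finite (\<lambda>n. T n \<eta>)"
      using r e by auto
    then show "\<forall>\<^sub>F n in sequentially. 0 < T n \<epsilon> \<and> T n \<epsilon> < \<infinity> \<and> 0 < T n \<eta> \<and> T n \<eta> < \<infinity>"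
      unfolding ev_pos_finite_def by eventually_elim auto
    show "(\<lambda>n. T n \<epsilon> / T n \<eta>) \<longlonglongrightarrow> 1"
      unfolding ratio_tendsto_1_iff[OF f] using r e by auto
  qed
qed

lemma ev_pos_finite_of_bound:
  assumes "a \<longlonglongrightarrow> \<infinity>" "ev_pos_finite b" "\<forall>\<^sub>F n in sequentially. a n \<le> ereal C * b n + ereal S"
  shows "ev_pos_finite a"
  using tendsto_PInfty_eventually_pos[OF assms(1)] assms(2,3) unfolding ev_pos_finite_def
proof eventually_elim
  case (elim n)
  have "ereal C * b n + ereal S < \<infinity>"
    using elim(2) by (cases "b n") auto
  then show ?case
    using elim(1) le_less_trans[OF elim(3)] by blast
qed

text \<open>Think of \<open>A\<close> as the continuous mixing times and of \<open>B\<close> as \<open>1 - \<delta>\<close> times the lazy ones. If \<open>A\<close> has a cutoff,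
  then \<open>AB\<close> and \<open>BA\<close> squeeze every \<open>B\<close> between two levels of \<open>A\<close>, which are asymptotically equal. If \<open>B\<close> has
  a cutoff, \<open>BA\<close> would bound only the \<open>A\<close> at small levels from below; \<open>BA1\<close> does so for every level of \<open>A\<close>, by
  some level of \<open>B\<close>.\<close>

lemma cutoff_transfer:
  fixes A B :: "nat \<Rightarrow> real \<Rightarrow> ereal"
  assumes nnA: "\<And>\<epsilon>. \<forall>\<^sub>F n in sequentially. 0 \<le> A n \<epsilon>" and nnB: "\<And>\<epsilon>. \<forall>\<^sub>F n in sequentially. 0 \<le> B n \<epsilon>"
    and AB: "\<And>\<epsilon> \<eta> \<theta>. 0 < \<epsilon> \<Longrightarrow> \<epsilon> < \<eta> \<Longrightarrow> \<eta> < 1 \<Longrightarrow> 0 < \<theta> \<Longrightarrow>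
      \<exists>S. \<forall>\<^sub>F n in sequentially. A n \<eta> \<le> ereal (1 + \<theta>) * B n \<epsilon> + ereal S"
    and BA: "\<And>\<epsilon> \<theta>. 0 < \<epsilon> \<Longrightarrow> \<epsilon> < 1 \<Longrightarrow> 0 < \<theta> \<Longrightarrow>
      \<exists>\<epsilon>' S. 0 < \<epsilon>' \<and> \<epsilon>' < 1 \<and> (\<forall>\<^sub>F n in sequentially. B n \<epsilon> \<le> ereal (1 + \<theta>) * A n \<epsilon>' + ereal S)"
    and BA1: "\<And>\<epsilon>. 0 < \<epsilon> \<Longrightarrow> \<epsilon> < 1 \<Longrightarrow>
      \<exists>\<epsilon>' S. 0 < \<epsilon>' \<and> \<epsilon>' < 1 \<and> (\<forall>\<^sub>F n in sequentially. B n \<epsilon>' \<le> A n \<epsilon> + ereal S)"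
    and e0: "0 < \<epsilon>0" "\<epsilon>0 < 1" and inf: "(\<lambda>n. A n \<epsilon>0) \<longlonglongrightarrow> \<infinity>"
  shows "has_cutoff A \<longleftrightarrow> has_cutoff B"
    and "has_cutoff A \<Longrightarrow> 0 < \<epsilon> \<Longrightarrow> \<epsilon> < 1 \<Longrightarrow> ev_pos_finite (\<lambda>n. B n \<epsilon>) \<and> (\<lambda>n. A n \<epsilon> / B n \<epsilon>) \<longlonglongrightarrow> 1"
proof -
  let ?I = "{0<..<1::real}"
  have *: "has_cutoff B \<and> (\<forall>\<epsilon>\<in>?I. ev_pos_finite (\<lambda>n. B n \<epsilon>) \<and> (\<lambda>n. A n \<epsilon> / B n \<epsilon>) \<longlonglongrightarrow> 1)"
    if cut: "has_cutoff A"
  proof -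
    have fA: "ev_pos_finite (\<lambda>n. A n \<epsilon>)" if "\<epsilon> \<in> ?I" for \<epsilon>
      using cut that unfolding has_cutoff_iff[of A, OF nnA] by blast
    have aA: "asym_le (\<lambda>n. A n \<epsilon>) (\<lambda>n. A n \<eta>)" if "\<epsilon> \<in> ?I" "\<eta> \<in> ?I" for \<epsilon> \<eta>
      using cut that unfolding has_cutoff_iff[of A, OF nnA] by blast
    have iA: "(\<lambda>n. A n \<epsilon>) \<longlonglongrightarrow> \<infinity>" if "\<epsilon> \<in> ?I" for \<epsilon>
      using asym_le_tendsto_PInfty[OF inf aA] e0 that by simp
    have aBA: "asym_le (\<lambda>n. B n \<epsilon>) (\<lambda>n. A n \<eta>)" if e: "\<epsilon> \<in> ?I" "\<eta> \<in> ?I" for \<epsilon> \<eta>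
    proof (rule asym_le_via[OF _ iA[OF e(2)]])
      fix \<theta> :: real assume \<theta>: "0 < \<theta>"
      obtain \<epsilon>' S where "0 < \<epsilon>'" "\<epsilon>' < 1" "\<forall>\<^sub>F n in sequentially. B n \<epsilon> \<le> ereal (1 + \<theta>) * A n \<epsilon>' + ereal S"
        using BA[of \<epsilon> \<theta>] e \<theta> by auto
      moreover have "asym_le (\<lambda>n. A n \<epsilon>') (\<lambda>n. A n \<eta>)"
        using calculation e by (intro aA) auto
      ultimately show "\<exists>c S. asym_le c (\<lambda>n. A n \<eta>) \<and> (\<forall>\<^sub>F n in sequentially. B n \<epsilon> \<le> ereal (1 + \<theta>) * c n + ereal S)"
        by blast
    qed
    have iB: "(\<lambda>n. B n \<epsilon>) \<longlonglongrightarrow> \<infinity>" if e: "\<epsilon> \<in> ?I" for \<epsilon>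
    proof -
      have m: "\<epsilon> < (1 + \<epsilon>) / 2" "(1 + \<epsilon>) / 2 \<in> ?I"
        using e by auto
      obtain S where S: "\<forall>\<^sub>F n in sequentially. A n ((1 + \<epsilon>) / 2) \<le> ereal (1 + 1) * B n \<epsilon> + ereal S"
        using AB[of \<epsilon> "(1 + \<epsilon>) / 2" 1] e m by auto
      then show ?thesis
        by (rule tendsto_PInfty_lower_bound[OF iA[OF m(2)], rotated]) simp
    qed
    have aAB: "asym_le (\<lambda>n. A n \<eta>) (\<lambda>n. B n \<epsilon>)" if e: "\<epsilon> \<in> ?I" "\<eta> \<in> ?I" for \<epsilon> \<eta>
    proof (rule asym_le_trans[OF aA _ iB[OF e(1)]])
      show "\<eta> \<in> ?I" "(1 + \<epsilon>) / 2 \<in> ?I"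
        using e by auto
      show "asym_le (\<lambda>n. A n ((1 + \<epsilon>) / 2)) (\<lambda>n. B n \<epsilon>)"
      proof (rule asym_le_via[OF _ iB[OF e(1)]])
        fix \<theta> :: real assume "0 < \<theta>"
        then have "\<exists>S. \<forall>\<^sub>F n in sequentially. A n ((1 + \<epsilon>) / 2) \<le> ereal (1 + \<theta>) * B n \<epsilon> + ereal S"
          using AB[of \<epsilon> "(1 + \<epsilon>) / 2" \<theta>] e by auto
        then show "\<exists>c S. asym_le c (\<lambda>n. B n \<epsilon>) \<and> (\<forall>\<^sub>F n in sequentially. A n ((1 + \<epsilon>) / 2) \<le> ereal (1 + \<theta>) * c n + ereal S)"
          using asym_le_refl[of "\<lambda>n. B n \<epsilon>"] nnB by blast
      qed
    qed
    have fB: "ev_pos_finite (\<lambda>n. B n \<epsilon>)" if e: "\<epsilon> \<in> ?I" for \<epsilon>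
    proof -
      obtain \<epsilon>' S where "0 < \<epsilon>'" "\<epsilon>' < 1" "\<forall>\<^sub>F n in sequentially. B n \<epsilon> \<le> ereal (1 + 1) * A n \<epsilon>' + ereal S"
        using BA[of \<epsilon> 1] e by auto
      then show ?thesis
        by (intro ev_pos_finite_of_bound[OF iB[OF e] fA]) auto
    qed
    have "asym_le (\<lambda>n. B n \<epsilon>) (\<lambda>n. B n \<eta>)" if e: "\<epsilon> \<in> ?I" "\<eta> \<in> ?I" for \<epsilon> \<eta>
      by (rule asym_le_trans[OF aBA aAB iB]) (use e in auto)
    then have "has_cutoff B"
      unfolding has_cutoff_iff[of B, OF nnB] using fB by blast
    moreover have "(\<lambda>n. A n \<epsilon> / B n \<epsilon>) \<longlonglongrightarrow> 1" if "\<epsilon> \<in> ?I" for \<epsilon>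
      unfolding ratio_tendsto_1_iff[OF fA[OF that] fB[OF that]] using aAB aBA that by blast
    ultimately show ?thesis
      using fB by blast
  qed
  have "has_cutoff A" if cut: "has_cutoff B"
  proof -
    have fB: "ev_pos_finite (\<lambda>n. B n \<epsilon>)" if "\<epsilon> \<in> ?I" for \<epsilon>
      using cut that unfolding has_cutoff_iff[of B, OF nnB] by blast
    have aB: "asym_le (\<lambda>n. B n \<epsilon>) (\<lambda>n. B n \<eta>)" if "\<epsilon> \<in> ?I" "\<eta> \<in> ?I" for \<epsilon> \<eta>
      using cut that unfolding has_cutoff_iff[of B, OF nnB] by blast
    have "(\<lambda>n. B n (\<epsilon>0 / 2)) \<longlonglongrightarrow> \<infinity>"
    proof -
      obtain S where S: "\<forall>\<^sub>F n in sequentially. A n \<epsilon>0 \<le> ereal (1 + 1) * B n (\<epsilon>0 / 2) + ereal S"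
        using AB[of "\<epsilon>0 / 2" \<epsilon>0 1] e0 by auto
      then show ?thesis
        by (rule tendsto_PInfty_lower_bound[OF inf, rotated]) simp
    qed
    then have iB: "(\<lambda>n. B n \<epsilon>) \<longlonglongrightarrow> \<infinity>" if "\<epsilon> \<in> ?I" for \<epsilon>
      by (rule asym_le_tendsto_PInfty[OF _ aB]) (use e0 that in auto)
    have aAB: "asym_le (\<lambda>n. A n \<eta>) (\<lambda>n. B n \<epsilon>)" if e: "\<epsilon> \<in> ?I" "\<eta> \<in> ?I" for \<epsilon> \<eta>
    proof (rule asym_le_via[OF _ iB[OF e(1)]])
      fix \<theta> :: real assume \<theta>: "0 < \<theta>"
      have "\<exists>S. \<forall>\<^sub>F n in sequentially. A n \<eta> \<le> ereal (1 + \<theta>) * B n (\<eta> / 2) + ereal S"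
        using AB[of "\<eta> / 2" \<eta> \<theta>] e \<theta> by auto
      moreover have "asym_le (\<lambda>n. B n (\<eta> / 2)) (\<lambda>n. B n \<epsilon>)"
        using e by (intro aB) auto
      ultimately show "\<exists>c S. asym_le c (\<lambda>n. B n \<epsilon>) \<and> (\<forall>\<^sub>F n in sequentially. A n \<eta> \<le> ereal (1 + \<theta>) * c n + ereal S)"
        by blast
    qed
    have low: "(\<lambda>n. A n \<epsilon>) \<longlonglongrightarrow> \<infinity> \<and> (\<exists>\<epsilon>'\<in>?I. asym_le (\<lambda>n. B n \<epsilon>') (\<lambda>n. A n \<epsilon>))" if e: "\<epsilon> \<in> ?I" for \<epsilon>
    proof -
      obtain \<epsilon>' S where \<epsilon>': "\<epsilon>' \<in> ?I" and S: "\<forall>\<^sub>F n in sequentially. B n \<epsilon>' \<le> A n \<epsilon> + ereal S"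
        using BA1[of \<epsilon>] e by auto
      then have "\<forall>\<^sub>F n in sequentially. B n \<epsilon>' \<le> ereal 1 * A n \<epsilon> + ereal S"
        by (simp add: one_ereal_def[symmetric])
      then have iA: "(\<lambda>n. A n \<epsilon>) \<longlonglongrightarrow> \<infinity>"
        by (rule tendsto_PInfty_lower_bound[OF iB[OF \<epsilon>'], rotated]) simp
      have "asym_le (\<lambda>n. B n \<epsilon>') (\<lambda>n. A n \<epsilon>)"
      proof (rule asym_le_via[OF _ iA])
        fix \<theta> :: real assume \<theta>: "0 < \<theta>"
        have "\<forall>\<^sub>F n in sequentially. B n \<epsilon>' \<le> ereal (1 + \<theta>) * A n \<epsilon> + ereal S"
          using S nnA[of \<epsilon>]
        proof eventually_elim
          case (elim n)
          show ?case
            using elim(1) add_right_mono[OF le_one_plus_mult[OF elim(2) \<theta>], of "ereal S"] by (rule order_trans)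
        qed
        then show "\<exists>c S. asym_le c (\<lambda>n. A n \<epsilon>) \<and> (\<forall>\<^sub>F n in sequentially. B n \<epsilon>' \<le> ereal (1 + \<theta>) * c n + ereal S)"
          using asym_le_refl[of "\<lambda>n. A n \<epsilon>"] nnA by blast
      qed
      then show ?thesis
        using iA \<epsilon>' by blast
    qed
    have "asym_le (\<lambda>n. A n \<epsilon>) (\<lambda>n. A n \<eta>)" if e: "\<epsilon> \<in> ?I" "\<eta> \<in> ?I" for \<epsilon> \<eta>
    proof -
      obtain \<epsilon>' where "\<epsilon>' \<in> ?I" "asym_le (\<lambda>n. B n \<epsilon>') (\<lambda>n. A n \<eta>)"
        using low[OF e(2)] by blast
      then show ?thesis
        using asym_le_trans[OF aAB[OF _ e(1)]] low[OF e(2)] by blast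
    qed
    moreover have "ev_pos_finite (\<lambda>n. A n \<epsilon>)" if e: "\<epsilon> \<in> ?I" for \<epsilon>
    proof -
      obtain S where S: "\<forall>\<^sub>F n in sequentially. A n \<epsilon> \<le> ereal (1 + 1) * B n (\<epsilon> / 2) + ereal S"
        using AB[of "\<epsilon> / 2" \<epsilon> 1] e by auto
      then show ?thesis
        using low[OF e] e by (intro ev_pos_finite_of_bound[OF _ fB[of "\<epsilon> / 2"]]) auto
    qed
    ultimately show ?thesis
      unfolding has_cutoff_iff[of A, OF nnA] by blast
  qed
  with * show "has_cutoff A \<longleftrightarrow> has_cutoff B"
    by blast
  show "ev_pos_finite (\<lambda>n. B n \<epsilon>) \<and> (\<lambda>n. A n \<epsilon> / B n \<epsilon>) \<longlonglongrightarrow> 1"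
    if "has_cutoff A" "0 < \<epsilon>" "\<epsilon> < 1"
    using *[OF that(1)] that by auto
qed

lemma ereal_divide_cancel_left:
  fixes a b :: ereal
  assumes "0 < p"
  shows "ereal p * a / (ereal p * b) = a / b"
  using assms by (cases a; cases b) (auto simp: zero_less_mult_iff zero_le_mult_iff)

lemma has_cutoff_scale:
  assumes p: "0 < p"
  shows "has_cutoff (\<lambda>n \<epsilon>. ereal p * T n \<epsilon>) \<longleftrightarrow> has_cutoff T"
proof -
  have "0 < ereal p * a \<longleftrightarrow> 0 < a" "ereal p * a < \<infinity> \<longleftrightarrow> a < \<infinity>" for a
    using p by (cases a; auto simp: zero_less_mult_iff)+
  then show ?thesis
    unfolding has_cutoff_def ereal_divide_cancel_left[OF p] by simp
qed

theorem theorem1p1: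
  fixes \<Omega> :: "nat \<Rightarrow> 'a set"
    and K :: "nat \<Rightarrow> 'a \<Rightarrow> 'a \<Rightarrow> real"
    and \<pi> :: "nat \<Rightarrow> 'a \<Rightarrow> real"
    and \<delta> :: real
  assumes "\<And>n. n \<ge> 1 \<Longrightarrow> countable (\<Omega> n)"
    and "\<And>n. n \<ge> 1 \<Longrightarrow> stochastic_matrix (\<Omega> n) (K n)"
    and "\<And>n. n \<ge> 1 \<Longrightarrow> irreducible_chain (\<Omega> n) (K n)"
    and "\<And>n. n \<ge> 1 \<Longrightarrow> positive_recurrent (\<Omega> n) (K n)"
    and "\<And>n. n \<ge> 1 \<Longrightarrow> stationary_distribution (\<Omega> n) (K n) (\<pi> n)"
    and "0 < \<delta>" and "\<delta> < 1"
    and "\<exists>\<epsilon>0. 0 < \<epsilon>0 \<and> \<epsilon>0 < 1 \<and> (\<lambda>n. T_cont (\<Omega> n) (K n) (\<pi> n) \<epsilon>0) \<longlonglongrightarrow> \<infinity>"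
  shows "(has_cutoff (\<lambda>n. T_lazy \<delta> (\<Omega> n) (K n) (\<pi> n)) \<longleftrightarrow>
          has_cutoff (\<lambda>n. T_cont (\<Omega> n) (K n) (\<pi> n))) \<and>
         (has_cutoff (\<lambda>n. T_cont (\<Omega> n) (K n) (\<pi> n)) \<longrightarrow>
          (\<forall>\<epsilon>. 0 < \<epsilon> \<and> \<epsilon> < 1 \<longrightarrow>
            (\<lambda>n. T_cont (\<Omega> n) (K n) (\<pi> n) \<epsilon> / T_lazy \<delta> (\<Omega> n) (K n) (\<pi> n) \<epsilon>)
              \<longlonglongrightarrow> ereal (1 - \<delta>)))"
proof -
  let ?A = "\<lambda>n. T_cont (\<Omega> n) (K n) (\<pi> n)"
  let ?L = "\<lambda>n. T_lazy \<delta> (\<Omega> n) (K n) (\<pi> n)"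
  let ?B = "\<lambda>n \<epsilon>. ereal (1 - \<delta>) * ?L n \<epsilon>"
  have \<delta>: "0 < \<delta>" "\<delta> < 1" "0 < 1 - \<delta>"
    using assms(6,7) by auto
  have mc: "markov_chain (\<Omega> n) (K n) (\<pi> n)" if "1 \<le> n" for n
    using assms(2)[OF that] assms(5)[OF that]
    by (simp add: markov_chain_def stationary_distribution_def)
  obtain \<epsilon>0 where e0: "0 < \<epsilon>0" "\<epsilon>0 < 1" "(\<lambda>n. ?A n \<epsilon>0) \<longlonglongrightarrow> \<infinity>"
    using assms(8) by blast
  have nnA: "\<forall>\<^sub>F n in sequentially. 0 \<le> ?A n \<epsilon>" for \<epsilon>
    by (rule eventually_sequentiallyI[of 1]) (rule markov_chain.T_cont_nonneg[OF mc])
  have nnB: "\<forall>\<^sub>F n in sequentially. 0 \<le> ?B n \<epsilon>" for \<epsilon>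
  proof (rule eventually_sequentiallyI[of 1])
    show "0 \<le> ?B n \<epsilon>" if "1 \<le> n" for n
      using markov_chain.T_lazy_nonneg[OF mc[OF that]] \<delta> by simp
  qed
  have AB: "\<exists>S. \<forall>\<^sub>F n in sequentially. ?A n \<eta> \<le> ereal (1 + \<theta>) * ?B n \<epsilon> + ereal S"
    if e: "0 < \<epsilon>" "\<epsilon> < \<eta>" "\<eta> < 1" "0 < \<theta>" for \<epsilon> \<eta> \<theta>
  proof -
    obtain S where "\<And>\<Omega> (K :: 'a \<Rightarrow> 'a \<Rightarrow> real) \<pi>. markov_chain \<Omega> K \<pi> \<Longrightarrow>
        T_cont \<Omega> K \<pi> \<eta> \<le> ereal (1 + \<theta>) * (ereal (1 - \<delta>) * T_lazy \<delta> \<Omega> K \<pi> \<epsilon>) + ereal S"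
      using T_cont_le_T_lazy[OF \<delta>(1,2) e(2,4)] by blast
    then show ?thesis
      by (blast intro: eventually_sequentiallyI mc)
  qed
  have BA: "\<exists>\<epsilon>' S. 0 < \<epsilon>' \<and> \<epsilon>' < 1 \<and> (\<forall>\<^sub>F n in sequentially. ?B n \<epsilon> \<le> ereal (1 + \<theta>) * ?A n \<epsilon>' + ereal S)"
    if e: "0 < \<epsilon>" "\<epsilon> < 1" "0 < \<theta>" for \<epsilon> \<theta>
  proof -
    obtain \<epsilon>' S where "0 < \<epsilon>'" "\<epsilon>' < 1" "\<And>\<Omega> (K :: 'a \<Rightarrow> 'a \<Rightarrow> real) \<pi>. markov_chain \<Omega> K \<pi> \<Longrightarrow>
        ereal (1 - \<delta>) * T_lazy \<delta> \<Omega> K \<pi> \<epsilon> \<le> ereal (1 + \<theta>) * T_cont \<Omega> K \<pi> \<epsilon>' + ereal S"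
      using T_lazy_le_T_cont[OF \<delta>(1,2) e] by blast
    then show ?thesis
      by (blast intro: eventually_sequentiallyI mc)
  qed
  have BA1: "\<exists>\<epsilon>' S. 0 < \<epsilon>' \<and> \<epsilon>' < 1 \<and> (\<forall>\<^sub>F n in sequentially. ?B n \<epsilon>' \<le> ?A n \<epsilon> + ereal S)"
    if e: "0 < \<epsilon>" "\<epsilon> < 1" for \<epsilon>
  proof -
    obtain \<epsilon>' S where "0 < \<epsilon>'" "\<epsilon>' < 1" "\<And>\<Omega> (K :: 'a \<Rightarrow> 'a \<Rightarrow> real) \<pi>. markov_chain \<Omega> K \<pi> \<Longrightarrow>
        ereal (1 - \<delta>) * T_lazy \<delta> \<Omega> K \<pi> \<epsilon>' \<le> T_cont \<Omega> K \<pi> \<epsilon> + ereal S"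
      using T_lazy_le_T_cont_near_one[OF \<delta>(1,2) e] by blast
    then show ?thesis
      by (blast intro: eventually_sequentiallyI mc)
  qed
  have "has_cutoff ?A \<longleftrightarrow> has_cutoff ?B"
    by (rule cutoff_transfer(1)[of ?A ?B \<epsilon>0]) (fact nnA nnB AB BA BA1 e0)+
  then have iff: "has_cutoff ?A \<longleftrightarrow> has_cutoff ?L"
    using has_cutoff_scale[OF \<delta>(3), of ?L] by simp
  have "(\<lambda>n. ?A n \<epsilon> / ?L n \<epsilon>) \<longlonglongrightarrow> ereal (1 - \<delta>)"
    if cut: "has_cutoff ?A" and \<epsilon>: "0 < \<epsilon>" "\<epsilon> < 1" for \<epsilon>
  proof -
    have "ev_pos_finite (\<lambda>n. ?B n \<epsilon>) \<and> (\<lambda>n. ?A n \<epsilon> / ?B n \<epsilon>) \<longlonglongrightarrow> 1"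
      by (rule cutoff_transfer(2)[of ?A ?B \<epsilon>0]) (fact nnA nnB AB BA BA1 e0 cut \<epsilon>)+
    then have B: "ev_pos_finite (\<lambda>n. ?B n \<epsilon>)" and lim: "(\<lambda>n. ?A n \<epsilon> / ?B n \<epsilon>) \<longlonglongrightarrow> 1"
      by auto
    have "(\<lambda>n. ereal (1 - \<delta>) * (?A n \<epsilon> / ?B n \<epsilon>)) \<longlonglongrightarrow> ereal (1 - \<delta>) * 1"
      by (rule tendsto_cmult_ereal[OF _ lim]) simp
    moreover have "\<forall>\<^sub>F n in sequentially. ereal (1 - \<delta>) * (?A n \<epsilon> / ?B n \<epsilon>) = ?A n \<epsilon> / ?L n \<epsilon>"
      using B unfolding ev_pos_finite_def
    proof eventually_elim
      case (elim n)
      then show ?case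
        using \<delta> by (cases "?L n \<epsilon>"; cases "?A n \<epsilon>") (auto simp: zero_less_mult_iff)
    qed
    ultimately show ?thesis
      using tendsto_cong[of "\<lambda>n. ereal (1 - \<delta>) * (?A n \<epsilon> / ?B n \<epsilon>)"] by simp
  qed
  then show ?thesis
    using iff by blast
qed

end
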